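(* The group $\mathbb{Z}^2$ is flexibly stable in the operator norm.
   Context: For $n\in\mathbb{N}$, let $M_n=M_n(\mathbb{C})$, let $\mathcal{U}_n$ be the group of $n\times n$ unitary matrices, and let $\|\cdot\|$ denote the operator norm. Let $\Gamma$ be a countable discrete group. An asymptotic representation of $\Gamma$ in the operator norm is a sequence of maps $\varphi_n\colon\Gamma\to\mathcal{U}_{d_n}$ (with $(d_n)$ a sequence of positive integers) such that $\|\varphi_n(gh)-\varphi_n(g)\varphi_n(h)\|\to 0$ for every $g,h\in\Gamma$. The group $\Gamma$ is flexibly stable in the operator norm if, for every asymptotic representation $(\varphi_n)$ of $\Gamma$ in the operator norm, there exist integers $k_n\ge d_n$ with $k_n/d_n\to 1$, isometries $W_n\colon\mathbb{C}^{d_n}\to\mathbb{C}^{k_n}$, and genuine unitary representations (group homomorphisms) $\pi_n\colon\Gamma\to\mathcal{U}_{k_n}$ such that $\|W_n^*\pi_n(g)W_n-\varphi_n(g)\|\to 0$ for every $g\in\Gamma$. *)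

theory Defs
  imports
    "HOL-Analysis.L2_Norm"
    "HOL-Library.Countable_Set"
    "HOL-Algebra.Elementary_Groups"
    "Jordan_Normal_Form.Schur_Decomposition"
begin

definition vec_l2_norm :: "complex vec \<Rightarrow> real"
  where "vec_l2_norm v = L2_set (\<lambda>i. cmod (v $ i)) {..<dim_vec v}"

definition mat_op_norm :: "complex mat \<Rightarrow> real"
  where "mat_op_norm A =
    Sup {vec_l2_norm (A *\<^sub>v v) | v. v \<in> carrier_vec (dim_col A) \<and> vec_l2_norm v \<le> 1}"

text \<open>A \<open>k \<times> d\<close> matrix is an isometry from \<open>d\<close>-dimensional to \<open>k\<close>-dimensional
  complex Euclidean space.\<close>

definition isometry_mat :: "nat \<Rightarrow> nat \<Rightarrow> complex mat \<Rightarrow> bool"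
  where "isometry_mat d k W \<longleftrightarrow> W \<in> carrier_mat k d \<and> mat_adjoint W * W = 1\<^sub>m d"

definition unitary_group :: "nat \<Rightarrow> complex mat monoid"
  where "unitary_group n =
    \<lparr>carrier = {U \<in> carrier_mat n n. mat_adjoint U * U = 1\<^sub>m n \<and> U * mat_adjoint U = 1\<^sub>m n},
     monoid.mult = (*), one = 1\<^sub>m n\<rparr>"

lemma mat_adjoint_carrier [simp]:
  "A \<in> carrier_mat m n \<Longrightarrow> mat_adjoint A \<in> carrier_mat n m"
  by (auto simp: mat_adjoint_def mat_of_rows_def)

lemma dim_mat_adjoint [simp]:
  "dim_row (mat_adjoint A) = dim_col A" "dim_col (mat_adjoint A) = dim_row A"
  by (auto simp: mat_adjoint_def mat_of_rows_def)

lemma mat_adjoint_index: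
  assumes "A \<in> carrier_mat m n" "i < n" "j < m"
  shows "mat_adjoint A $$ (i, j) = conjugate (A $$ (j, i))"
  using assms by (auto simp: mat_adjoint_def mat_of_rows_def)

lemma mat_adjoint_adjoint:
  assumes "(A :: complex mat) \<in> carrier_mat m n"
  shows "mat_adjoint (mat_adjoint A) = A"
proof (rule eq_matI)
  note A' = mat_adjoint_carrier[OF assms]
  show "dim_row (mat_adjoint (mat_adjoint A)) = dim_row A"
    "dim_col (mat_adjoint (mat_adjoint A)) = dim_col A"
    by simp_all
  fix i j assume "i < dim_row A" "j < dim_col A"
  then have "i < m" "j < n" using assms by auto
  then show "mat_adjoint (mat_adjoint A) $$ (i, j) = A $$ (i, j)"
    by (simp add: mat_adjoint_index[OF A'] mat_adjoint_index[OF assms])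
qed

lemma mat_adjoint_mult:
  assumes A: "(A :: complex mat) \<in> carrier_mat m n" and B: "B \<in> carrier_mat n l"
  shows "mat_adjoint (A * B) = mat_adjoint B * mat_adjoint A"
proof (rule eq_matI)
  note A' = mat_adjoint_carrier[OF A]
  note B' = mat_adjoint_carrier[OF B]
  have AB: "A * B \<in> carrier_mat m l" using A B by auto
  note AB' = mat_adjoint_carrier[OF AB]
  show "dim_row (mat_adjoint (A * B)) = dim_row (mat_adjoint B * mat_adjoint A)"
    "dim_col (mat_adjoint (A * B)) = dim_col (mat_adjoint B * mat_adjoint A)"
    using A' B' AB' by auto
  fix i j
  assume "i < dim_row (mat_adjoint B * mat_adjoint A)" "j < dim_col (mat_adjoint B * mat_adjoint A)"
  then have ij: "i < l" "j < m" using A' B' by auto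
  have "mat_adjoint (A * B) $$ (i, j) = cnj (\<Sum>k = 0..<n. A $$ (j, k) * B $$ (k, i))"
    using ij A B by (simp add: mat_adjoint_index[OF AB] scalar_prod_def)
  also have "\<dots> = (\<Sum>k = 0..<n. mat_adjoint B $$ (i, k) * mat_adjoint A $$ (k, j))"
    using ij by (simp add: mat_adjoint_index[OF A] mat_adjoint_index[OF B] mult.commute)
  also have "\<dots> = (mat_adjoint B * mat_adjoint A) $$ (i, j)"
    using ij A B by (simp add: scalar_prod_def)
  finally show "mat_adjoint (A * B) $$ (i, j) = (mat_adjoint B * mat_adjoint A) $$ (i, j)" .
qed

lemma mat_adjoint_one [simp]: "mat_adjoint (1\<^sub>m n :: complex mat) = 1\<^sub>m n"
proof (rule eq_matI)
  have one: "(1\<^sub>m n :: complex mat) \<in> carrier_mat n n" by simp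
  show "dim_row (mat_adjoint (1\<^sub>m n :: complex mat)) = dim_row (1\<^sub>m n :: complex mat)"
    "dim_col (mat_adjoint (1\<^sub>m n :: complex mat)) = dim_col (1\<^sub>m n :: complex mat)"
    by simp_all
  fix i j assume "i < dim_row (1\<^sub>m n :: complex mat)" "j < dim_col (1\<^sub>m n :: complex mat)"
  then show "mat_adjoint (1\<^sub>m n :: complex mat) $$ (i, j) = 1\<^sub>m n $$ (i, j)"
    by (simp add: mat_adjoint_index[OF one])
qed

lemma group_unitary_group: "group (unitary_group n)"
proof (rule groupI)
  fix U V assume "U \<in> carrier (unitary_group n)" "V \<in> carrier (unitary_group n)"
  then have U: "U \<in> carrier_mat n n" "mat_adjoint U * U = 1\<^sub>m n" "U * mat_adjoint U = 1\<^sub>m n"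
    and V: "V \<in> carrier_mat n n" "mat_adjoint V * V = 1\<^sub>m n" "V * mat_adjoint V = 1\<^sub>m n"
    by (auto simp: unitary_group_def)
  note U' = mat_adjoint_carrier[OF U(1)] and V' = mat_adjoint_carrier[OF V(1)]
  have UV: "U * V \<in> carrier_mat n n" and VU': "mat_adjoint V * mat_adjoint U \<in> carrier_mat n n"
    using U(1) V(1) U' V' by auto
  have "(mat_adjoint V * mat_adjoint U) * (U * V) = mat_adjoint V * ((mat_adjoint U * U) * V)"
    using assoc_mult_mat[OF V' U' UV] assoc_mult_mat[OF U' U(1) V(1)] by simp
  moreover have "(U * V) * (mat_adjoint V * mat_adjoint U) = U * ((V * mat_adjoint V) * mat_adjoint U)"
    using assoc_mult_mat[OF U(1) V(1) VU'] assoc_mult_mat[OF V(1) V' U'] by simp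
  ultimately show "U \<otimes>\<^bsub>unitary_group n\<^esub> V \<in> carrier (unitary_group n)"
    using U V U' V' by (simp add: unitary_group_def mat_adjoint_mult[OF U(1) V(1)])
next
  show "\<one>\<^bsub>unitary_group n\<^esub> \<in> carrier (unitary_group n)" by (simp add: unitary_group_def)
next
  fix U V X
  assume "U \<in> carrier (unitary_group n)" "V \<in> carrier (unitary_group n)" "X \<in> carrier (unitary_group n)"
  then show "U \<otimes>\<^bsub>unitary_group n\<^esub> V \<otimes>\<^bsub>unitary_group n\<^esub> X =
    U \<otimes>\<^bsub>unitary_group n\<^esub> (V \<otimes>\<^bsub>unitary_group n\<^esub> X)"
    by (auto simp: unitary_group_def intro: assoc_mult_mat)
next
  fix U assume "U \<in> carrier (unitary_group n)"
  then show "\<one>\<^bsub>unitary_group n\<^esub> \<otimes>\<^bsub>unitary_group n\<^esub> U = U"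
    by (auto simp: unitary_group_def)
next
  fix U assume "U \<in> carrier (unitary_group n)"
  then show "\<exists>V\<in>carrier (unitary_group n). V \<otimes>\<^bsub>unitary_group n\<^esub> U = \<one>\<^bsub>unitary_group n\<^esub>"
    by (intro bexI[of _ "mat_adjoint U"]) (auto simp: unitary_group_def mat_adjoint_adjoint)
qed

definition asymptotic_rep ::
    "('a, 'b) monoid_scheme \<Rightarrow> (nat \<Rightarrow> nat) \<Rightarrow> (nat \<Rightarrow> 'a \<Rightarrow> complex mat) \<Rightarrow> bool"
  where "asymptotic_rep G d \<phi> \<longleftrightarrow>
    (\<forall>n. d n > 0) \<and>
    (\<forall>n. \<phi> n \<in> carrier G \<rightarrow> carrier (unitary_group (d n))) \<and>
    (\<forall>g\<in>carrier G. \<forall>h\<in>carrier G.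
      (\<lambda>n. mat_op_norm (\<phi> n (g \<otimes>\<^bsub>G\<^esub> h) - \<phi> n g * \<phi> n h)) \<longlonglongrightarrow> 0)"

text \<open>The following is meant for countable (discrete) groups \<open>G\<close>.\<close>

definition flexibly_stable :: "('a, 'b) monoid_scheme \<Rightarrow> bool"
  where "flexibly_stable G \<longleftrightarrow>
    (\<forall>d \<phi>. asymptotic_rep G d \<phi> \<longrightarrow>
      (\<exists>k W \<pi>.
        (\<forall>n. k n \<ge> d n) \<and>
        (\<lambda>n. real (k n) / real (d n)) \<longlonglongrightarrow> 1 \<and>
        (\<forall>n. isometry_mat (d n) (k n) (W n)) \<and>
        (\<forall>n. \<pi> n \<in> hom G (unitary_group (k n))) \<and>
        (\<forall>g\<in>carrier G.
          (\<lambda>n. mat_op_norm (mat_adjoint (W n) * \<pi> n g * W n - \<phi> n g)) \<longlonglongrightarrow> 0)))"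

abbreviation Z2_group :: "(int \<times> int) monoid"
  where "Z2_group \<equiv> integer_group \<times>\<times> integer_group"

lemma group_Z2_group: "group Z2_group"
  by (simp add: DirProd_group)

lemma countable_Z2_group: "countable (carrier Z2_group)"
  by (rule countableI_type)

end

theory Submission
  imports Defs "HOL-Analysis.Weierstrass_Theorems" "Jordan_Normal_Form.Spectral_Radius"
begin

text \<open>Let \<open>U\<close> and \<open>V\<close> be almost commuting unitaries, with \<open>U\<close> diagonal. Cover the spectrum of \<open>U\<close> by
  finitely many small overlapping cells, and let \<open>f\<^sub>j\<close> be continuous functions supported in the cells
  with \<open>\<Sum>\<^sub>j f\<^sub>j\<^sup>2 = 1\<close>. Translating the cells, one can arrange that few eigenvalues lie in the overlaps.
  Let \<open>H\<^sub>j\<close> be the spectral subspace of the cell \<open>j\<close>. The map \<open>W x = (f\<^sub>j(U) x)\<^sub>j\<close> is an isometry into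
  \<open>\<Oplus>\<^sub>j H\<^sub>j\<close>, whose dimension is only slightly larger than that of the original space. Let \<open>U'\<close> act on
  \<open>H\<^sub>j\<close> as a scalar close to the spectrum of \<open>U\<close> in the cell, and let \<open>V'\<close> act on \<open>H\<^sub>j\<close> as the unitary
  part of the compression of \<open>V\<close>. Then \<open>U'\<close> and \<open>V'\<close> commute exactly. Since \<open>V\<close> almost commutes with
  \<open>f\<^sub>j(U)\<close>, the compression agrees up to a small error with \<open>V\<close>, hence is almost isometric, on the range
  of \<open>f\<^sub>j(U)\<close>; therefore \<open>W\<close> almost intertwines \<open>(U, V)\<close> with \<open>(U', V')\<close>. No index obstruction arises
  because the extra unitaries on the overlaps may wrap around inside a cell, where \<open>U'\<close> is constant.\<close>

section \<open>Euclidean and operator norms\<close>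

text \<open>Ordinary stability fails for this group: Voiculescu's clock and shift matrices almost
  commute but stay far from all commuting pairs of the same size, by a winding number. Extra
  dimensions are needed, and they must be few relative to \<open>d\<close>. The shape of the proof
  comes from uniformity. The tolerance \<delta> for the commutator may depend on \<epsilon> only,
  whereas a cover with few eigenvalues in its overlaps depends on the spectrum of \<open>U\<close>.
  So the cover is taken from a finite list fixed in advance, and one \<delta> serves the whole list.
  The commutators with \<open>f\<^sub>j(U)\<close> are controlled through polynomial approximation
  of \<open>f\<^sub>j\<close>, with constants that see neither the dimension nor the matrices.
  Errors are measured by \<open>U' W - W U\<close>, not by the compression of \<open>U'\<close> to
  the range of \<open>W\<close>: approximate intertwining passes to products and inverses, hence
  from the two generators to the whole group, and it yields the compression at the end. The
  compression of \<open>V\<close> to a cell can be far from isometric, even singular, on vectors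
  near the edge of the cell; its unitary part is compared with it only on the range of
  \<open>f\<^sub>j(U)\<close>.\<close>

no_notation inner (infix \<open>\<bullet>\<close> 70)
no_notation vec_nth (infixl \<open>$\<close> 90)
hide_type (open) Finite_Cartesian_Product.vec
hide_const (open) Finite_Cartesian_Product.vec Finite_Cartesian_Product.mat Finite_Cartesian_Product.row

notation vec_l2_norm (\<open>\<parallel>_\<parallel>\<close>)

lemma vec_l2_norm_nonneg [simp]: "0 \<le> \<parallel>v\<parallel>"
  by (simp add: vec_l2_norm_def L2_set_nonneg)

lemma vec_l2_norm_sq: "\<parallel>v\<parallel>\<^sup>2 = (\<Sum>i<dim_vec v. (cmod (v $ i))\<^sup>2)"
  by (simp add: vec_l2_norm_def L2_set_def sum_nonneg)

lemma vec_l2_norm_zero [simp]: "\<parallel>0\<^sub>v n\<parallel> = 0"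
  by (simp add: vec_l2_norm_def L2_set_def)

lemma vec_l2_norm_eq_0:
  assumes "v \<in> carrier_vec n" "\<parallel>v\<parallel> = 0"
  shows "v = 0\<^sub>v n"
proof -
  have "(\<Sum>i<dim_vec v. (cmod (v $ i))\<^sup>2) = 0"
    using assms vec_l2_norm_sq[of v] by simp
  then have "\<forall>i<dim_vec v. v $ i = 0"
    by (subst (asm) sum_nonneg_eq_0_iff) auto
  then show ?thesis using assms by auto
qed

lemma vec_l2_norm_triangle:
  assumes "dim_vec v = dim_vec w"
  shows "\<parallel>v + w\<parallel> \<le> \<parallel>v\<parallel> + \<parallel>w\<parallel>"
proof -
  have "\<parallel>v + w\<parallel> \<le> L2_set (\<lambda>i. cmod (v $ i) + cmod (w $ i)) {..<dim_vec w}"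
    unfolding vec_l2_norm_def
    by (simp add: index_add_vec, intro L2_set_mono) (auto intro: norm_triangle_ineq)
  also have "\<dots> \<le> \<parallel>v\<parallel> + \<parallel>w\<parallel>"
    unfolding vec_l2_norm_def assms by (rule L2_set_triangle_ineq)
  finally show ?thesis .
qed

lemma vec_l2_norm_smult [simp]: "\<parallel>c \<cdot>\<^sub>v v\<parallel> = cmod c * \<parallel>v\<parallel>"
proof -
  have "L2_set (\<lambda>i. cmod ((c \<cdot>\<^sub>v v) $ i)) {..<dim_vec v} = L2_set (\<lambda>i. cmod c * cmod (v $ i)) {..<dim_vec v}"
    by (intro L2_set_cong) (auto simp: norm_mult)
  then show ?thesis by (simp add: vec_l2_norm_def L2_set_right_distrib)
qed

lemma vec_l2_norm_uminus [simp]: "\<parallel>- v\<parallel> = \<parallel>v\<parallel>"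
  by (simp add: vec_l2_norm_def L2_set_def)

lemma vec_l2_norm_minus_commute:
  assumes "dim_vec v = dim_vec w"
  shows "\<parallel>v - w\<parallel> = \<parallel>w - v\<parallel>"
proof -
  have "L2_set (\<lambda>i. cmod ((v - w) $ i)) {..<dim_vec w} = L2_set (\<lambda>i. cmod ((w - v) $ i)) {..<dim_vec w}"
    using assms by (intro L2_set_cong) (auto simp: norm_minus_commute)
  then show ?thesis using assms by (simp add: vec_l2_norm_def)
qed

lemma vec_l2_norm_triangle_minus:
  assumes "dim_vec v = dim_vec w"
  shows "\<parallel>v - w\<parallel> \<le> \<parallel>v\<parallel> + \<parallel>w\<parallel>"
proof -
  have "v - w = v + (- w)" using assms by auto
  then show ?thesis using vec_l2_norm_triangle[of v "- w"] assms by simp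
qed

lemma vec_l2_norm_diff_triangle:
  assumes "v \<in> carrier_vec n" "w \<in> carrier_vec n" "z \<in> carrier_vec n"
    and "\<parallel>v - w\<parallel> \<le> a" "\<parallel>w - z\<parallel> \<le> b"
  shows "\<parallel>v - z\<parallel> \<le> a + b"
proof -
  have "v - z = (v - w) + (w - z)" using assms by auto
  then have "\<parallel>v - z\<parallel> \<le> \<parallel>v - w\<parallel> + \<parallel>w - z\<parallel>"
    using vec_l2_norm_triangle[of "v - w" "w - z"] assms by simp
  then show ?thesis using assms by simp
qed

lemma vec_l2_norm_mono_le:
  assumes "dim_vec v = dim_vec w" "\<And>i. i < dim_vec w \<Longrightarrow> cmod (v $ i) \<le> c * cmod (w $ i)"
    and "0 \<le> c"
  shows "\<parallel>v\<parallel> \<le> c * \<parallel>w\<parallel>"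
proof -
  have "\<parallel>v\<parallel> \<le> L2_set (\<lambda>i. c * cmod (w $ i)) {..<dim_vec w}"
    unfolding vec_l2_norm_def assms(1) using assms by (intro L2_set_mono) auto
  then show ?thesis using assms(3) by (simp add: vec_l2_norm_def L2_set_right_distrib)
qed

lemma cscalar_prod_self: "v \<bullet>c v = complex_of_real (\<parallel>v\<parallel>\<^sup>2)" for v :: "complex vec"
  by (simp add: vec_l2_norm_sq scalar_prod_def atLeast0LessThan complex_norm_square
      del: of_real_power)

lemma cscalar_prod_mult_mat_vec:
  fixes A :: "complex mat"
  assumes A: "A \<in> carrier_mat m n" and v: "v \<in> carrier_vec n" and w: "w \<in> carrier_vec m"
  shows "(A *\<^sub>v v) \<bullet>c w = v \<bullet>c (mat_adjoint A *\<^sub>v w)"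
proof -
  have "(A *\<^sub>v v) \<bullet>c w = (\<Sum>i<m. \<Sum>j<n. A $$ (i, j) * v $ j * cnj (w $ i))"
    using assms by (simp add: scalar_prod_def atLeast0LessThan sum_distrib_right)
  also have "\<dots> = (\<Sum>j<n. \<Sum>i<m. A $$ (i, j) * v $ j * cnj (w $ i))"
    by (rule sum.swap)
  also have "\<dots> = v \<bullet>c (mat_adjoint A *\<^sub>v w)"
    using assms by (simp add: scalar_prod_def atLeast0LessThan sum_distrib_left
        mat_adjoint_index[OF A] mult_ac)
  finally show ?thesis .
qed

lemma vec_l2_norm_isometry:
  fixes A :: "complex mat"
  assumes A: "A \<in> carrier_mat m n" and iso: "mat_adjoint A * A = 1\<^sub>m n" and v: "v \<in> carrier_vec n"
  shows "\<parallel>A *\<^sub>v v\<parallel> = \<parallel>v\<parallel>"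
proof -
  have "(A *\<^sub>v v) \<bullet>c (A *\<^sub>v v) = v \<bullet>c (mat_adjoint A *\<^sub>v (A *\<^sub>v v))"
    using A v by (intro cscalar_prod_mult_mat_vec) auto
  also have "mat_adjoint A *\<^sub>v (A *\<^sub>v v) = v"
    using iso v by (simp add: assoc_mult_mat_vec[OF mat_adjoint_carrier[OF A] A v, symmetric])
  finally have "\<parallel>A *\<^sub>v v\<parallel>\<^sup>2 = \<parallel>v\<parallel>\<^sup>2"
    unfolding cscalar_prod_self of_real_eq_iff .
  then show ?thesis by simp
qed

lemma cmod_cscalar_prod_le:
  assumes "v \<in> carrier_vec n" "w \<in> carrier_vec n"
  shows "cmod (v \<bullet>c w) \<le> \<parallel>v\<parallel> * \<parallel>w\<parallel>"
proof -
  have "cmod (v \<bullet>c w) \<le> (\<Sum>i<n. \<bar>cmod (v $ i)\<bar> * \<bar>cmod (w $ i)\<bar>)"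
    using assms by (simp add: scalar_prod_def atLeast0LessThan)
      (rule order_trans[OF norm_sum], simp add: norm_mult)
  also have "\<dots> \<le> \<parallel>v\<parallel> * \<parallel>w\<parallel>"
    using assms L2_set_mult_ineq[of "\<lambda>i. cmod (v $ i)" "\<lambda>i. cmod (w $ i)" "{..<n}"]
    by (simp add: vec_l2_norm_def)
  finally show ?thesis .
qed

text \<open>A pointwise inequality replaces the supremum in all estimates. The operator norm itself
  is met again only in the hypothesis and the conclusion of the final theorem.\<close>

definition norm_bounded_by :: "complex mat \<Rightarrow> real \<Rightarrow> bool"
  where "norm_bounded_by A c \<longleftrightarrow> (\<forall>v\<in>carrier_vec (dim_col A). \<parallel>A *\<^sub>v v\<parallel> \<le> c * \<parallel>v\<parallel>)"

lemma norm_bounded_byD: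
  "norm_bounded_by A c \<Longrightarrow> A \<in> carrier_mat m n \<Longrightarrow> v \<in> carrier_vec n \<Longrightarrow> \<parallel>A *\<^sub>v v\<parallel> \<le> c * \<parallel>v\<parallel>"
  by (auto simp: norm_bounded_by_def)

lemma norm_bounded_byI:
  "A \<in> carrier_mat m n \<Longrightarrow> (\<And>v. v \<in> carrier_vec n \<Longrightarrow> \<parallel>A *\<^sub>v v\<parallel> \<le> c * \<parallel>v\<parallel>) \<Longrightarrow> norm_bounded_by A c"
  by (auto simp: norm_bounded_by_def)

text \<open>Cauchy-Schwarz in every row, with the Frobenius norm as constant. This makes the
  supremum in \<open>mat_op_norm\<close> one of a bounded set.\<close>

lemma norm_bounded_by_exists: "\<exists>c. norm_bounded_by A c"
proof -
  define c where "c = L2_set (\<lambda>i. \<parallel>conjugate (row A i)\<parallel>) {..<dim_row A}"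
  have "\<parallel>A *\<^sub>v v\<parallel> \<le> c * \<parallel>v\<parallel>" if v: "v \<in> carrier_vec (dim_col A)" for v
  proof -
    have "cmod ((A *\<^sub>v v) $ i) \<le> \<parallel>v\<parallel> * \<parallel>conjugate (row A i)\<parallel>" if i: "i < dim_row A" for i
    proof -
      have r: "row A i \<in> carrier_vec (dim_col A)" by auto
      have "(A *\<^sub>v v) $ i = v \<bullet>c conjugate (row A i)"
        using i v r by (simp add: comm_scalar_prod[OF r v])
      then show ?thesis
        using cmod_cscalar_prod_le[of v "dim_col A" "conjugate (row A i)"] v r by simp
    qed
    then have "\<parallel>A *\<^sub>v v\<parallel> \<le> L2_set (\<lambda>i. \<parallel>v\<parallel> * \<parallel>conjugate (row A i)\<parallel>) {..<dim_row A}"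
      by (simp add: vec_l2_norm_def[of "A *\<^sub>v v"] del: index_mult_mat_vec) (intro L2_set_mono, auto)
    then show ?thesis
      by (simp add: c_def L2_set_right_distrib mult.commute)
  qed
  then show ?thesis by (auto simp: norm_bounded_by_def)
qed

lemma mat_op_norm_bdd_above:
  "bdd_above {\<parallel>A *\<^sub>v v\<parallel> | v. v \<in> carrier_vec (dim_col A) \<and> \<parallel>v\<parallel> \<le> 1}"
proof -
  obtain c where c: "norm_bounded_by A c" using norm_bounded_by_exists by blast
  show ?thesis
  proof (rule bdd_aboveI)
    fix x assume "x \<in> {\<parallel>A *\<^sub>v v\<parallel> | v. v \<in> carrier_vec (dim_col A) \<and> \<parallel>v\<parallel> \<le> 1}"
    then obtain v where v: "x = \<parallel>A *\<^sub>v v\<parallel>" "v \<in> carrier_vec (dim_col A)" "\<parallel>v\<parallel> \<le> 1" by blast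
    then have "x \<le> c * \<parallel>v\<parallel>" using c by (auto simp: norm_bounded_by_def)
    also have "\<dots> \<le> \<bar>c\<bar> * 1" using v(3) by (intro mult_mono) auto
    finally show "x \<le> \<bar>c\<bar>" by simp
  qed
qed

lemma mat_op_norm_upper:
  assumes "v \<in> carrier_vec (dim_col A)" "\<parallel>v\<parallel> \<le> 1"
  shows "\<parallel>A *\<^sub>v v\<parallel> \<le> mat_op_norm A"
  unfolding mat_op_norm_def by (rule cSup_upper[OF _ mat_op_norm_bdd_above]) (use assms in blast)

lemma mat_op_norm_nonneg: "0 \<le> mat_op_norm A"
  by (rule order_trans[OF vec_l2_norm_nonneg mat_op_norm_upper[of "0\<^sub>v (dim_col A)" A]]) auto

lemma norm_bounded_by_mat_op_norm: "norm_bounded_by A (mat_op_norm A)"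
  unfolding norm_bounded_by_def
proof
  fix v :: "complex vec" assume v: "v \<in> carrier_vec (dim_col A)"
  show "\<parallel>A *\<^sub>v v\<parallel> \<le> mat_op_norm A * \<parallel>v\<parallel>"
  proof (cases "\<parallel>v\<parallel> = 0")
    case True
    then have "v = 0\<^sub>v (dim_col A)" using vec_l2_norm_eq_0 v by blast
    then have "A *\<^sub>v v = 0\<^sub>v (dim_row A)" by (auto intro!: eq_vecI)
    then show ?thesis using True by simp
  next
    case False
    define w where "w = complex_of_real (1 / \<parallel>v\<parallel>) \<cdot>\<^sub>v v"
    have w: "w \<in> carrier_vec (dim_col A)" "\<parallel>w\<parallel> = 1" using v False by (auto simp: w_def norm_divide)
    have "A *\<^sub>v w = complex_of_real (1 / \<parallel>v\<parallel>) \<cdot>\<^sub>v (A *\<^sub>v v)"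
      unfolding w_def using v by (intro mult_mat_vec[of A "dim_row A" "dim_col A"]) auto
    then have "\<parallel>A *\<^sub>v v\<parallel> / \<parallel>v\<parallel> \<le> mat_op_norm A"
      using mat_op_norm_upper[OF w(1)] w(2) by (simp add: norm_divide)
    then show ?thesis using False by (simp add: pos_divide_le_eq less_le)
  qed
qed

lemma mat_op_norm_le:
  assumes "norm_bounded_by A c" "0 \<le> c"
  shows "mat_op_norm A \<le> c"
  unfolding mat_op_norm_def
proof (rule cSup_least)
  show "{\<parallel>A *\<^sub>v v\<parallel> | v. v \<in> carrier_vec (dim_col A) \<and> \<parallel>v\<parallel> \<le> 1} \<noteq> {}"
    by (auto intro!: exI[of _ "0\<^sub>v (dim_col A)"])
  fix x assume "x \<in> {\<parallel>A *\<^sub>v v\<parallel> | v. v \<in> carrier_vec (dim_col A) \<and> \<parallel>v\<parallel> \<le> 1}"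
  then obtain v where v: "x = \<parallel>A *\<^sub>v v\<parallel>" "v \<in> carrier_vec (dim_col A)" "\<parallel>v\<parallel> \<le> 1" by blast
  then have "x \<le> c * \<parallel>v\<parallel>" using assms by (auto simp: norm_bounded_by_def)
  also have "\<dots> \<le> c * 1" using v(3) assms by (intro mult_left_mono)
  finally show "x \<le> c" by simp
qed

section \<open>Unitary matrices\<close>

lemma unitary_groupD:
  assumes "U \<in> carrier (unitary_group n)"
  shows "U \<in> carrier_mat n n" "mat_adjoint U * U = 1\<^sub>m n" "U * mat_adjoint U = 1\<^sub>m n"
    "mat_adjoint U \<in> carrier_mat n n"
  using assms by (auto simp: unitary_group_def)

lemma unitary_groupI:
  fixes U :: "complex mat"
  assumes "U \<in> carrier_mat n n" "mat_adjoint U * U = 1\<^sub>m n"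
  shows "U \<in> carrier (unitary_group n)"
  using assms mat_mult_left_right_inverse[of "mat_adjoint U" n U] by (auto simp: unitary_group_def)

lemma mat_adjoint_unitary:
  assumes "U \<in> carrier (unitary_group n)"
  shows "mat_adjoint U \<in> carrier (unitary_group n)"
  using unitary_groupD[OF assms] by (auto simp: unitary_group_def mat_adjoint_adjoint)

lemma vec_l2_norm_unitary:
  assumes "U \<in> carrier (unitary_group n)" "v \<in> carrier_vec n"
  shows "\<parallel>U *\<^sub>v v\<parallel> = \<parallel>v\<parallel>"
  using vec_l2_norm_isometry[of U n n v] unitary_groupD[OF assms(1)] assms(2) by auto

lemma unitary_mult:
  assumes "U \<in> carrier (unitary_group n)" "V \<in> carrier (unitary_group n)"
  shows "U * V \<in> carrier (unitary_group n)"
  using monoid.m_closed[OF group.is_monoid[OF group_unitary_group[of n]] assms] by (simp add: unitary_group_def)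

lemma one_unitary: "1\<^sub>m n \<in> carrier (unitary_group n)"
  by (simp add: unitary_group_def)

section \<open>Diagonalization of normal matrices\<close>

lemma adjoint_mult_cancel:
  fixes A B :: "complex mat"
  assumes "A \<in> carrier_mat m n" "mat_adjoint A * A = 1\<^sub>m n" "B \<in> carrier_mat n l"
  shows "mat_adjoint A * (A * B) = B"
  using assms by (simp add: assoc_mult_mat[OF mat_adjoint_carrier[OF assms(1)] assms(1) assms(3), symmetric])

lemma unitary_cancel:
  assumes Q: "Q \<in> carrier (unitary_group n)"
  shows "B \<in> carrier_mat n l \<Longrightarrow> mat_adjoint Q * (Q * B) = B"
    and "B \<in> carrier_mat n l \<Longrightarrow> Q * (mat_adjoint Q * B) = B"
    and "v \<in> carrier_vec n \<Longrightarrow> mat_adjoint Q *\<^sub>v (Q *\<^sub>v v) = v"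
    and "v \<in> carrier_vec n \<Longrightarrow> Q *\<^sub>v (mat_adjoint Q *\<^sub>v v) = v"
proof -
  note q = unitary_groupD[OF Q]
  show "mat_adjoint Q * (Q * B) = B" if "B \<in> carrier_mat n l"
    using q that by (simp add: assoc_mult_mat[OF q(4) q(1) that, symmetric])
  show "Q * (mat_adjoint Q * B) = B" if "B \<in> carrier_mat n l"
    using q that by (simp add: assoc_mult_mat[OF q(1) q(4) that, symmetric])
  show "mat_adjoint Q *\<^sub>v (Q *\<^sub>v v) = v" if "v \<in> carrier_vec n"
    using q that by (simp add: assoc_mult_mat_vec[OF q(4) q(1) that, symmetric])
  show "Q *\<^sub>v (mat_adjoint Q *\<^sub>v v) = v" if "v \<in> carrier_vec n"
    using q that by (simp add: assoc_mult_mat_vec[OF q(1) q(4) that, symmetric])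
qed

section \<open>Diagonal and block diagonal matrices\<close>

definition diag_of :: "nat \<Rightarrow> (nat \<Rightarrow> complex) \<Rightarrow> complex mat"
  where "diag_of n r = mat n n (\<lambda>(i, j). if i = j then r i else 0)"

lemma diag_of_carrier [simp]: "diag_of n r \<in> carrier_mat n n"
  by (simp add: diag_of_def)

lemma diag_of_mult_vec:
  assumes "x \<in> carrier_vec n"
  shows "diag_of n r *\<^sub>v x = vec n (\<lambda>i. r i * x $ i)"
  using assms
  by (intro eq_vecI) (auto simp: diag_of_def scalar_prod_def if_distrib[of "\<lambda>a. a * _"] sum.delta cong: if_cong)

lemma diag_of_adjoint: "mat_adjoint (diag_of n r) = diag_of n (\<lambda>i. cnj (r i))"
proof (rule eq_matI)
  fix i j assume "i < dim_row (diag_of n (\<lambda>i. cnj (r i)))" "j < dim_col (diag_of n (\<lambda>i. cnj (r i)))"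
  then have ij: "i < n" "j < n" by (auto simp: diag_of_def)
  show "mat_adjoint (diag_of n r) $$ (i, j) = diag_of n (\<lambda>i. cnj (r i)) $$ (i, j)"
    unfolding mat_adjoint_index[OF diag_of_carrier ij] using ij by (auto simp: diag_of_def)
qed (auto simp: diag_of_def)

lemma diag_of_mult: "diag_of n r * diag_of n s = diag_of n (\<lambda>i. r i * s i)"
  by (rule eq_matI) (auto simp: diag_of_def scalar_prod_def if_distrib[of "\<lambda>a. a * _"] sum.delta cong: if_cong)

lemma diag_of_one: "diag_of n (\<lambda>_. 1) = 1\<^sub>m n"
  by (rule eq_matI) (auto simp: diag_of_def)

lemma diag_of_cong: "(\<And>i. i < n \<Longrightarrow> r i = s i) \<Longrightarrow> diag_of n r = diag_of n s"
  by (rule eq_matI) (auto simp: diag_of_def)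

definition block_diag :: "complex mat \<Rightarrow> complex mat \<Rightarrow> complex mat"
  where "block_diag A B =
    four_block_mat A (0\<^sub>m (dim_row A) (dim_col B)) (0\<^sub>m (dim_row B) (dim_col A)) B"

lemma block_diag_carrier:
  "A \<in> carrier_mat p p \<Longrightarrow> B \<in> carrier_mat q q \<Longrightarrow> block_diag A B \<in> carrier_mat (p + q) (p + q)"
  by (auto simp: block_diag_def)

lemma block_diag_mult:
  assumes "A \<in> carrier_mat p p" "B \<in> carrier_mat q q" "A' \<in> carrier_mat p p" "B' \<in> carrier_mat q q"
  shows "block_diag A B * block_diag A' B' = block_diag (A * A') (B * B')"
proof -
  have "block_diag A B * block_diag A' B' =
      four_block_mat (A * A' + 0\<^sub>m p q * 0\<^sub>m q p) (A * 0\<^sub>m p q + 0\<^sub>m p q * B')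
        (0\<^sub>m q p * A' + B * 0\<^sub>m q p) (0\<^sub>m q p * 0\<^sub>m p q + B * B')"
    unfolding block_diag_def using assms
    by (simp only: carrier_matD, intro mult_four_block_mat[of _ p p _ q _ q]) auto
  also have "\<dots> = block_diag (A * A') (B * B')"
    using assms by (auto simp: block_diag_def)
  finally show ?thesis .
qed

lemma block_diag_adjoint:
  assumes A: "A \<in> carrier_mat p p" and B: "B \<in> carrier_mat q q"
  shows "mat_adjoint (block_diag A B) = block_diag (mat_adjoint A) (mat_adjoint B)"
proof (rule eq_matI)
  note C = block_diag_carrier[OF A B]
  note C' = block_diag_carrier[OF mat_adjoint_carrier[OF A] mat_adjoint_carrier[OF B]]
  show "dim_row (mat_adjoint (block_diag A B)) = dim_row (block_diag (mat_adjoint A) (mat_adjoint B))"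
    "dim_col (mat_adjoint (block_diag A B)) = dim_col (block_diag (mat_adjoint A) (mat_adjoint B))"
    using C C' by auto
  fix i j assume "i < dim_row (block_diag (mat_adjoint A) (mat_adjoint B))"
    "j < dim_col (block_diag (mat_adjoint A) (mat_adjoint B))"
  then have ij: "i < p + q" "j < p + q" using C' by auto
  then show "mat_adjoint (block_diag A B) $$ (i, j) = block_diag (mat_adjoint A) (mat_adjoint B) $$ (i, j)"
    using A B unfolding mat_adjoint_index[OF C ij]
    by (auto simp: block_diag_def mat_adjoint_index[OF A] mat_adjoint_index[OF B])
qed

lemma block_diag_one: "block_diag (1\<^sub>m p) (1\<^sub>m q) = 1\<^sub>m (p + q)"
  by (rule eq_matI) (auto simp: block_diag_def)

lemma block_diag_unitary:
  assumes "A \<in> carrier (unitary_group p)" "B \<in> carrier (unitary_group q)"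
  shows "block_diag A B \<in> carrier (unitary_group (p + q))"
  using unitary_groupD[OF assms(1)] unitary_groupD[OF assms(2)]
  by (intro unitary_groupI)
    (auto intro: block_diag_carrier simp: block_diag_adjoint block_diag_mult[of _ p _ q] block_diag_one)

lemma block_diag_mult_vec:
  assumes "A \<in> carrier_mat p p" "B \<in> carrier_mat q q" "x \<in> carrier_vec p" "y \<in> carrier_vec q"
  shows "block_diag A B *\<^sub>v (x @\<^sub>v y) = (A *\<^sub>v x) @\<^sub>v (B *\<^sub>v y)"
proof -
  have "block_diag A B *\<^sub>v (x @\<^sub>v y) =
      (A *\<^sub>v x + 0\<^sub>m p q *\<^sub>v y) @\<^sub>v (0\<^sub>m q p *\<^sub>v x + B *\<^sub>v y)"
    unfolding block_diag_def using assms
    by (simp only: carrier_matD, intro four_block_mat_mult_vec[of _ p p _ q _ q]) auto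
  also have "0\<^sub>m p q *\<^sub>v y = 0\<^sub>v p" using assms by auto
  also have "0\<^sub>m q p *\<^sub>v x = 0\<^sub>v q" using assms by auto
  finally show ?thesis using assms by simp
qed

lemma diag_of_Suc:
  "diag_of (Suc n) (\<lambda>i. case i of 0 \<Rightarrow> e | Suc i \<Rightarrow> r i) = block_diag (mat 1 1 (\<lambda>_. e)) (diag_of n r)"
  by (rule eq_matI) (auto simp: block_diag_def diag_of_def split: nat.split)

text \<open>Complete \<open>v\<close> to a basis, orthogonalize, and normalize. The scalar
  \<open>c\<close> is the normalization of \<open>v\<close>.\<close>

lemma exists_unitary_first_column:
  assumes v: "v \<in> carrier_vec n" "v \<noteq> 0\<^sub>v n"
  shows "\<exists>W\<in>carrier (unitary_group n). \<exists>c. col W 0 = c \<cdot>\<^sub>v v"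
proof -
  interpret cof_vec_space n "TYPE(complex)" .
  define b where "b = basis_completion v"
  define ws where "ws = gram_schmidt n b"
  note b = basis_completion[OF v, folded b_def]
  note ws = gram_schmidt_result[OF b(2,4,5) refl, folded ws_def]
  have n: "n > 0" using v by (cases n) auto
  have bne: "b \<noteq> []" using b(6) n by auto
  \<comment> \<open>This Gram-Schmidt process orthogonalizes without normalizing, so its first
    vector is still \<open>v\<close>; the lengths \<open>N\<close> are divided out below.\<close>
  then have hd: "hd ws = v"
    unfolding ws_def using gram_schmidt_hd[OF v(1), of "tl b"] b(7) by (metis list.collapse)
  have len: "length ws = n" using ws(4) b(6) by simp
  have ws0: "ws ! 0 = v" using hd hd_conv_nth[of ws] len n by force
  have wc: "ws ! i \<in> carrier_vec n" if "i < n" for i using ws(3) len that by auto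
  define N where "N i = complex_of_real (\<parallel>ws ! i\<parallel>)" for i
  define W where "W = mat n n (\<lambda>(i, j). ws ! j $ i / N j)"
  have W: "W \<in> carrier_mat n n" by (simp add: W_def)
  \<comment> \<open>The equivalence contains the diagonal case: no vector of the list is orthogonal
    to itself, so the lengths are nonzero.\<close>
  have orth: "ws ! i \<bullet>c ws ! j = 0 \<longleftrightarrow> i \<noteq> j" if "i < n" "j < n" for i j
    using corthogonalD[OF ws(2)] that len by auto
  have N0: "N i \<noteq> 0" if "i < n" for i
    using orth[OF that that] cscalar_prod_self[of "ws ! i"] by (auto simp: N_def)
  have "mat_adjoint W * W = 1\<^sub>m n"
  proof (rule eq_matI)
    fix i j assume "i < dim_row (1\<^sub>m n :: complex mat)" "j < dim_col (1\<^sub>m n :: complex mat)"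
    then have ij: "i < n" "j < n" by auto
    have "(mat_adjoint W * W) $$ (i, j) = (\<Sum>k<n. cnj (W $$ (k, i)) * W $$ (k, j))"
      using ij W by (simp add: scalar_prod_def atLeast0LessThan mat_adjoint_index[OF W])
    also have "\<dots> = (ws ! j \<bullet>c ws ! i) / (N i * N j)"
      using ij wc[OF ij(1)] wc[OF ij(2)]
      by (simp add: scalar_prod_def atLeast0LessThan W_def N_def sum_divide_distrib mult_ac)
    also have "\<dots> = 1\<^sub>m n $$ (i, j)"
      using ij orth[OF ij(2) ij(1)] N0[OF ij(1)]
      by (cases "i = j") (auto simp: cscalar_prod_self N_def power2_eq_square)
    finally show "(mat_adjoint W * W) $$ (i, j) = 1\<^sub>m n $$ (i, j)" .
  qed (use W in auto)
  then have "W \<in> carrier (unitary_group n)" using W by (intro unitary_groupI)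
  moreover have "col W 0 = (1 / N 0) \<cdot>\<^sub>v v"
    using n v(1) ws0 by (intro eq_vecI) (auto simp: W_def)
  ultimately show ?thesis by blast
qed

lemma adjoint_mult_self_index:
  fixes A :: "complex mat"
  assumes "A \<in> carrier_mat m n" "i < n" "j < n"
  shows "(mat_adjoint A * A) $$ (i, j) = (\<Sum>k<m. cnj (A $$ (k, i)) * A $$ (k, j))"
  using assms by (simp add: scalar_prod_def atLeast0LessThan mat_adjoint_index[OF assms(1)])

lemma mult_adjoint_self_index:
  fixes A :: "complex mat"
  assumes "A \<in> carrier_mat m n" "i < m" "j < m"
  shows "(A * mat_adjoint A) $$ (i, j) = (\<Sum>k<n. A $$ (i, k) * cnj (A $$ (j, k)))"
  using assms by (simp add: scalar_prod_def atLeast0LessThan mat_adjoint_index[OF assms(1)])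

text \<open>In a normal matrix the zeroth row has the same norm as the zeroth column, so deflating an
  eigenvector leaves a block diagonal matrix.\<close>

theorem normal_unitarily_diagonalizable:
  assumes "A \<in> carrier_mat n n" "mat_adjoint A * A = A * mat_adjoint A"
  shows "\<exists>Q\<in>carrier (unitary_group n). \<exists>r. A = Q * diag_of n r * mat_adjoint Q"
  using assms
proof (induction n arbitrary: A)
  case 0
  then have "A = 1\<^sub>m 0 * diag_of 0 undefined * mat_adjoint (1\<^sub>m 0)" by (intro eq_matI) auto
  then show ?case using one_unitary by blast
next
  case (Suc n)
  note A = Suc.prems(1)
  obtain e where "eigenvalue A e"
    using spectrum_non_empty[OF A] by (auto simp: spectrum_def)
  then obtain v where v: "v \<in> carrier_vec (Suc n)" "v \<noteq> 0\<^sub>v (Suc n)" "A *\<^sub>v v = e \<cdot>\<^sub>v v"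
    using A by (auto simp: eigenvalue_def eigenvector_def)
  obtain W c where W: "W \<in> carrier (unitary_group (Suc n))" and col: "col W 0 = c \<cdot>\<^sub>v v"
    using exists_unitary_first_column[OF v(1,2)] by blast
  note w = unitary_groupD[OF W]
  note assoc = assoc_mult_mat[of _ "Suc n" "Suc n" _ "Suc n" _ "Suc n"]
    mult_carrier_mat[of _ "Suc n" "Suc n" _ "Suc n"]
  note adj = mat_adjoint_mult[of _ "Suc n" "Suc n" _ "Suc n"]
  define B where "B = mat_adjoint W * A * W"
  have B: "B \<in> carrier_mat (Suc n) (Suc n)" unfolding B_def by (intro mult_carrier_mat[OF mult_carrier_mat[OF w(4) A] w(1)])
  have AB: "A = W * B * mat_adjoint W"
    using A w by (simp add: B_def assoc unitary_cancel(1,2)[OF W, where l = "Suc n"])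
  note A' = mat_adjoint_carrier[OF A]
  have B': "mat_adjoint B = mat_adjoint W * mat_adjoint A * W"
    using A w A' by (simp add: B_def adj assoc mat_adjoint_adjoint)
  have normal: "mat_adjoint B * B = B * mat_adjoint B"
  proof -
    have "mat_adjoint B * B = mat_adjoint W * (mat_adjoint A * A) * W"
      using A w A' unfolding B' by (simp add: B_def assoc unitary_cancel(2)[OF W, where l = "Suc n"])
    also have "\<dots> = B * mat_adjoint B"
      using A w A' unfolding B' Suc.prems(2) by (simp add: B_def assoc unitary_cancel(2)[OF W, where l = "Suc n"])
    finally show ?thesis .
  qed
  \<comment> \<open>The zeroth column of \<open>W\<close> is still an eigenvector of
    \<open>A\<close>; conjugated by \<open>W\<close>, this says that \<open>B\<close> maps the
    zeroth unit vector to \<open>e\<close> times itself.\<close>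
  have col0: "B $$ (i, 0) = (if i = 0 then e else 0)" if i: "i < Suc n" for i
  proof -
    have cw: "col W 0 \<in> carrier_vec (Suc n)" using w(1) by (auto intro: carrier_vecI)
    have "A *\<^sub>v col W 0 = e \<cdot>\<^sub>v col W 0"
      unfolding col mult_mat_vec[OF A v(1)] v(3) by (simp add: smult_smult_assoc mult.commute)
    moreover have "col B 0 = mat_adjoint W *\<^sub>v (A *\<^sub>v col W 0)"
      unfolding B_def assoc_mult_mat[OF w(4) A w(1)]
        col_mult2[OF w(4) mult_carrier_mat[OF A w(1)] zero_less_Suc] col_mult2[OF A w(1) zero_less_Suc] ..
    moreover have "mat_adjoint W *\<^sub>v col W 0 = col (1\<^sub>m (Suc n)) 0"
      using w by (metis col_mult2 zero_less_Suc)
    ultimately have "col B 0 = e \<cdot>\<^sub>v col (1\<^sub>m (Suc n)) 0"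
      by (simp add: mult_mat_vec[OF w(4) cw])
    then have "col B 0 $ i = (e \<cdot>\<^sub>v col (1\<^sub>m (Suc n)) 0) $ i" by simp
    then show ?thesis using i B by auto
  qed
  have "(\<Sum>k<Suc n. B $$ (0, k) * cnj (B $$ (0, k))) = (\<Sum>k<Suc n. cnj (B $$ (k, 0)) * B $$ (k, 0))"
    using adjoint_mult_self_index[OF B, of 0 0] mult_adjoint_self_index[OF B, of 0 0] normal by simp
  also have "\<dots> = cnj e * e"
    unfolding sum.lessThan_Suc_shift by (simp add: col0)
  finally have "(\<Sum>k<n. B $$ (0, Suc k) * cnj (B $$ (0, Suc k))) = 0"
    unfolding sum.lessThan_Suc_shift by (simp add: col0 mult.commute)
  then have "(\<Sum>k<n. complex_of_real ((cmod (B $$ (0, Suc k)))\<^sup>2)) = 0"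
    by (simp add: complex_norm_square del: of_real_power)
  then have "(\<Sum>k<n. (cmod (B $$ (0, Suc k)))\<^sup>2) = 0"
    by (simp only: of_real_sum[symmetric] of_real_eq_0_iff)
  then have row0: "B $$ (0, Suc k) = 0" if "k < n" for k
    using that by (subst (asm) sum_nonneg_eq_0_iff) auto
  define C where "C = mat n n (\<lambda>(i, j). B $$ (Suc i, Suc j))"
  have C: "C \<in> carrier_mat n n" by (simp add: C_def)
  have BC: "B = block_diag (mat 1 1 (\<lambda>_. e)) C"
  proof (rule eq_matI)
    fix i j assume "i < dim_row (block_diag (mat 1 1 (\<lambda>_. e)) C)" "j < dim_col (block_diag (mat 1 1 (\<lambda>_. e)) C)"
    then show "B $$ (i, j) = block_diag (mat 1 1 (\<lambda>_. e)) C $$ (i, j)"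
      using col0[of i] row0[of "j - 1"] C
      by (cases i; cases j) (auto simp: block_diag_def C_def)
  qed (use B C in \<open>auto simp: block_diag_def\<close>)
  \<comment> \<open>The lower block inherits normality: in the entries of both products of
    \<open>B\<close>, the summand with index 0 vanishes by \<open>col0\<close> and
    \<open>row0\<close>.\<close>
  have "mat_adjoint C * C = C * mat_adjoint C"
  proof (rule eq_matI)
    fix i j assume "i < dim_row (C * mat_adjoint C)" "j < dim_col (C * mat_adjoint C)"
    then have ij: "i < n" "j < n" using C by auto
    have "(mat_adjoint B * B) $$ (Suc i, Suc j) = (B * mat_adjoint B) $$ (Suc i, Suc j)"
      by (simp add: normal)
    then have "(\<Sum>k<Suc n. cnj (B $$ (k, Suc i)) * B $$ (k, Suc j)) =
        (\<Sum>k<Suc n. B $$ (Suc i, k) * cnj (B $$ (Suc j, k)))"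
      using adjoint_mult_self_index[OF B, of "Suc i" "Suc j"]
        mult_adjoint_self_index[OF B, of "Suc i" "Suc j"] ij
      by (simp del: sum.lessThan_Suc index_mult_mat)
    then show "(mat_adjoint C * C) $$ (i, j) = (C * mat_adjoint C) $$ (i, j)"
      unfolding adjoint_mult_self_index[OF C ij] mult_adjoint_self_index[OF C ij]
      using ij by (simp add: sum.lessThan_Suc_shift row0 col0 C_def del: sum.lessThan_Suc)
  qed (use C in auto)
  then obtain P r where P: "P \<in> carrier (unitary_group n)" and CP: "C = P * diag_of n r * mat_adjoint P"
    using Suc.IH[OF C] by blast
  note p = unitary_groupD[OF P]
  define Q where "Q = block_diag (1\<^sub>m 1) P"
  have Q: "Q \<in> carrier (unitary_group (Suc n))"
    unfolding Q_def using block_diag_unitary[OF one_unitary P, of 1] by simp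
  note q = unitary_groupD[OF Q]
  let ?D = "diag_of (Suc n) (\<lambda>i. case i of 0 \<Rightarrow> e | Suc i \<Rightarrow> r i)"
  have "B = Q * ?D * mat_adjoint Q"
    unfolding BC CP Q_def diag_of_Suc using p
    by (simp add: block_diag_adjoint[of _ 1 _ n] block_diag_mult[of _ 1 _ n])
  then have "A = W * Q * ?D * mat_adjoint (W * Q)"
    using w q unfolding AB by (simp add: assoc adj)
  then show ?case using unitary_mult[OF W Q] by blast
qed

section \<open>Unitary parts and block sums\<close>

lemma mult_minus_mat_vec:
  fixes A :: "complex mat"
  assumes "A \<in> carrier_mat m n" "v \<in> carrier_vec n" "w \<in> carrier_vec n"
  shows "A *\<^sub>v (v - w) = A *\<^sub>v v - A *\<^sub>v w"
  using assms mult_minus_distrib_mat_vec by blast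

lemma mult_mat_zero_vec:
  fixes A :: "complex mat"
  assumes "A \<in> carrier_mat m n"
  shows "A *\<^sub>v 0\<^sub>v n = 0\<^sub>v m"
  using assms by (intro eq_vecI) auto

lemma diag_of_const_mult_vec:
  assumes "x \<in> carrier_vec m"
  shows "diag_of m (\<lambda>_. c) *\<^sub>v x = c \<cdot>\<^sub>v x"
  using assms by (intro eq_vecI) (auto simp: diag_of_mult_vec)

text \<open>\<open>V\<close> is \<open>T\<close> times the inverse square root of
  \<open>T\<^sup>* T\<close>. In an eigenbasis of \<open>T\<^sup>* T\<close>, with singular values
  \<sigma>, the left side has the norm of \<open>x\<close> with its coordinates multiplied by 1 -
  \<sigma>, the right side with multipliers 1 - \<sigma>^2, and |1 - \<sigma>| <= |1 - \<sigma>^2|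
  for \<sigma> >= 0. The estimate is made vector by vector because \<open>T\<close> will be almost
  isometric only on some vectors.\<close>

lemma polar_unitary_injective:
  assumes T: "T \<in> carrier_mat m m"
    and inj: "\<And>v. v \<in> carrier_vec m \<Longrightarrow> T *\<^sub>v v = 0\<^sub>v m \<Longrightarrow> v = 0\<^sub>v m"
  shows "\<exists>V\<in>carrier (unitary_group m). \<forall>x\<in>carrier_vec m.
    \<parallel>V *\<^sub>v x - T *\<^sub>v x\<parallel> \<le> \<parallel>x - mat_adjoint T *\<^sub>v (T *\<^sub>v x)\<parallel>"
proof -
  note T' = mat_adjoint_carrier[OF T]
  note asm = assoc_mult_mat[of _ m m _ m _ m] mult_carrier_mat[of _ m m _ m]
  note asv = assoc_mult_mat_vec[of _ m m _ m] mult_mat_vec_carrier[of _ m m]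
  define H where "H = mat_adjoint T * T"
  have H: "H \<in> carrier_mat m m" using T T' unfolding H_def by (rule mult_carrier_mat[rotated])
  have "mat_adjoint H = H" using T T' by (simp add: H_def mat_adjoint_mult[OF T' T] mat_adjoint_adjoint[OF T])
  then obtain Q r where Q: "Q \<in> carrier (unitary_group m)" and HQ: "H = Q * diag_of m r * mat_adjoint Q"
    using normal_unitarily_diagonalizable[OF H] by auto
  note q = unitary_groupD[OF Q]
  define S where "S = T * Q"
  have S: "S \<in> carrier_mat m m" using T q(1) unfolding S_def by (rule mult_carrier_mat)
  note S' = mat_adjoint_carrier[OF S]
  have SS: "mat_adjoint S * S = diag_of m r"
  proof -
    have "mat_adjoint S * S = mat_adjoint Q * H * Q"
      using T q T' by (simp add: S_def H_def mat_adjoint_mult[OF T q(1)] asm)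
    also have "\<dots> = diag_of m r"
      using q(1,2,4) by (simp add: HQ asm unitary_cancel(1)[OF Q, where l = m] right_mult_one_mat[OF diag_of_carrier])
    finally show ?thesis .
  qed
  have SSX: "mat_adjoint S * (S * X) = diag_of m r * X" if "X \<in> carrier_mat m m" for X
    using assoc_mult_mat[OF S' S that] by (simp add: SS)
  \<comment> \<open>By \<open>SS\<close> the columns of \<open>S\<close> are orthogonal; their
    lengths are the singular values of \<open>T\<close>, and injectivity makes them
    positive.\<close>
  define \<sigma> where "\<sigma> i = \<parallel>S *\<^sub>v unit_vec m i\<parallel>" for i
  have \<sigma>: "\<sigma> i > 0 \<and> r i = complex_of_real ((\<sigma> i)\<^sup>2)" if i: "i < m" for i
  proof -
    have "S *\<^sub>v unit_vec m i \<noteq> 0\<^sub>v m"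
    proof
      assume "S *\<^sub>v unit_vec m i = 0\<^sub>v m"
      then have "T *\<^sub>v (Q *\<^sub>v unit_vec m i) = 0\<^sub>v m"
        using T q(1,4) by (simp add: S_def asv)
      then have "Q *\<^sub>v unit_vec m i = 0\<^sub>v m" by (rule inj[OF mult_mat_vec_carrier[OF q(1) unit_vec_carrier]])
      then have "unit_vec m i = (0\<^sub>v m :: complex vec)"
        using unitary_cancel(3)[OF Q unit_vec_carrier] mult_mat_zero_vec[OF q(4)] by metis
      then have "(unit_vec m i :: complex vec) $ i = 0\<^sub>v m $ i" by simp
      then show False using i by simp
    qed
    then have "\<sigma> i \<noteq> 0" using vec_l2_norm_eq_0[of "S *\<^sub>v unit_vec m i" m] S by (auto simp: \<sigma>_def asv)
    moreover have "r i = complex_of_real ((\<sigma> i)\<^sup>2)"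
    proof -
      have "complex_of_real ((\<sigma> i)\<^sup>2) = (S *\<^sub>v unit_vec m i) \<bullet>c (S *\<^sub>v unit_vec m i)"
        by (simp only: \<sigma>_def cscalar_prod_self)
      also have "S *\<^sub>v unit_vec m i = vec m (\<lambda>k. S $$ (k, i))"
        using S i by (intro eq_vecI) (auto simp: scalar_prod_right_unit)
      also have "vec m (\<lambda>k. S $$ (k, i)) \<bullet>c vec m (\<lambda>k. S $$ (k, i)) = (\<Sum>k<m. S $$ (k, i) * cnj (S $$ (k, i)))"
        by (simp add: scalar_prod_def atLeast0LessThan)
      also have "\<dots> = diag_of m r $$ (i, i)"
        using adjoint_mult_self_index[OF S i i] by (simp add: SS mult.commute)
      also have "\<dots> = r i" using i by (simp add: diag_of_def)
      finally show ?thesis by simp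
    qed
    ultimately show ?thesis by (simp add: \<sigma>_def less_le)
  qed
  define D where "D = diag_of m (\<lambda>i. complex_of_real (1 / \<sigma> i))"
  have D: "D \<in> carrier_mat m m" "mat_adjoint D = D" by (auto simp: D_def diag_of_adjoint)
  \<comment> \<open>\<open>S * D\<close> is \<open>S\<close> with its columns scaled to length one,
    hence orthonormal.\<close>
  define V where "V = S * D * mat_adjoint Q"
  have V: "V \<in> carrier_mat m m" unfolding V_def using S D q(1,4) by (simp add: asm)
  have "mat_adjoint V * V = Q * (D * (diag_of m r * D)) * mat_adjoint Q"
    using S S' D q SS
    by (simp add: V_def mat_adjoint_mult[of _ m m _ m] asm mat_adjoint_adjoint SSX)
  also have "D * (diag_of m r * D) = 1\<^sub>m m"
    unfolding D_def diag_of_mult diag_of_one[symmetric]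
    by (rule diag_of_cong) (use \<sigma> in \<open>auto simp: field_simps power2_eq_square dest: \<sigma>\<close>)
  finally have Vu: "V \<in> carrier (unitary_group m)"
    using V q by (intro unitary_groupI) auto
  have "\<parallel>V *\<^sub>v x - T *\<^sub>v x\<parallel> \<le> \<parallel>x - mat_adjoint T *\<^sub>v (T *\<^sub>v x)\<parallel>" if x: "x \<in> carrier_vec m" for x
  proof -
    define y where "y = mat_adjoint Q *\<^sub>v x"
    have y: "y \<in> carrier_vec m" using q(1,4) x by (simp add: y_def asv)
    have xy: "x = Q *\<^sub>v y" using x by (simp add: y_def unitary_cancel(4)[OF Q])
    \<comment> \<open>In eigenvector coordinates, \<open>z\<close> is \<open>x\<close> minus its
      image under the square root of \<open>H\<close>. Since \<open>V Q = S D\<close>, the identity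
      \<open>D z = D y - y\<close> becomes the difference to be estimated.\<close>
    define z where "z = y - diag_of m (\<lambda>i. complex_of_real (\<sigma> i)) *\<^sub>v y"
    have z: "z \<in> carrier_vec m" using y by (simp add: z_def diag_of_mult_vec)
    have Tx: "T *\<^sub>v x = S *\<^sub>v y" using T q(1,4) y by (simp add: S_def xy asv)
    have "D *\<^sub>v z = D *\<^sub>v y - y"
      using y \<sigma> unfolding z_def D_def
      by (intro eq_vecI) (auto simp: diag_of_mult_vec field_simps dest: \<sigma>)
    then have "V *\<^sub>v (Q *\<^sub>v z) = S *\<^sub>v (D *\<^sub>v y) - S *\<^sub>v y"
      using S D q(1,4) y z by (simp add: V_def asv unitary_cancel(3)[OF Q] mult_minus_mat_vec[OF S])
    also have "S *\<^sub>v (D *\<^sub>v y) = V *\<^sub>v x"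
      using S D q(1,4) y by (simp add: V_def xy asv unitary_cancel(3)[OF Q])
    finally have "V *\<^sub>v x - T *\<^sub>v x = V *\<^sub>v (Q *\<^sub>v z)" by (simp add: Tx)
    then have "\<parallel>V *\<^sub>v x - T *\<^sub>v x\<parallel> = \<parallel>z\<parallel>"
      using z q(1,4) by (simp add: vec_l2_norm_unitary[OF Vu] vec_l2_norm_unitary[OF Q] asv)
    also have "\<dots> \<le> 1 * \<parallel>y - diag_of m r *\<^sub>v y\<parallel>"
    proof (rule vec_l2_norm_mono_le)
      fix i assume "i < dim_vec (y - diag_of m r *\<^sub>v y)"
      then have i: "i < m" by (auto simp: diag_of_def)
      have "\<bar>1 - \<sigma> i\<bar> * 1 \<le> \<bar>1 - \<sigma> i\<bar> * (1 + \<sigma> i)"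
        using \<sigma>[OF i] by (intro mult_left_mono) auto
      also have "\<dots> = \<bar>(1 - \<sigma> i) * (1 + \<sigma> i)\<bar>"
        using \<sigma>[OF i] by (simp add: abs_mult)
      also have "\<dots> = \<bar>1 - (\<sigma> i)\<^sup>2\<bar>"
        by (simp add: algebra_simps power2_eq_square)
      finally have *: "\<bar>1 - \<sigma> i\<bar> * cmod (y $ i) \<le> \<bar>1 - (\<sigma> i)\<^sup>2\<bar> * cmod (y $ i)"
        by (intro mult_right_mono) auto
      have "z $ i = complex_of_real (1 - \<sigma> i) * y $ i"
        using i y by (simp add: z_def diag_of_mult_vec algebra_simps)
      moreover have "(y - diag_of m r *\<^sub>v y) $ i = complex_of_real (1 - (\<sigma> i)\<^sup>2) * y $ i"
        using i y \<sigma>[OF i] by (simp add: diag_of_mult_vec algebra_simps)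
      ultimately show "cmod (z $ i) \<le> 1 * cmod ((y - diag_of m r *\<^sub>v y) $ i)"
        using * by (simp only: norm_mult norm_of_real mult_1)
    qed (use z y in \<open>auto simp: diag_of_def\<close>)
    also have "\<parallel>y - diag_of m r *\<^sub>v y\<parallel> = \<parallel>Q *\<^sub>v (y - diag_of m r *\<^sub>v y)\<parallel>"
      using y by (intro vec_l2_norm_unitary[OF Q, symmetric]) (simp add: diag_of_mult_vec)
    also have "Q *\<^sub>v (y - diag_of m r *\<^sub>v y) = x - H *\<^sub>v x"
      using y q(1,4) by (simp add: mult_minus_mat_vec[of Q m m] HQ xy asv asm unitary_cancel(3)[OF Q])
    also have "H *\<^sub>v x = mat_adjoint T *\<^sub>v (T *\<^sub>v x)"
      using T T' x by (simp add: H_def asv)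
    finally show ?thesis by simp
  qed
  then show ?thesis using Vu by blast
qed

text \<open>A small multiple of the identity makes any matrix injective, at an arbitrarily small cost.\<close>

lemma polar_unitary:
  assumes T: "T \<in> carrier_mat m m"
    and bd: "norm_bounded_by T 1" "norm_bounded_by (mat_adjoint T) 1" and \<eta>: "\<eta> > 0"
  shows "\<exists>V\<in>carrier (unitary_group m). \<forall>x\<in>carrier_vec m.
    \<parallel>V *\<^sub>v x - T *\<^sub>v x\<parallel> \<le> \<parallel>x - mat_adjoint T *\<^sub>v (T *\<^sub>v x)\<parallel> + \<eta> * \<parallel>x\<parallel>"
proof -
  note T' = mat_adjoint_carrier[OF T]
  \<comment> \<open>Only finitely many \<open>s\<close> are excluded, those with -s an eigenvalue of
    \<open>T\<close>. The total error is 4 s, which explains \<eta>/4: one s for replacing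
    \<open>T\<close> by \<open>S\<close>, and 3 s for replacing \<open>T\<^sup>* T\<close> by
    \<open>S\<^sup>* S\<close>, where s <= 1 bounds the quadratic term.\<close>
  have "infinite {0<..<min 1 (\<eta> / 4)}" using \<eta> by (simp add: infinite_Ioo)
  moreover have "finite ((\<lambda>z. - Re z) ` spectrum T)"
    using card_finite_spectrum(1)[OF T] by simp
  ultimately obtain s where s: "s \<in> {0<..<min 1 (\<eta> / 4)}" "s \<notin> (\<lambda>z. - Re z) ` spectrum T"
    by (meson finite_subset subsetI)
  have notin: "- complex_of_real s \<notin> spectrum T" using s(2) by (force simp: image_iff)
  define S where "S = T + diag_of m (\<lambda>_. complex_of_real s)"
  have S: "S \<in> carrier_mat m m" using T by (simp add: S_def)
  have Sv: "S *\<^sub>v v = T *\<^sub>v v + complex_of_real s \<cdot>\<^sub>v v" if v: "v \<in> carrier_vec m" for v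
    using T v by (simp add: S_def add_mult_distrib_mat_vec[of _ m m] diag_of_const_mult_vec)
  have S': "mat_adjoint S = mat_adjoint T + diag_of m (\<lambda>_. complex_of_real s)"
  proof (rule eq_matI)
    fix i j assume "i < dim_row (mat_adjoint T + diag_of m (\<lambda>_. complex_of_real s))"
      "j < dim_col (mat_adjoint T + diag_of m (\<lambda>_. complex_of_real s))"
    then have ij: "i < m" "j < m" by (auto simp: diag_of_def)
    then show "mat_adjoint S $$ (i, j) = (mat_adjoint T + diag_of m (\<lambda>_. complex_of_real s)) $$ (i, j)"
      using T T' by (simp add: mat_adjoint_index[OF S ij] mat_adjoint_index[OF T ij]) (simp add: S_def diag_of_def mat_adjoint_index[OF T ij])
  qed (use S T in \<open>auto simp: diag_of_def\<close>)
  have S'v: "mat_adjoint S *\<^sub>v v = mat_adjoint T *\<^sub>v v + complex_of_real s \<cdot>\<^sub>v v"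
    if v: "v \<in> carrier_vec m" for v
    using T' v by (simp add: S' add_mult_distrib_mat_vec[of _ m m] diag_of_const_mult_vec)
  have inj: "v = 0\<^sub>v m" if v: "v \<in> carrier_vec m" and Sv0: "S *\<^sub>v v = 0\<^sub>v m" for v
  proof (rule ccontr)
    assume "v \<noteq> 0\<^sub>v m"
    moreover have "T *\<^sub>v v = (- complex_of_real s) \<cdot>\<^sub>v v"
    proof (rule eq_vecI)
      fix i assume "i < dim_vec ((- complex_of_real s) \<cdot>\<^sub>v v)"
      then have i: "i < m" using v by simp
      have "(T *\<^sub>v v + complex_of_real s \<cdot>\<^sub>v v) $ i = 0\<^sub>v m $ i" using Sv[OF v] Sv0 by simp
      then have "(T *\<^sub>v v) $ i + complex_of_real s * v $ i = 0"
        using i v T by simp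
      then show "(T *\<^sub>v v) $ i = ((- complex_of_real s) \<cdot>\<^sub>v v) $ i"
        using i v by (simp add: eq_neg_iff_add_eq_0)
    qed (use T v in auto)
    ultimately have "eigenvector T v (- complex_of_real s)"
      using T v by (simp add: eigenvector_def)
    then show False using notin by (auto simp: spectrum_def eigenvalue_def)
  qed
  obtain V where V: "V \<in> carrier (unitary_group m)"
    and VS: "\<And>x. x \<in> carrier_vec m \<Longrightarrow>
      \<parallel>V *\<^sub>v x - S *\<^sub>v x\<parallel> \<le> \<parallel>x - mat_adjoint S *\<^sub>v (S *\<^sub>v x)\<parallel>"
    using polar_unitary_injective[OF S inj] by blast
  have "\<parallel>V *\<^sub>v x - T *\<^sub>v x\<parallel> \<le> \<parallel>x - mat_adjoint T *\<^sub>v (T *\<^sub>v x)\<parallel> + \<eta> * \<parallel>x\<parallel>"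
    if x: "x \<in> carrier_vec m" for x
  proof -
    note mc = mult_mat_vec_carrier[of _ m m]
    have c: "T *\<^sub>v x \<in> carrier_vec m" "S *\<^sub>v x \<in> carrier_vec m" "V *\<^sub>v x \<in> carrier_vec m"
      "mat_adjoint T *\<^sub>v (T *\<^sub>v x) \<in> carrier_vec m" "mat_adjoint S *\<^sub>v (S *\<^sub>v x) \<in> carrier_vec m"
      "mat_adjoint T *\<^sub>v x \<in> carrier_vec m"
      using T T' S x unitary_groupD(1)[OF V] mat_adjoint_carrier[OF S] by (auto simp: mc)
    have b: "\<parallel>T *\<^sub>v x\<parallel> \<le> \<parallel>x\<parallel>" "\<parallel>mat_adjoint T *\<^sub>v x\<parallel> \<le> \<parallel>x\<parallel>"
      using norm_bounded_byD[OF bd(1) T x] norm_bounded_byD[OF bd(2) T' x] by auto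
    have "S *\<^sub>v x - T *\<^sub>v x = complex_of_real s \<cdot>\<^sub>v x"
      using c x T by (intro eq_vecI) (auto simp: Sv[OF x])
    then have 1: "\<parallel>S *\<^sub>v x - T *\<^sub>v x\<parallel> \<le> s * \<parallel>x\<parallel>" using s by simp
    have "mat_adjoint T *\<^sub>v (T *\<^sub>v x) - mat_adjoint S *\<^sub>v (S *\<^sub>v x)
        = - (complex_of_real s \<cdot>\<^sub>v (mat_adjoint T *\<^sub>v x + (T *\<^sub>v x + complex_of_real s \<cdot>\<^sub>v x)))"
      using c x T T' unfolding S'v[OF c(2)] unfolding Sv[OF x]
      by (intro eq_vecI) (auto simp: mult_add_distrib_mat_vec[OF T'] mult_mat_vec[OF T'] algebra_simps)
    then have "\<parallel>mat_adjoint T *\<^sub>v (T *\<^sub>v x) - mat_adjoint S *\<^sub>v (S *\<^sub>v x)\<parallel>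
        = s * \<parallel>mat_adjoint T *\<^sub>v x + (T *\<^sub>v x + complex_of_real s \<cdot>\<^sub>v x)\<parallel>"
      using s by simp
    also have "\<dots> \<le> s * (\<parallel>x\<parallel> + (\<parallel>x\<parallel> + 1 * \<parallel>x\<parallel>))"
    proof (intro mult_left_mono order_trans[OF vec_l2_norm_triangle] add_mono b)
      show "\<parallel>complex_of_real s \<cdot>\<^sub>v x\<parallel> \<le> 1 * \<parallel>x\<parallel>"
        using s by (simp add: mult_right_mono mult_left_le_one_le)
    qed (use c x s T T' in auto)
    finally have 2: "\<parallel>mat_adjoint T *\<^sub>v (T *\<^sub>v x) - mat_adjoint S *\<^sub>v (S *\<^sub>v x)\<parallel> \<le> 3 * s * \<parallel>x\<parallel>"
      by simp
    have "\<parallel>x - mat_adjoint S *\<^sub>v (S *\<^sub>v x)\<parallel> \<le> \<parallel>x - mat_adjoint T *\<^sub>v (T *\<^sub>v x)\<parallel> + 3 * s * \<parallel>x\<parallel>"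
      by (rule vec_l2_norm_diff_triangle[OF x c(4,5) order_refl 2])
    then have "\<parallel>V *\<^sub>v x - T *\<^sub>v x\<parallel> \<le> (\<parallel>x - mat_adjoint T *\<^sub>v (T *\<^sub>v x)\<parallel> + 3 * s * \<parallel>x\<parallel>) + s * \<parallel>x\<parallel>"
      by (intro vec_l2_norm_diff_triangle[OF c(3,2,1) _ 1] order_trans[OF VS[OF x]])
    also have "\<dots> = \<parallel>x - mat_adjoint T *\<^sub>v (T *\<^sub>v x)\<parallel> + (4 * s) * \<parallel>x\<parallel>" by simp
    also have "\<dots> \<le> \<parallel>x - mat_adjoint T *\<^sub>v (T *\<^sub>v x)\<parallel> + \<eta> * \<parallel>x\<parallel>"
      using s by (intro add_left_mono mult_right_mono) auto
    finally show ?thesis .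
  qed
  then show ?thesis using V by blast
qed

section \<open>Direct sums of blocks\<close>

lemma sum_lessThan_add: "(\<Sum>i<p + q. f i) = (\<Sum>i<p. f i) + (\<Sum>i<q. f (p + i))"
  for f :: "nat \<Rightarrow> 'a::comm_monoid_add"
  by (induction q) (auto simp: add.assoc)

lemma vec_l2_norm_append_sq: "\<parallel>v @\<^sub>v w\<parallel>\<^sup>2 = \<parallel>v\<parallel>\<^sup>2 + \<parallel>w\<parallel>\<^sup>2"
  by (simp add: vec_l2_norm_sq sum_lessThan_add)

lemma minus_append_vec:
  fixes v w :: "complex vec"
  assumes "dim_vec v = dim_vec v'" "dim_vec w = dim_vec w'"
  shows "(v @\<^sub>v w) - (v' @\<^sub>v w') = (v - v') @\<^sub>v (w - w')"
  using assms by (intro eq_vecI) auto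

lemma unitary_scalar:
  assumes "cmod c = 1"
  shows "diag_of m (\<lambda>_. c) \<in> carrier (unitary_group m)"
proof (rule unitary_groupI)
  have "cnj c * c = 1" using assms complex_norm_square[of c] by (simp add: mult.commute)
  then show "mat_adjoint (diag_of m (\<lambda>_. c)) * diag_of m (\<lambda>_. c) = 1\<^sub>m m"
    by (simp add: diag_of_adjoint diag_of_mult diag_of_one)
qed simp

lemma diag_of_const_commute:
  assumes V: "V \<in> carrier_mat m m"
  shows "diag_of m (\<lambda>_. c) * V = V * diag_of m (\<lambda>_. c)"
  by (rule eq_matI)
    (use V in \<open>auto simp: diag_of_def scalar_prod_def mult.commute if_distrib[of "\<lambda>a. a * _"]
      if_distrib[of "\<lambda>a. _ * a"] sum.delta cong: if_cong\<close>)

text \<open>The \<open>W j\<close> are stacked and the operators are direct sums along the list; a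
  scalar block commutes with every \<open>V j\<close>. The vector \<open>y\<close> is left free: it
  will be the image of \<open>x\<close> under either of the given unitaries, or 0 to obtain the norm
  of the image. Exact sums of squares are kept because errors in different blocks are orthogonal and
  should not be added by the triangle inequality.\<close>

lemma assemble_blocks:
  fixes W V :: "'a \<Rightarrow> complex mat"
  assumes "\<And>j. j \<in> set js \<Longrightarrow> W j \<in> carrier_mat (m j) d"
    and "\<And>j. j \<in> set js \<Longrightarrow> cmod (\<mu> j) = 1"
    and "\<And>j. j \<in> set js \<Longrightarrow> V j \<in> carrier (unitary_group (m j))"
    and "k = (\<Sum>j\<leftarrow>js. m j)"
  shows "\<exists>X U' V'. X \<in> carrier_mat k d \<and> U' \<in> carrier (unitary_group k) \<and> V' \<in> carrier (unitary_group k) \<and>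
    U' * V' = V' * U' \<and>
    (\<forall>a<d. \<forall>b<d. (mat_adjoint X * X) $$ (a, b) = (\<Sum>j\<leftarrow>js. (mat_adjoint (W j) * W j) $$ (a, b))) \<and>
    (\<forall>x\<in>carrier_vec d. \<forall>y\<in>carrier_vec d.
      \<parallel>U' *\<^sub>v (X *\<^sub>v x) - X *\<^sub>v y\<parallel>\<^sup>2 = (\<Sum>j\<leftarrow>js. \<parallel>\<mu> j \<cdot>\<^sub>v (W j *\<^sub>v x) - W j *\<^sub>v y\<parallel>\<^sup>2) \<and>
      \<parallel>V' *\<^sub>v (X *\<^sub>v x) - X *\<^sub>v y\<parallel>\<^sup>2 = (\<Sum>j\<leftarrow>js. \<parallel>V j *\<^sub>v (W j *\<^sub>v x) - W j *\<^sub>v y\<parallel>\<^sup>2))"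
  using assms
proof (induction js arbitrary: k)
  case Nil
  then have "k = 0" by simp
  moreover have "(mat_adjoint (0\<^sub>m 0 d) * (0\<^sub>m 0 d :: complex mat)) $$ (a, b) = 0" if "a < d" "b < d" for a b
    using that by (subst adjoint_mult_self_index[of _ 0 d]) auto
  ultimately show ?case using one_unitary[of 0]
    by (intro exI[of _ "0\<^sub>m 0 d"] exI[of _ "1\<^sub>m 0"]) (auto simp del: index_mult_mat simp: vec_l2_norm_sq)
next
  case (Cons j js)
  define k' where "k' = (\<Sum>j\<leftarrow>js. m j)"
  have k: "k = m j + k'" using Cons.prems(4) by (simp add: k'_def)
  note Wj = Cons.prems(1)[of j, simplified] and lj = Cons.prems(2)[of j, simplified]
    and Vj = Cons.prems(3)[of j, simplified]
  have "\<exists>X U' V'. X \<in> carrier_mat k' d \<and> U' \<in> carrier (unitary_group k') \<and> V' \<in> carrier (unitary_group k') \<and>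
    U' * V' = V' * U' \<and>
    (\<forall>a<d. \<forall>b<d. (mat_adjoint X * X) $$ (a, b) = (\<Sum>j\<leftarrow>js. (mat_adjoint (W j) * W j) $$ (a, b))) \<and>
    (\<forall>x\<in>carrier_vec d. \<forall>y\<in>carrier_vec d.
      \<parallel>U' *\<^sub>v (X *\<^sub>v x) - X *\<^sub>v y\<parallel>\<^sup>2 = (\<Sum>j\<leftarrow>js. \<parallel>\<mu> j \<cdot>\<^sub>v (W j *\<^sub>v x) - W j *\<^sub>v y\<parallel>\<^sup>2) \<and>
      \<parallel>V' *\<^sub>v (X *\<^sub>v x) - X *\<^sub>v y\<parallel>\<^sup>2 = (\<Sum>j\<leftarrow>js. \<parallel>V j *\<^sub>v (W j *\<^sub>v x) - W j *\<^sub>v y\<parallel>\<^sup>2))"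
    by (rule Cons.IH) (use Cons.prems in \<open>auto simp: k'_def\<close>)
  then obtain X U' V' where X: "X \<in> carrier_mat k' d" and U': "U' \<in> carrier (unitary_group k')"
    and V': "V' \<in> carrier (unitary_group k')" and comm: "U' * V' = V' * U'"
    and XX: "\<forall>a<d. \<forall>b<d. (mat_adjoint X * X) $$ (a, b) = (\<Sum>j\<leftarrow>js. (mat_adjoint (W j) * W j) $$ (a, b))"
    and est: "\<forall>x\<in>carrier_vec d. \<forall>y\<in>carrier_vec d.
      \<parallel>U' *\<^sub>v (X *\<^sub>v x) - X *\<^sub>v y\<parallel>\<^sup>2 = (\<Sum>j\<leftarrow>js. \<parallel>\<mu> j \<cdot>\<^sub>v (W j *\<^sub>v x) - W j *\<^sub>v y\<parallel>\<^sup>2) \<and>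
      \<parallel>V' *\<^sub>v (X *\<^sub>v x) - X *\<^sub>v y\<parallel>\<^sup>2 = (\<Sum>j\<leftarrow>js. \<parallel>V j *\<^sub>v (W j *\<^sub>v x) - W j *\<^sub>v y\<parallel>\<^sup>2)"
    by (elim exE conjE) (rule that; assumption)
  note iso = XX[rule_format] and U'x = est[rule_format, THEN conjunct1] and V'x = est[rule_format, THEN conjunct2]
  define L where "L = diag_of (m j) (\<lambda>_. \<mu> j)"
  have L: "L \<in> carrier (unitary_group (m j))" unfolding L_def by (rule unitary_scalar[OF lj])
  define Y where "Y = W j @\<^sub>r X"
  have Y: "Y \<in> carrier_mat k d" using Wj X by (simp add: Y_def k)
  have Yx: "Y *\<^sub>v x = (W j *\<^sub>v x) @\<^sub>v (X *\<^sub>v x)" if "x \<in> carrier_vec d" for x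
    unfolding Y_def using Wj X that by (rule mat_mult_append)
  note mc = mult_mat_vec_carrier
  \<comment> \<open>One computation serves both operators: the new block contributes an orthogonal
    summand.\<close>
  have blk: "\<parallel>block_diag A B *\<^sub>v (Y *\<^sub>v x) - Y *\<^sub>v y\<parallel>\<^sup>2 =
      \<parallel>A *\<^sub>v (W j *\<^sub>v x) - W j *\<^sub>v y\<parallel>\<^sup>2 + \<parallel>B *\<^sub>v (X *\<^sub>v x) - X *\<^sub>v y\<parallel>\<^sup>2"
    if "A \<in> carrier_mat (m j) (m j)" "B \<in> carrier_mat k' k'" "x \<in> carrier_vec d" "y \<in> carrier_vec d"
    for A B x y
    using that mc[OF Wj that(3)] mc[OF X that(3)] Wj X
    by (simp add: Yx block_diag_mult_vec minus_append_vec vec_l2_norm_append_sq)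
  note l = unitary_groupD(1)[OF L] and u = unitary_groupD(1)[OF U'] and v = unitary_groupD(1)[OF V']
    and vj = unitary_groupD(1)[OF Vj]
  have "block_diag L U' * block_diag (V j) V' = block_diag (V j) V' * block_diag L U'"
    unfolding block_diag_mult[OF l u vj v] block_diag_mult[OF vj v l u] comm
    unfolding L_def diag_of_const_commute[OF vj] ..
  moreover have "(mat_adjoint Y * Y) $$ (a, b) = (\<Sum>j\<leftarrow>j # js. (mat_adjoint (W j) * W j) $$ (a, b))"
    if ab: "a < d" "b < d" for a b
    using iso[OF ab] ab Wj X unfolding adjoint_mult_self_index[OF Y ab]
    by (simp add: k sum_lessThan_add adjoint_mult_self_index[OF Wj ab] adjoint_mult_self_index[OF X ab]
        del: index_mult_mat) (simp add: Y_def append_rows_def)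
  moreover have "\<parallel>block_diag L U' *\<^sub>v (Y *\<^sub>v x) - Y *\<^sub>v y\<parallel>\<^sup>2 =
      (\<Sum>j\<leftarrow>j # js. \<parallel>\<mu> j \<cdot>\<^sub>v (W j *\<^sub>v x) - W j *\<^sub>v y\<parallel>\<^sup>2)"
    if "x \<in> carrier_vec d" "y \<in> carrier_vec d" for x y
    using blk[OF l u that] U'x[OF that] mc[OF Wj that(1)] by (simp add: L_def diag_of_const_mult_vec)
  moreover have "\<parallel>block_diag (V j) V' *\<^sub>v (Y *\<^sub>v x) - Y *\<^sub>v y\<parallel>\<^sup>2 =
      (\<Sum>j\<leftarrow>j # js. \<parallel>V j *\<^sub>v (W j *\<^sub>v x) - W j *\<^sub>v y\<parallel>\<^sup>2)"
    if "x \<in> carrier_vec d" "y \<in> carrier_vec d" for x y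
    using blk[OF vj v that] V'x[OF that] by simp
  ultimately show ?case
    using Y block_diag_unitary[OF L U'] block_diag_unitary[OF Vj V'] unfolding k[symmetric]
    by (intro exI[of _ Y] exI[of _ "block_diag L U'"] exI[of _ "block_diag (V j) V'"] conjI allI impI ballI)
qed

section \<open>Almost commutation and continuous functional calculus\<close>

text \<open>The diagonal matrix is given by its entries, so that applying a function to it is just
  composition with \<open>w\<close>.\<close>

definition comm_le :: "nat \<Rightarrow> complex mat \<Rightarrow> (nat \<Rightarrow> complex) \<Rightarrow> real \<Rightarrow> bool"
  where "comm_le d V w c \<longleftrightarrow> (\<forall>x\<in>carrier_vec d.
    \<parallel>diag_of d w *\<^sub>v (V *\<^sub>v x) - V *\<^sub>v (diag_of d w *\<^sub>v x)\<parallel> \<le> c * \<parallel>x\<parallel>)"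

lemma dim_diag_of [simp]: "dim_row (diag_of d w) = d" "dim_col (diag_of d w) = d"
  by (simp_all add: diag_of_def)

lemma diag_of_mult_vec_carrier [simp]: "x \<in> carrier_vec d \<Longrightarrow> diag_of d w *\<^sub>v x \<in> carrier_vec d"
  by (rule mult_mat_vec_carrier[OF diag_of_carrier])

lemma diag_of_mult_vec_mult:
  "x \<in> carrier_vec d \<Longrightarrow> diag_of d v *\<^sub>v (diag_of d w *\<^sub>v x) = diag_of d (\<lambda>i. v i * w i) *\<^sub>v x"
  by (intro eq_vecI) (auto simp: diag_of_mult_vec)

lemma diag_of_mult_vec_add:
  "x \<in> carrier_vec d \<Longrightarrow> diag_of d (\<lambda>i. v i + w i) *\<^sub>v x = diag_of d v *\<^sub>v x + diag_of d w *\<^sub>v x"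
  by (intro eq_vecI) (auto simp: diag_of_mult_vec algebra_simps)

lemma vec_l2_norm_diag_of_le:
  assumes "x \<in> carrier_vec d" "\<And>i. i < d \<Longrightarrow> cmod (w i) \<le> c" "0 \<le> c"
  shows "\<parallel>diag_of d w *\<^sub>v x\<parallel> \<le> c * \<parallel>x\<parallel>"
  using assms by (intro vec_l2_norm_mono_le) (auto simp: diag_of_mult_vec norm_mult intro: mult_right_mono)

lemma comm_le_mono: "comm_le d V w c \<Longrightarrow> c \<le> c' \<Longrightarrow> comm_le d V w c'"
  unfolding comm_le_def by (meson mult_right_mono order_trans vec_l2_norm_nonneg)

context
  fixes d V
  assumes V: "V \<in> carrier (unitary_group d)"
begin

lemma unitary_mult_vec_carrier: "x \<in> carrier_vec d \<Longrightarrow> V *\<^sub>v x \<in> carrier_vec d"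
  by (rule mult_mat_vec_carrier[OF unitary_groupD(1)[OF V]])

lemma comm_le_const: "comm_le d V (\<lambda>_. a) 0"
  unfolding comm_le_def
proof
  fix x :: "complex vec" assume x: "x \<in> carrier_vec d"
  have "V *\<^sub>v (a \<cdot>\<^sub>v x) = a \<cdot>\<^sub>v (V *\<^sub>v x)"
    by (rule mult_mat_vec[OF unitary_groupD(1)[OF V] x])
  then show "\<parallel>diag_of d (\<lambda>_. a) *\<^sub>v (V *\<^sub>v x) - V *\<^sub>v (diag_of d (\<lambda>_. a) *\<^sub>v x)\<parallel> \<le> 0 * \<parallel>x\<parallel>"
    using unitary_mult_vec_carrier[OF x] x by (simp add: diag_of_const_mult_vec)
qed

lemma comm_le_add:
  assumes "comm_le d V w c" "comm_le d V w' c'"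
  shows "comm_le d V (\<lambda>i. w i + w' i) (c + c')"
  unfolding comm_le_def
proof
  fix x :: "complex vec" assume x: "x \<in> carrier_vec d"
  note Vx = unitary_mult_vec_carrier[OF x]
  let ?D = "diag_of d w" and ?D' = "diag_of d w'"
  have c: "V *\<^sub>v (?D *\<^sub>v x) \<in> carrier_vec d" "V *\<^sub>v (?D' *\<^sub>v x) \<in> carrier_vec d"
    using x by (auto intro: unitary_mult_vec_carrier)
  have "V *\<^sub>v (?D *\<^sub>v x + ?D' *\<^sub>v x) = V *\<^sub>v (?D *\<^sub>v x) + V *\<^sub>v (?D' *\<^sub>v x)"
    using x by (intro mult_add_distrib_mat_vec[OF unitary_groupD(1)[OF V]]) auto
  then have "diag_of d (\<lambda>i. w i + w' i) *\<^sub>v (V *\<^sub>v x) - V *\<^sub>v (diag_of d (\<lambda>i. w i + w' i) *\<^sub>v x)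
      = (?D *\<^sub>v (V *\<^sub>v x) - V *\<^sub>v (?D *\<^sub>v x)) + (?D' *\<^sub>v (V *\<^sub>v x) - V *\<^sub>v (?D' *\<^sub>v x))"
    unfolding diag_of_mult_vec_add[OF x] diag_of_mult_vec_add[OF Vx]
    using c diag_of_mult_vec_carrier[OF Vx, of w] diag_of_mult_vec_carrier[OF Vx, of w']
      carrier_matD[OF unitary_groupD(1)[OF V]]
    by (intro eq_vecI) auto
  also have "\<parallel>\<dots>\<parallel> \<le> c * \<parallel>x\<parallel> + c' * \<parallel>x\<parallel>"
    using assms x c by (intro order_trans[OF vec_l2_norm_triangle] add_mono) (auto simp: comm_le_def)
  finally show "\<parallel>diag_of d (\<lambda>i. w i + w' i) *\<^sub>v (V *\<^sub>v x) - V *\<^sub>v (diag_of d (\<lambda>i. w i + w' i) *\<^sub>v x)\<parallel>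
      \<le> (c + c') * \<parallel>x\<parallel>"
    by (simp add: algebra_simps)
qed

text \<open>Leibniz rule for commutators: \<open>D D' V - V D D'\<close> is the sum of
  \<open>D (D' V - V D')\<close> and \<open>(D V - V D) D'\<close>.\<close>

lemma comm_le_mult:
  assumes "comm_le d V w c" "comm_le d V w' c'"
    and b: "\<And>i. i < d \<Longrightarrow> cmod (w i) \<le> b" "\<And>i. i < d \<Longrightarrow> cmod (w' i) \<le> b'"
    and nn: "0 \<le> b" "0 \<le> b'" "0 \<le> c"
  shows "comm_le d V (\<lambda>i. w i * w' i) (b * c' + b' * c)"
  unfolding comm_le_def
proof
  fix x :: "complex vec" assume x: "x \<in> carrier_vec d"
  note Vx = unitary_mult_vec_carrier[OF x]
  let ?D = "diag_of d w" and ?D' = "diag_of d w'"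
  define y where "y = ?D' *\<^sub>v x"
  have y: "y \<in> carrier_vec d" using x by (simp add: y_def)
  note Vy = unitary_mult_vec_carrier[OF y]
  have z: "?D' *\<^sub>v (V *\<^sub>v x) - V *\<^sub>v y \<in> carrier_vec d" using Vx Vy by simp
  have "\<parallel>?D *\<^sub>v (?D' *\<^sub>v (V *\<^sub>v x)) - ?D *\<^sub>v (V *\<^sub>v y)\<parallel> = \<parallel>?D *\<^sub>v (?D' *\<^sub>v (V *\<^sub>v x) - V *\<^sub>v y)\<parallel>"
    using Vx Vy by (subst mult_minus_mat_vec[OF diag_of_carrier]) auto
  also have "\<dots> \<le> b * \<parallel>?D' *\<^sub>v (V *\<^sub>v x) - V *\<^sub>v y\<parallel>"
    by (rule vec_l2_norm_diag_of_le[OF z b(1) nn(1)])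
  also have "\<dots> \<le> b * (c' * \<parallel>x\<parallel>)"
    using assms x by (intro mult_left_mono) (auto simp: comm_le_def y_def)
  finally have 1: "\<parallel>?D *\<^sub>v (?D' *\<^sub>v (V *\<^sub>v x)) - ?D *\<^sub>v (V *\<^sub>v y)\<parallel> \<le> b * (c' * \<parallel>x\<parallel>)" .
  have "\<parallel>?D *\<^sub>v (V *\<^sub>v y) - V *\<^sub>v (?D *\<^sub>v y)\<parallel> \<le> c * \<parallel>y\<parallel>"
    using assms y by (auto simp: comm_le_def)
  also have "\<dots> \<le> c * (b' * \<parallel>x\<parallel>)"
    unfolding y_def by (intro mult_left_mono vec_l2_norm_diag_of_le[OF x b(2) nn(2)] nn)
  finally have 2: "\<parallel>?D *\<^sub>v (V *\<^sub>v y) - V *\<^sub>v (?D *\<^sub>v y)\<parallel> \<le> c * (b' * \<parallel>x\<parallel>)" .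
  have "\<parallel>?D *\<^sub>v (?D' *\<^sub>v (V *\<^sub>v x)) - V *\<^sub>v (?D *\<^sub>v y)\<parallel> \<le> b * (c' * \<parallel>x\<parallel>) + c * (b' * \<parallel>x\<parallel>)"
    using y Vx Vy unitary_mult_vec_carrier[of "?D *\<^sub>v y"]
    by (intro vec_l2_norm_diff_triangle[OF _ _ _ 1 2]) auto
  then show "\<parallel>diag_of d (\<lambda>i. w i * w' i) *\<^sub>v (V *\<^sub>v x) - V *\<^sub>v (diag_of d (\<lambda>i. w i * w' i) *\<^sub>v x)\<parallel>
      \<le> (b * c' + b' * c) * \<parallel>x\<parallel>"
    using x Vx unfolding y_def by (simp add: diag_of_mult_vec_mult algebra_simps)
qed

text \<open>For a unitary \<open>D\<close> with adjoint \<open>D'\<close> one has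
  \<open>D' V - V D' = D' (V D - D V) D'\<close>, so the constant is unchanged.\<close>

lemma comm_le_cnj:
  assumes comm: "comm_le d V w c" and w: "\<And>i. i < d \<Longrightarrow> cmod (w i) = 1" and c: "0 \<le> c"
  shows "comm_le d V (\<lambda>i. cnj (w i)) c"
  unfolding comm_le_def
proof
  fix x :: "complex vec" assume x: "x \<in> carrier_vec d"
  let ?D = "diag_of d w" and ?D' = "diag_of d (\<lambda>i. cnj (w i))"
  have ww: "cnj (w i) * w i = 1" if "i < d" for i
    using w[OF that] complex_norm_square[of "w i"] by (simp add: mult.commute)
  have cancel: "?D' *\<^sub>v (?D *\<^sub>v v) = v" "?D *\<^sub>v (?D' *\<^sub>v v) = v" if "v \<in> carrier_vec d" for v
    using that ww by (auto simp: diag_of_mult_vec_mult diag_of_mult_vec mult.commute intro!: eq_vecI)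
  define y where "y = ?D' *\<^sub>v x"
  have y: "y \<in> carrier_vec d" and xy: "x = ?D *\<^sub>v y" using x by (auto simp: y_def cancel)
  note Vx = unitary_mult_vec_carrier[OF x] and Vy = unitary_mult_vec_carrier[OF y]
  have "?D' *\<^sub>v (V *\<^sub>v x) - V *\<^sub>v y = ?D' *\<^sub>v (V *\<^sub>v (?D *\<^sub>v y) - ?D *\<^sub>v (V *\<^sub>v y))"
    using Vx Vy by (subst mult_minus_mat_vec[OF diag_of_carrier]) (auto simp: cancel xy[symmetric])
  also have "\<parallel>\<dots>\<parallel> \<le> 1 * \<parallel>V *\<^sub>v (?D *\<^sub>v y) - ?D *\<^sub>v (V *\<^sub>v y)\<parallel>"
    using Vx Vy w by (intro vec_l2_norm_diag_of_le) (auto simp: xy[symmetric])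
  also have "\<dots> = \<parallel>?D *\<^sub>v (V *\<^sub>v y) - V *\<^sub>v (?D *\<^sub>v y)\<parallel>"
    using carrier_matD[OF unitary_groupD(1)[OF V]] unfolding mult_1
    by (intro vec_l2_norm_minus_commute) simp
  also have "\<dots> \<le> c * \<parallel>y\<parallel>" using comm y by (auto simp: comm_le_def)
  also have "\<parallel>y\<parallel> \<le> 1 * \<parallel>x\<parallel>"
    unfolding y_def using w by (intro vec_l2_norm_diag_of_le[OF x]) auto
  finally show "\<parallel>?D' *\<^sub>v (V *\<^sub>v x) - V *\<^sub>v (?D' *\<^sub>v x)\<parallel> \<le> c * \<parallel>x\<parallel>"
    using c by (simp add: y_def mult_left_mono)
qed

text \<open>The diagonal matrix of \<open>w' - w\<close> has norm at most \<open>e\<close> and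
  stands once to the left and once to the right of a unitary, whence the factor 2.\<close>

lemma comm_le_approx:
  assumes comm: "comm_le d V w c" and e: "\<And>i. i < d \<Longrightarrow> cmod (w' i - w i) \<le> e" and "0 \<le> e"
  shows "comm_le d V w' (c + 2 * e)"
proof -
  have "comm_le d V (\<lambda>i. w' i - w i) (2 * e)"
    unfolding comm_le_def
  proof
    fix x :: "complex vec" assume x: "x \<in> carrier_vec d"
    note Vx = unitary_mult_vec_carrier[OF x]
    let ?D = "diag_of d (\<lambda>i. w' i - w i)"
    have "\<parallel>?D *\<^sub>v (V *\<^sub>v x) - V *\<^sub>v (?D *\<^sub>v x)\<parallel> \<le> \<parallel>?D *\<^sub>v (V *\<^sub>v x)\<parallel> + \<parallel>V *\<^sub>v (?D *\<^sub>v x)\<parallel>"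
      using carrier_matD[OF unitary_groupD(1)[OF V]] by (intro vec_l2_norm_triangle_minus) simp
    also have "\<dots> \<le> e * \<parallel>x\<parallel> + e * \<parallel>x\<parallel>"
      using x Vx vec_l2_norm_diag_of_le[OF Vx e \<open>0 \<le> e\<close>] vec_l2_norm_diag_of_le[OF x e \<open>0 \<le> e\<close>]
      by (intro add_mono) (auto simp: vec_l2_norm_unitary[OF V])
    finally show "\<parallel>?D *\<^sub>v (V *\<^sub>v x) - V *\<^sub>v (?D *\<^sub>v x)\<parallel> \<le> 2 * e * \<parallel>x\<parallel>" by simp
  qed
  from comm_le_add[OF comm this] show ?thesis by simp
qed

end

text \<open>The order of the quantifiers matters: \<open>C\<close> depends on the polynomial only,
  not on dimension, unitary or eigenvalues. Real polynomial functions of a complex variable are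
  polynomials in \<open>z\<close> and its conjugate, so the rules for conjugates, sums and products
  suffice.\<close>

lemma comm_le_polynomial:
  assumes "real_polynomial_function (p :: complex \<Rightarrow> real)"
  shows "\<exists>C\<ge>0. \<forall>d V u c. V \<in> carrier (unitary_group d) \<longrightarrow> (\<forall>i<d. cmod (u i) = 1) \<longrightarrow> 0 \<le> c \<longrightarrow>
    comm_le d V u c \<longrightarrow> comm_le d V (\<lambda>i. complex_of_real (p (u i))) (C * c)"
  using assms
proof (induction p rule: real_polynomial_function.induct)
  case (linear g)
  \<comment> \<open>A real-linear functional is \<open>g z = Re z * g 1 + Im z * g \<i>\<close>;
    writing the two parts through \<open>z\<close> and its conjugate gives this coefficient.\<close>
  define \<alpha> where "\<alpha> = Complex (g 1 / 2) (- g \<i> / 2)"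
  have g: "complex_of_real (g z) = \<alpha> * z + cnj \<alpha> * cnj z" for z
  proof -
    interpret bounded_linear g by fact
    have "z = Re z *\<^sub>R 1 + Im z *\<^sub>R \<i>" by (simp add: complex_eq_iff)
    then have "g z = g (Re z *\<^sub>R 1 + Im z *\<^sub>R \<i>)" by simp
    also have "\<dots> = Re z * g 1 + Im z * g \<i>" by (simp only: add scaleR real_scaleR_def)
    finally show ?thesis by (simp add: complex_eq_iff \<alpha>_def algebra_simps)
  qed
  show ?case
  proof (intro exI[of _ "2 * cmod \<alpha>"] conjI allI impI)
    fix d V u c
    assume V: "V \<in> carrier (unitary_group d)" and u: "\<forall>i<d. cmod (u i) = 1" and c: "0 \<le> (c::real)"
      and comm: "comm_le d V u c"
    have 1: "comm_le d V (\<lambda>i. \<alpha> * u i) (cmod \<alpha> * c + 1 * 0)"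
      using u c by (intro comm_le_mult[OF V comm_le_const[OF V] comm]) auto
    have 2: "comm_le d V (\<lambda>i. cnj \<alpha> * cnj (u i)) (cmod \<alpha> * c + 1 * 0)"
      using u c by (intro comm_le_mult[OF V comm_le_const[OF V] comm_le_cnj[OF V comm]]) auto
    show "comm_le d V (\<lambda>i. complex_of_real (g (u i))) (2 * cmod \<alpha> * c)"
      using comm_le_add[OF V 1 2] by (simp add: g algebra_simps)
  qed simp
next
  case (const a)
  show ?case by (intro exI[of _ 0]) (auto intro: comm_le_const)
next
  case (add f g)
  then obtain C C' where C: "C \<ge> 0" "\<And>d V u c. V \<in> carrier (unitary_group d) \<Longrightarrow> (\<forall>i<d. cmod (u i) = 1) \<Longrightarrow> 0 \<le> c \<Longrightarrow>
    comm_le d V u c \<Longrightarrow> comm_le d V (\<lambda>i. complex_of_real (f (u i))) (C * c)"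
    and C': "C' \<ge> 0" "\<And>d V u c. V \<in> carrier (unitary_group d) \<Longrightarrow> (\<forall>i<d. cmod (u i) = 1) \<Longrightarrow> 0 \<le> c \<Longrightarrow>
    comm_le d V u c \<Longrightarrow> comm_le d V (\<lambda>i. complex_of_real (g (u i))) (C' * c)"
    by metis
  show ?case
  proof (intro exI[of _ "C + C'"] conjI allI impI)
    fix d V u c
    assume a: "V \<in> carrier (unitary_group d)" "\<forall>i<d. cmod (u i) = 1" "0 \<le> (c::real)" "comm_le d V u c"
    show "comm_le d V (\<lambda>i. complex_of_real (f (u i) + g (u i))) ((C + C') * c)"
      using comm_le_add[OF a(1) C(2)[OF a] C'(2)[OF a]] by (simp add: algebra_simps)
  qed (use C C' in simp)
next
  case (mult f g)
  then obtain C C' where C: "C \<ge> 0" "\<And>d V u c. V \<in> carrier (unitary_group d) \<Longrightarrow> (\<forall>i<d. cmod (u i) = 1) \<Longrightarrow> 0 \<le> c \<Longrightarrow>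
    comm_le d V u c \<Longrightarrow> comm_le d V (\<lambda>i. complex_of_real (f (u i))) (C * c)"
    and C': "C' \<ge> 0" "\<And>d V u c. V \<in> carrier (unitary_group d) \<Longrightarrow> (\<forall>i<d. cmod (u i) = 1) \<Longrightarrow> 0 \<le> c \<Longrightarrow>
    comm_le d V u c \<Longrightarrow> comm_le d V (\<lambda>i. complex_of_real (g (u i))) (C' * c)"
    by metis
  \<comment> \<open>The product rule needs bounds of both factors at every possible eigenvalue;
    compactness of the unit circle supplies them.\<close>
  have bound: "\<exists>B>0. \<forall>z. cmod z = 1 \<longrightarrow> \<bar>h z\<bar> \<le> B" if "real_polynomial_function h" for h :: "complex \<Rightarrow> real"
  proof -
    have "continuous_on (sphere 0 1) h"
      using that continuous_on_polymonial_function real_polynomial_function_eq by blast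
    then have "bounded (h ` sphere 0 1)"
      by (intro compact_imp_bounded compact_continuous_image) auto
    then obtain B where "B > 0" "\<And>z. z \<in> sphere 0 1 \<Longrightarrow> \<bar>h z\<bar> \<le> B"
      unfolding bounded_pos by auto
    then show ?thesis by (intro exI[of _ B]) auto
  qed
  obtain B B' where B: "B > 0" "\<And>z. cmod z = 1 \<Longrightarrow> \<bar>f z\<bar> \<le> B"
    and B': "B' > 0" "\<And>z. cmod z = 1 \<Longrightarrow> \<bar>g z\<bar> \<le> B'"
    using bound[OF mult.hyps(1)] bound[OF mult.hyps(2)] by metis
  show ?case
  proof (intro exI[of _ "B * C' + B' * C"] conjI allI impI)
    fix d V u c
    assume a: "V \<in> carrier (unitary_group d)" "\<forall>i<d. cmod (u i) = 1" "0 \<le> (c::real)" "comm_le d V u c"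
    have "comm_le d V (\<lambda>i. complex_of_real (f (u i)) * complex_of_real (g (u i))) (B * (C' * c) + B' * (C * c))"
      using a B B' C(1) by (intro comm_le_mult[OF a(1) C(2)[OF a] C'(2)[OF a]]) auto
    then show "comm_le d V (\<lambda>i. complex_of_real (f (u i) * g (u i))) ((B * C' + B' * C) * c)"
      by (simp add: algebra_simps)
  qed (use C C' B B' in simp)
qed

text \<open>Stone-Weierstrass on the circle. A polynomial within \<epsilon>/4 of \<open>F\<close>
  costs \<epsilon>/2, and \<delta> leaves at most \<epsilon>/2 for the polynomial; the summand 1 in
  its denominator avoids a division by zero when \<open>C\<close> is 0.\<close>

lemma comm_le_continuous:
  assumes F: "continuous_on (sphere 0 1) (F :: complex \<Rightarrow> real)" and \<epsilon>: "\<epsilon> > 0"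
  shows "\<exists>\<delta>>0. \<forall>d V u. V \<in> carrier (unitary_group d) \<longrightarrow> (\<forall>i<d. cmod (u i) = 1) \<longrightarrow>
    comm_le d V u \<delta> \<longrightarrow> comm_le d V (\<lambda>i. complex_of_real (F (u i))) \<epsilon>"
proof -
  obtain p where p: "real_polynomial_function p" "\<And>z. z \<in> sphere 0 1 \<Longrightarrow> \<bar>F z - p z\<bar> < \<epsilon> / 4"
    using Stone_Weierstrass_real_polynomial_function[OF compact_sphere F, of "\<epsilon> / 4"] \<epsilon> by auto
  obtain C where C: "C \<ge> 0" "\<And>d V u c. V \<in> carrier (unitary_group d) \<Longrightarrow> (\<forall>i<d. cmod (u i) = 1) \<Longrightarrow> 0 \<le> c \<Longrightarrow>
    comm_le d V u c \<Longrightarrow> comm_le d V (\<lambda>i. complex_of_real (p (u i))) (C * c)"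
    using comm_le_polynomial[OF p(1)] by metis
  define \<delta> where "\<delta> = \<epsilon> / (2 * (C + 1))"
  have \<delta>: "\<delta> > 0" using \<epsilon> C(1) by (simp add: \<delta>_def)
  show ?thesis
  proof (intro exI[of _ \<delta>] conjI allI impI \<delta>)
    fix d V u
    assume a: "V \<in> carrier (unitary_group d)" "\<forall>i<d. cmod (u i) = 1" "comm_le d V u \<delta>"
    have "comm_le d V (\<lambda>i. complex_of_real (F (u i))) (C * \<delta> + 2 * (\<epsilon> / 4))"
    proof (rule comm_le_approx[OF a(1) C(2)[OF a(1,2) less_imp_le[OF \<delta>] a(3)]])
      fix i assume "i < d"
      then have "\<bar>F (u i) - p (u i)\<bar> < \<epsilon> / 4" using p(2)[of "u i"] a(2) by auto
      then show "cmod (complex_of_real (F (u i)) - complex_of_real (p (u i))) \<le> \<epsilon> / 4"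
        by (simp only: of_real_diff[symmetric] norm_of_real)
    qed (use \<epsilon> in simp)
    moreover have "C * \<delta> + 2 * (\<epsilon> / 4) \<le> \<epsilon>"
      using \<epsilon> C(1) by (simp add: \<delta>_def field_simps)
    ultimately show "comm_le d V (\<lambda>i. complex_of_real (F (u i))) \<epsilon>" by (rule comm_le_mono)
  qed
qed

section \<open>Covers with few overlaps\<close>

definition ramp :: "nat \<Rightarrow> real \<Rightarrow> real"
  where "ramp M x = max 0 (min 1 (real M * x))"

text \<open>For positive \<open>M\<close> the ramp climbs from 0 to 1 between 0 and 1/M, and the
  difference of two consecutive ramps is a trapezoid over the interval from n to n + 1 + 1/M. The
  root is taken because an isometry requires the squares to sum to 1.\<close>

definition bump :: "nat \<Rightarrow> nat \<Rightarrow> real \<Rightarrow> real"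
  where "bump M n x = sqrt (ramp M (x - real n) - ramp M (x - real (Suc n)))"

lemma ramp_mono: "x \<le> y \<Longrightarrow> ramp M x \<le> ramp M y"
  unfolding ramp_def by (intro max.mono min.mono mult_left_mono order_refl) auto

lemma ramp_nonpos: "x \<le> 0 \<Longrightarrow> ramp M x = 0"
  using mult_nonneg_nonpos[of "real M" x] by (simp add: ramp_def)

lemma ramp_eq_1: "M > 0 \<Longrightarrow> 1 / real M \<le> x \<Longrightarrow> ramp M x = 1"
  by (simp add: ramp_def field_simps)

lemma bump_sq: "(bump M n x)\<^sup>2 = ramp M (x - real n) - ramp M (x - real (Suc n))"
  unfolding bump_def by (rule real_sqrt_pow2) (simp add: ramp_mono)

lemma continuous_bump: "continuous_on S g \<Longrightarrow> continuous_on S (\<lambda>z. bump M n (g z))"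
  unfolding bump_def ramp_def by (intro continuous_intros)

lemma bump_support:
  assumes "M > 0" "bump M n x \<noteq> 0"
  shows "real n < x" "x < real n + 1 + 1 / real M"
proof -
  show "real n < x"
    using assms(2) by (rule contrapos_np) (simp add: bump_def ramp_nonpos)
  have "1 / real M > 0" using assms by simp
  then show "x < real n + 1 + 1 / real M"
    using assms(2) by (rule_tac ccontr) (simp add: bump_def ramp_eq_1[OF assms(1)])
qed

text \<open>The squares telescope to the ramp at \<open>x\<close> minus the ramp at
  \<open>x - L\<close>; the bounds on \<open>x\<close> make these 1 and 0.\<close>

lemma sum_bump_sq:
  assumes "M > 0" "1 \<le> x" "x \<le> real L"
  shows "(\<Sum>n<L. (bump M n x)\<^sup>2) = 1"
proof -
  have "1 / real M \<le> 1" using assms(1) by simp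
  then have "1 / real M \<le> x" using assms(2) by linarith
  then show ?thesis
    unfolding bump_sq sum_lessThan_telescope'[of "\<lambda>n. ramp M (x - real n)"]
    using assms by (simp add: ramp_nonpos ramp_eq_1)
qed

text \<open>Consecutive trapezoids meet only in a strip of width 1/M to the right of an integer, and
  no three of them meet.\<close>

lemma card_bump_support:
  assumes M: "M > 0"
  shows "card {n. n < L \<and> bump M n x \<noteq> 0} \<le> (if frac x < 1 / real M then 2 else 1)"
proof -
  let ?S = "{n. n < L \<and> bump M n x \<noteq> 0}"
  have M1: "1 / real M \<le> 1" using M by simp
  note supp = bump_support[OF M]
  \<comment> \<open>Truncated subtraction is harmless: a member of \<open>?S\<close> forces the
    ceiling of \<open>x\<close> to be at least 1, and if it is 1 both candidates are 0.\<close>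
  have "?S \<subseteq> {nat \<lceil>x\<rceil> - 1, nat \<lceil>x\<rceil> - 2}"
  proof
    fix n assume "n \<in> ?S"
    then have "real n < x" "x < real n + 2" using supp M1 by fastforce+
    then have "int n < \<lceil>x\<rceil>" "\<lceil>x\<rceil> \<le> int n + 2" by linarith+
    then show "n \<in> {nat \<lceil>x\<rceil> - 1, nat \<lceil>x\<rceil> - 2}" by auto
  qed
  then have "card ?S \<le> card {nat \<lceil>x\<rceil> - 1, nat \<lceil>x\<rceil> - 2}" by (intro card_mono) auto
  also have "\<dots> \<le> 2" by (simp add: card_insert_if)
  finally have two: "card ?S \<le> 2" .
  show ?thesis
  proof (cases "frac x < 1 / real M")
    case False
    have *: "n = n'" if "n \<in> ?S" "n' \<in> ?S" "n \<le> n'" for n n'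
    proof (rule ccontr)
      assume "n \<noteq> n'"
      then have "real n + 1 \<le> real n'" using that(3) by linarith
      moreover have "real n' < x" "x < real n + 1 + 1 / real M" using supp that by auto
      ultimately have "real n' < x" "x < real n' + 1 / real M" by linarith+
      moreover from this have "\<lfloor>x\<rfloor> = int n'" using M1 by linarith
      ultimately have "frac x < 1 / real M" by (simp add: frac_def)
      then show False using False by simp
    qed
    have "n = n'" if "n \<in> ?S" "n' \<in> ?S" for n n'
      using *[OF that] *[OF that(2,1)] by (cases "n \<le> n'") simp_all
    then have "card ?S \<le> Suc 0" by (subst card_le_Suc0_iff_eq) auto
    then show ?thesis using False by simp
  qed (use two in simp)
qed

text \<open>The translates are spaced by 1/M modulo 1, and a half-open interval of this length
  contains at most one of them.\<close>

lemma card_frac_shift: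
  assumes M: "M > 0"
  shows "card {s. s < M \<and> frac (x + real s / real M) < 1 / real M} \<le> 1"
proof -
  have "s = s'" if "s < M" "s' < M" "frac (x + real s / real M) < 1 / real M"
      "frac (x + real s' / real M) < 1 / real M" for s s'
  proof -
    define a where "a = \<lfloor>x + real s / real M\<rfloor>"
    define b where "b = \<lfloor>x + real s' / real M\<rfloor>"
    have a: "0 \<le> x + real s / real M - real_of_int a" "x + real s / real M - real_of_int a < 1 / real M"
      using that(3) unfolding frac_def a_def by linarith+
    have b: "0 \<le> x + real s' / real M - real_of_int b" "x + real s' / real M - real_of_int b < 1 / real M"
      using that(4) unfolding frac_def b_def by linarith+
    have "\<bar>(x + real s / real M - real_of_int a) - (x + real s' / real M - real_of_int b)\<bar> < 1 / real M"
      using a b by linarith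
    then have "real M * \<bar>(real s - real s') / real M - real_of_int (a - b)\<bar> < real M * (1 / real M)"
      using M by (intro mult_strict_left_mono) (simp_all add: diff_divide_distrib algebra_simps)
    moreover have "real M * \<bar>(real s - real s') / real M - real_of_int (a - b)\<bar>
        = \<bar>real M * ((real s - real s') / real M - real_of_int (a - b))\<bar>"
      by (simp add: abs_mult)
    moreover have "real M * ((real s - real s') / real M - real_of_int (a - b))
        = real_of_int ((int s - int s') - int M * (a - b))"
      using M by (simp add: field_simps)
    ultimately have "real_of_int \<bar>(int s - int s') - int M * (a - b)\<bar> < 1"
      using M by (simp del: of_int_diff of_int_mult)
    \<comment> \<open>An integer of absolute value below 1 is 0. So \<open>M\<close> divides
      \<open>s - s'\<close>, and both numbers are below \<open>M\<close>.\<close>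
    then have eq: "int s - int s' = int M * (a - b)" by linarith
    then have "\<bar>int M * (a - b)\<bar> < int M * 1" using that by linarith
    then have "int M * \<bar>a - b\<bar> < int M * 1" by (simp add: abs_mult)
    then have "\<bar>a - b\<bar> < 1" using M by (simp only: mult_less_cancel_left_pos of_nat_0_less_iff)
    then show "s = s'" using eq by simp
  qed
  then show ?thesis by (subst One_nat_def, subst card_le_Suc0_iff_eq) auto
qed

lemma sum_card_swap:
  assumes "finite A" "finite B"
  shows "(\<Sum>a\<in>A. card {b \<in> B. P a b}) = (\<Sum>b\<in>B. card {a \<in> A. P a b})"
proof -
  have "(\<Sum>a\<in>A. card {b \<in> B. P a b}) = (\<Sum>a\<in>A. \<Sum>b\<in>B. of_bool (P a b))"
    using assms by (simp add: Collect_conj_eq[symmetric] Int_def)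
  also have "\<dots> = (\<Sum>b\<in>B. \<Sum>a\<in>A. of_bool (P a b))" by (rule sum.swap)
  also have "\<dots> = (\<Sum>b\<in>B. card {a \<in> A. P a b})"
    using assms by (simp add: Collect_conj_eq[symmetric] Int_def)
  finally show ?thesis .
qed

text \<open>Double counting: each point is in the bad strip for at most one of the \<open>M\<close>
  shifts, so all shifts together see at most \<open>d\<close> bad points and some shift sees at most
  d/M.\<close>

lemma exists_good_shift:
  assumes M: "M > 0"
  shows "\<exists>s<M. M * card {i. i < d \<and> frac (x i + real s / real M) < 1 / real M} \<le> d"
proof (rule ccontr)
  let ?P = "\<lambda>s i. frac (x i + real s / real M) < 1 / real M"
  assume "\<not> ?thesis"
  then have "d < M * card {i \<in> {..<d}. ?P s i}" if "s < M" for s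
    using that by (auto simp: not_le)
  then have "(\<Sum>s<M. d) < (\<Sum>s<M. M * card {i \<in> {..<d}. ?P s i})"
    using M by (intro sum_strict_mono) auto
  also have "\<dots> = M * (\<Sum>i<d. card {s \<in> {..<M}. ?P s i})"
    unfolding sum_distrib_left[symmetric]
    by (rule arg_cong[OF sum_card_swap[OF finite_lessThan finite_lessThan]])
  also have "\<dots> \<le> M * (\<Sum>i<d. 1)"
    using card_frac_shift[OF M] by (intro mult_left_mono sum_mono) auto
  finally show False by simp
qed

text \<open>Cells of a square grid of mesh \<open>1/K\<close>, with overlaps of width \<open>1/(K M)\<close>. Only finitely many
  translates of the grid are used, and by averaging over them the overlaps of one of them contain few
  of the given points.\<close>

theorem exists_cover:
  assumes \<epsilon>: "\<epsilon> > 0"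
  shows "\<exists>\<F> :: (nat \<times> nat \<Rightarrow> complex \<Rightarrow> real) set. \<exists>J. finite \<F> \<and> finite J \<and>
    (\<forall>F\<in>\<F>. \<forall>j\<in>J. continuous_on (sphere 0 1) (F j)) \<and>
    (\<forall>F\<in>\<F>. \<forall>z. cmod z = 1 \<longrightarrow> (\<Sum>j\<in>J. (F j z)\<^sup>2) = 1) \<and>
    (\<forall>F\<in>\<F>. \<forall>j\<in>J. \<forall>z w. F j z \<noteq> 0 \<longrightarrow> F j w \<noteq> 0 \<longrightarrow> cmod (z - w) \<le> \<epsilon>) \<and>
    (\<forall>d u. (\<forall>i<d. cmod (u i) = 1) \<longrightarrow>
      (\<exists>F\<in>\<F>. real (\<Sum>j\<in>J. card {i. i < d \<and> F j (u i) \<noteq> 0}) \<le> (1 + \<epsilon>) * real d))"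
proof -
  \<comment> \<open>The number \<open>K\<close> has two uses, hence the single condition
    4/\<epsilon>. A cell has diameter at most 4/K, with 2/K from each coordinate; and the excess
    dimension will be at most 4 d/M, with 2 d/M from each family of strips.\<close>
  obtain K :: nat where K: "K > 0" "4 / \<epsilon> < real K"
    using reals_Archimedean2[of "4 / \<epsilon>"] \<epsilon> by (metis divide_pos_pos gr0I less_asym of_nat_0 zero_less_numeral)
  define M where "M = K"
  have M: "M > 0" using K by (simp add: M_def)
  have M\<epsilon>: "4 \<le> \<epsilon> * real M" using K \<epsilon> by (simp add: M_def field_simps)
  have K\<epsilon>: "4 / real K \<le> \<epsilon>" using K \<epsilon> by (simp add: field_simps)
  \<comment> \<open>Whatever the shift, coordinates between -1 and 1 land between 1 and 2 K + 2. The
    summand 1 in \<open>c\<close> meets the lower bound demanded by \<open>sum_bump_sq\<close>, and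
    \<open>L\<close> exceeds the upper end.\<close>
  define L where "L = 2 * K + 3"
  define c where "c s r = real K * (r + 1) + 1 + real s / real M" for s r
  \<comment> \<open>Rectangles in the plane are used instead of arcs of the circle, so that no
    branch of the argument has to be chosen.\<close>
  define F where "F st ab z = (case st of (s, t) \<Rightarrow> case ab of (a, b) \<Rightarrow>
    bump M a (c s (Re z)) * bump M b (c t (Im z)))" for st ab z
  define J where "J = {..<L} \<times> {..<L}"
  define \<F> where "\<F> = F ` ({..<M} \<times> {..<M})"
  have cb: "1 \<le> c s r" "c s r \<le> real L" if "\<bar>r\<bar> \<le> 1" "s < M" for s r
  proof -
    have "real K * (r + 1) \<le> real K * 2" "0 \<le> real K * (r + 1)"
      using that by (auto intro: mult_left_mono)
    moreover have "0 \<le> real s / real M" "real s / real M \<le> 1" using that M by auto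
    ultimately show "1 \<le> c s r" "c s r \<le> real L" by (auto simp: c_def L_def)
  qed
  have close: "\<bar>r - r'\<bar> \<le> 2 / real K"
    if "bump M a (c s r) \<noteq> 0" "bump M a (c s r') \<noteq> 0" for a s r r'
  proof -
    have "1 / real M \<le> 1" using M by simp
    then have "\<bar>c s r - c s r'\<bar> \<le> 2"
      using bump_support[OF M that(1)] bump_support[OF M that(2)] by linarith
    then have "real K * \<bar>r - r'\<bar> \<le> 2"
      by (simp add: c_def right_diff_distrib[symmetric] abs_mult)
    then show ?thesis using K(1) by (simp add: field_simps)
  qed
  have "continuous_on (sphere 0 1) (F (s, t) (a, b))" for s t a b
    unfolding F_def c_def by (auto intro!: continuous_intros continuous_bump)
  then have 1: "\<forall>G\<in>\<F>. \<forall>j\<in>J. continuous_on (sphere 0 1) (G j)"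
    by (auto simp: \<F>_def J_def)
  have 2: "\<forall>G\<in>\<F>. \<forall>z. cmod z = 1 \<longrightarrow> (\<Sum>j\<in>J. (G j z)\<^sup>2) = 1"
  proof (intro ballI allI impI)
    fix G z assume "G \<in> \<F>" and z: "cmod z = 1"
    then obtain s t where st: "s < M" "t < M" "G = F (s, t)" by (auto simp: \<F>_def)
    have r: "\<bar>Re z\<bar> \<le> 1" "\<bar>Im z\<bar> \<le> 1" using abs_Re_le_cmod[of z] abs_Im_le_cmod[of z] z by auto
    have "(\<Sum>j\<in>J. (G j z)\<^sup>2) = (\<Sum>a<L. \<Sum>b<L. (bump M a (c s (Re z)))\<^sup>2 * (bump M b (c t (Im z)))\<^sup>2)"
      unfolding J_def sum.cartesian_product by (intro sum.cong) (auto simp: st F_def power_mult_distrib)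
    also have "\<dots> = (\<Sum>a<L. (bump M a (c s (Re z)))\<^sup>2) * (\<Sum>b<L. (bump M b (c t (Im z)))\<^sup>2)"
      by (simp add: sum_product)
    also have "\<dots> = 1"
      using cb[OF r(1) st(1)] cb[OF r(2) st(2)] by (simp add: sum_bump_sq[OF M])
    finally show "(\<Sum>j\<in>J. (G j z)\<^sup>2) = 1" .
  qed
  have 3: "\<forall>G\<in>\<F>. \<forall>j\<in>J. \<forall>z w. G j z \<noteq> 0 \<longrightarrow> G j w \<noteq> 0 \<longrightarrow> cmod (z - w) \<le> \<epsilon>"
  proof (intro ballI allI impI)
    fix G j z w assume "G \<in> \<F>" "j \<in> J" and nz: "G j z \<noteq> 0" "G j w \<noteq> 0"
    then obtain s t a b where G: "G = F (s, t)" "j = (a, b)" by (auto simp: \<F>_def J_def)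
    have "cmod (z - w) \<le> \<bar>Re (z - w)\<bar> + \<bar>Im (z - w)\<bar>" by (rule cmod_le)
    also have "\<dots> \<le> 2 / real K + 2 / real K"
      using nz unfolding G F_def by (intro add_mono) (auto intro: close)
    also have "\<dots> \<le> \<epsilon>" using K\<epsilon> by simp
    finally show "cmod (z - w) \<le> \<epsilon>" .
  qed
  have 4: "\<exists>G\<in>\<F>. real (\<Sum>j\<in>J. card {i. i < d \<and> G j (u i) \<noteq> 0}) \<le> (1 + \<epsilon>) * real d" for d u
  proof -
    define x where "x i = real K * (Re (u i) + 1) + 1" for i
    define y where "y i = real K * (Im (u i) + 1) + 1" for i
    obtain s where s: "s < M" "M * card {i. i < d \<and> frac (x i + real s / real M) < 1 / real M} \<le> d"
      using exists_good_shift[OF M] by blast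
    obtain t where t: "t < M" "M * card {i. i < d \<and> frac (y i + real t / real M) < 1 / real M} \<le> d"
      using exists_good_shift[OF M] by blast
    define A where "A = {i. i < d \<and> frac (x i + real s / real M) < 1 / real M}"
    define B where "B = {i. i < d \<and> frac (y i + real t / real M) < 1 / real M}"
    have AB: "finite A" "finite B" "A \<subseteq> {..<d}" "B \<subseteq> {..<d}" by (auto simp: A_def B_def)
    \<comment> \<open>The counts in the two directions multiply; 2 * 2 <= 1 + 2 + 2 turns the
      product into a bound additive in \<open>A\<close> and \<open>B\<close>.\<close>
    have cnt: "card {j \<in> J. F (s, t) j (u i) \<noteq> 0} \<le>
        1 + 2 * (if i \<in> A then 1 else 0) + 2 * (if i \<in> B then 1 else 0)" if i: "i < d" for i
    proof -
      let ?X = "{a. a < L \<and> bump M a (c s (Re (u i))) \<noteq> 0}"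
      let ?Y = "{b. b < L \<and> bump M b (c t (Im (u i))) \<noteq> 0}"
      have "card {j \<in> J. F (s, t) j (u i) \<noteq> 0} = card ?X * card ?Y"
        unfolding card_cartesian_product[symmetric]
        by (rule arg_cong[of _ _ card]) (auto simp: J_def F_def)
      also have "\<dots> \<le> (if i \<in> A then 2 else 1) * (if i \<in> B then 2 else 1)"
        using card_bump_support[OF M, of L "c s (Re (u i))"] card_bump_support[OF M, of L "c t (Im (u i))"] i
        by (intro mult_mono) (auto simp: A_def B_def c_def x_def y_def)
      also have "\<dots> \<le> 1 + 2 * (if i \<in> A then 1 else 0) + 2 * (if i \<in> B then 1 else 0)" by simp
      finally show ?thesis .
    qed
    have "(\<Sum>j\<in>J. card {i. i < d \<and> F (s, t) j (u i) \<noteq> 0}) = (\<Sum>j\<in>J. card {i \<in> {..<d}. F (s, t) j (u i) \<noteq> 0})"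
      by (intro sum.cong arg_cong[of _ _ card]) auto
    also have "\<dots> = (\<Sum>i<d. card {j \<in> J. F (s, t) j (u i) \<noteq> 0})"
      by (rule sum_card_swap) (auto simp: J_def)
    also have "\<dots> \<le> (\<Sum>i<d. 1 + 2 * (if i \<in> A then 1 else 0) + 2 * (if i \<in> B then 1 else 0))"
      using cnt by (intro sum_mono) auto
    also have "\<dots> = d + 2 * card A + 2 * card B"
    proof -
      have "(\<Sum>i<d. if i \<in> A then 1 else 0) = card A" "(\<Sum>i<d. if i \<in> B then 1 else 0) = card B"
        using AB by (simp_all add: sum.If_cases Int_absorb1)
      then show ?thesis unfolding sum.distrib sum_distrib_left[symmetric] by simp
    qed
    finally have "M * (\<Sum>j\<in>J. card {i. i < d \<and> F (s, t) j (u i) \<noteq> 0}) \<le> M * (d + 2 * card A + 2 * card B)"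
      by (rule mult_le_mono2)
    also have "\<dots> \<le> M * d + 4 * d"
      using s(2) t(2) by (simp add: A_def B_def algebra_simps)
    finally have "real (M * (\<Sum>j\<in>J. card {i. i < d \<and> F (s, t) j (u i) \<noteq> 0})) \<le> real (M * d + 4 * d)"
      by (rule of_nat_mono)
    then have "real M * real (\<Sum>j\<in>J. card {i. i < d \<and> F (s, t) j (u i) \<noteq> 0}) \<le> real M * real d + 4 * real d"
      unfolding of_nat_mult of_nat_add of_nat_numeral .
    also have "\<dots> \<le> real M * real d + (\<epsilon> * real M) * real d"
      using M\<epsilon> by (intro add_left_mono mult_right_mono) auto
    also have "\<dots> = real M * ((1 + \<epsilon>) * real d)" by (simp add: algebra_simps)
    finally have "real (\<Sum>j\<in>J. card {i. i < d \<and> F (s, t) j (u i) \<noteq> 0}) \<le> (1 + \<epsilon>) * real d"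
      using M by (simp only: mult_le_cancel_left_pos of_nat_0_less_iff)
    then show ?thesis using s(1) t(1) by (intro bexI[of _ "F (s, t)"]) (auto simp: \<F>_def)
  qed
  show ?thesis
    by (intro exI[of _ \<F>] exI[of _ J] conjI 1 2 3 allI impI 4) (auto simp: \<F>_def J_def)
qed

section \<open>Almost commuting unitaries\<close>

text \<open>With \<open>w\<close> the image of \<open>v\<close> under the adjoint, the square of the
  norm of \<open>w\<close> is the inner product of \<open>A w\<close> and \<open>v\<close>, at most
  \<open>c\<close> times the norms of \<open>w\<close> and \<open>v\<close>; divide by the norm of
  \<open>w\<close>.\<close>

lemma norm_bounded_by_adjoint:
  assumes A: "A \<in> carrier_mat m n" and c: "norm_bounded_by A c" "0 \<le> c"
  shows "norm_bounded_by (mat_adjoint A) c"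
proof (rule norm_bounded_byI[OF mat_adjoint_carrier[OF A]])
  fix v :: "complex vec" assume v: "v \<in> carrier_vec m"
  define w where "w = mat_adjoint A *\<^sub>v v"
  have w: "w \<in> carrier_vec n" unfolding w_def by (rule mult_mat_vec_carrier[OF mat_adjoint_carrier[OF A] v])
  have Aw: "A *\<^sub>v w \<in> carrier_vec m" by (rule mult_mat_vec_carrier[OF A w])
  have "complex_of_real (\<parallel>w\<parallel>\<^sup>2) = (A *\<^sub>v w) \<bullet>c v"
    using cscalar_prod_mult_mat_vec[OF A w v] unfolding w_def[symmetric] cscalar_prod_self by simp
  then have "\<parallel>w\<parallel>\<^sup>2 = cmod ((A *\<^sub>v w) \<bullet>c v)" by (metis norm_of_real abs_power2)
  also have "\<dots> \<le> \<parallel>A *\<^sub>v w\<parallel> * \<parallel>v\<parallel>" by (rule cmod_cscalar_prod_le[OF Aw v])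
  also have "\<dots> \<le> (c * \<parallel>w\<parallel>) * \<parallel>v\<parallel>"
    using norm_bounded_byD[OF c(1) A w] by (intro mult_right_mono) auto
  finally have le: "\<parallel>w\<parallel> * \<parallel>w\<parallel> \<le> \<parallel>w\<parallel> * (c * \<parallel>v\<parallel>)" by (simp add: power2_eq_square mult_ac)
  show "\<parallel>mat_adjoint A *\<^sub>v v\<parallel> \<le> c * \<parallel>v\<parallel>"
  proof (cases "\<parallel>w\<parallel> = 0")
    case True
    then show ?thesis using c(2) unfolding w_def[symmetric] by simp
  next
    case False
    then have "0 < \<parallel>w\<parallel>" by (simp add: less_le)
    then show ?thesis using le unfolding w_def[symmetric] by simp
  qed
qed

text \<open>\<open>Q\<close> reads off the coordinates listed in \<open>l\<close>. The spectral
  subspaces of a diagonal matrix are coordinate subspaces, and \<open>Q\<close> identifies such a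
  subspace with the vectors of length \<open>length l\<close>.\<close>

lemma exists_coordinate_coisometry:
  assumes l: "distinct l" "set l \<subseteq> {..<d}"
  shows "\<exists>Q :: complex mat. Q \<in> carrier_mat (length l) d \<and> Q * mat_adjoint Q = 1\<^sub>m (length l) \<and>
    mat_adjoint Q * Q = diag_of d (\<lambda>i. of_bool (i \<in> set l))"
proof -
  define Q :: "complex mat" where "Q = mat (length l) d (\<lambda>(p, i). of_bool (l ! p = i))"
  have Q: "Q \<in> carrier_mat (length l) d" by (simp add: Q_def)
  have "Q * mat_adjoint Q = 1\<^sub>m (length l)"
  proof (rule eq_matI)
    fix p q assume "p < dim_row (1\<^sub>m (length l) :: complex mat)" "q < dim_col (1\<^sub>m (length l) :: complex mat)"
    then have pq: "p < length l" "q < length l" by auto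
    have "(Q * mat_adjoint Q) $$ (p, q) = (\<Sum>i<d. if i = l ! p then of_bool (l ! q = i) else 0)"
      unfolding mult_adjoint_self_index[OF Q pq] using pq by (intro sum.cong) (auto simp: Q_def)
    also have "\<dots> = of_bool (l ! q = l ! p)"
      using l(2) nth_mem[OF pq(1)] by (auto simp: sum.delta)
    finally show "(Q * mat_adjoint Q) $$ (p, q) = 1\<^sub>m (length l) $$ (p, q)"
      using pq l(1) by (auto simp: nth_eq_iff_index_eq)
  qed (use Q in auto)
  moreover have "mat_adjoint Q * Q = diag_of d (\<lambda>i. of_bool (i \<in> set l))"
  proof (rule eq_matI)
    fix a b assume "a < dim_row (diag_of d (\<lambda>i. of_bool (i \<in> set l)))" "b < dim_col (diag_of d (\<lambda>i. of_bool (i \<in> set l)))"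
    then have ab: "a < d" "b < d" by auto
    have "(mat_adjoint Q * Q) $$ (a, b) = (\<Sum>p<length l. of_bool (l ! p = a) * of_bool (l ! p = b))"
      unfolding adjoint_mult_self_index[OF Q ab] using ab by (intro sum.cong) (auto simp: Q_def)
    also have "\<dots> = (\<Sum>i\<in>set l. of_bool (i = a) * of_bool (i = b))"
      unfolding sum_list_distinct_conv_sum_set[OF l(1), symmetric] sum_list_sum_nth by (simp add: atLeast0LessThan)
    also have "\<dots> = (\<Sum>i\<in>set l. if i = a then of_bool (a = b) else 0)"
      by (intro sum.cong) auto
    also have "\<dots> = diag_of d (\<lambda>i. of_bool (i \<in> set l)) $$ (a, b)"
      using ab by (auto simp: diag_of_def sum.delta)
    finally show "(mat_adjoint Q * Q) $$ (a, b) = diag_of d (\<lambda>i. of_bool (i \<in> set l)) $$ (a, b)" .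
  qed (use Q in auto)
  ultimately show ?thesis using Q by blast
qed

text \<open>The compression \<open>Q V Q\<^sup>*\<close> of \<open>V\<close> is almost isometric on the range of \<open>Q w\<close>, and so the unitary
  part of its polar decomposition can replace it there.\<close>

lemma local_piece:
  assumes V: "V \<in> carrier (unitary_group d)" and w: "\<And>i. i < d \<Longrightarrow> cmod (w i) \<le> 1"
    and comm: "comm_le d V w \<eta>" and \<eta>: "\<eta> > 0" and m: "m = card {i. i < d \<and> w i \<noteq> 0}"
  shows "\<exists>W V'. W \<in> carrier_mat m d \<and> V' \<in> carrier (unitary_group m) \<and>
    mat_adjoint W * W = diag_of d (\<lambda>i. cnj (w i) * w i) \<and>
    (\<forall>x\<in>carrier_vec d. \<parallel>V' *\<^sub>v (W *\<^sub>v x) - W *\<^sub>v (V *\<^sub>v x)\<parallel> \<le> 4 * \<eta> * \<parallel>x\<parallel>) \<and>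
    (\<forall>u \<mu> \<epsilon>. (\<forall>i<d. w i \<noteq> 0 \<longrightarrow> cmod (\<mu> - u i) \<le> \<epsilon>) \<longrightarrow> 0 \<le> \<epsilon> \<longrightarrow>
      (\<forall>x\<in>carrier_vec d. \<parallel>\<mu> \<cdot>\<^sub>v (W *\<^sub>v x) - W *\<^sub>v (diag_of d u *\<^sub>v x)\<parallel> \<le> \<epsilon> * \<parallel>W *\<^sub>v x\<parallel>))"
proof -
  define S where "S = {i. i < d \<and> w i \<noteq> 0}"
  obtain l where l: "distinct l" "set l = S" using finite_distinct_list[of S] by (auto simp: S_def)
  have ml: "length l = m" using distinct_card[OF l(1)] l(2) m by (simp add: S_def)
  obtain Q :: "complex mat" where Q: "Q \<in> carrier_mat m d" and QQ': "Q * mat_adjoint Q = 1\<^sub>m m"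
    and Q'Q: "mat_adjoint Q * Q = diag_of d (\<lambda>i. of_bool (i \<in> S))"
    using exists_coordinate_coisometry[OF l(1), of d] l(2) unfolding ml by (auto simp: S_def)
  note Q' = mat_adjoint_carrier[OF Q]
  note v = unitary_groupD(1)[OF V] and v' = unitary_groupD(4)[OF V]
  define E where "E = diag_of d (\<lambda>i. of_bool (i \<in> S) :: complex)"
  define D where "D = diag_of d w"
  have E: "E \<in> carrier_mat d d" and D: "D \<in> carrier_mat d d" by (simp_all add: E_def D_def)
  have car: "Q *\<^sub>v x \<in> carrier_vec m" "V *\<^sub>v x \<in> carrier_vec d" "mat_adjoint V *\<^sub>v x \<in> carrier_vec d"
    "E *\<^sub>v x \<in> carrier_vec d" "D *\<^sub>v x \<in> carrier_vec d" if "x \<in> carrier_vec d" for x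
    using mult_mat_vec_carrier[OF Q that] mult_mat_vec_carrier[OF v that] mult_mat_vec_carrier[OF v' that]
      mult_mat_vec_carrier[OF E that] mult_mat_vec_carrier[OF D that] by auto
  have car': "mat_adjoint Q *\<^sub>v y \<in> carrier_vec d" if "y \<in> carrier_vec m" for y
    by (rule mult_mat_vec_carrier[OF Q' that])
  have Q'Qx: "mat_adjoint Q *\<^sub>v (Q *\<^sub>v x) = E *\<^sub>v x" if "x \<in> carrier_vec d" for x
    using assoc_mult_mat_vec[OF Q' Q that] by (simp add: Q'Q E_def)
  have nQ': "\<parallel>mat_adjoint Q *\<^sub>v y\<parallel> = \<parallel>y\<parallel>" if "y \<in> carrier_vec m" for y
    using vec_l2_norm_isometry[OF Q' _ that] QQ' by (simp add: mat_adjoint_adjoint[OF Q])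
  have "norm_bounded_by (mat_adjoint (mat_adjoint Q)) 1"
    using nQ' by (intro norm_bounded_by_adjoint[OF Q'] norm_bounded_byI[OF Q']) auto
  then have bQ: "norm_bounded_by Q 1" by (simp add: mat_adjoint_adjoint[OF Q])
  have nQ: "\<parallel>Q *\<^sub>v x\<parallel> \<le> \<parallel>x\<parallel>" if "x \<in> carrier_vec d" for x
    using norm_bounded_byD[OF bQ Q that] by simp
  have nE: "\<parallel>E *\<^sub>v x\<parallel> \<le> \<parallel>x\<parallel>" if "x \<in> carrier_vec d" for x
    unfolding E_def by (rule order_trans[OF vec_l2_norm_diag_of_le[OF that, of _ 1]]) simp_all
  have nD: "\<parallel>D *\<^sub>v x\<parallel> \<le> \<parallel>x\<parallel>" if "x \<in> carrier_vec d" for x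
    unfolding D_def by (rule order_trans[OF vec_l2_norm_diag_of_le[OF that w]]) simp_all
  have ED: "E *\<^sub>v (D *\<^sub>v x) = D *\<^sub>v x" if "x \<in> carrier_vec d" for x
    unfolding E_def D_def diag_of_mult_vec_mult[OF that]
    by (rule arg_cong2[of _ _ _ _ "(*\<^sub>v)", OF diag_of_cong refl]) (auto simp: S_def)
  define T where "T = Q * V * mat_adjoint Q"
  have QV: "Q * V \<in> carrier_mat m d" by (rule mult_carrier_mat[OF Q v])
  have T: "T \<in> carrier_mat m m" unfolding T_def by (rule mult_carrier_mat[OF QV Q'])
  have Ty: "T *\<^sub>v y = Q *\<^sub>v (V *\<^sub>v (mat_adjoint Q *\<^sub>v y))" if "y \<in> carrier_vec m" for y
    unfolding T_def assoc_mult_mat_vec[OF QV Q' that] assoc_mult_mat_vec[OF Q v car'[OF that]] ..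
  have T': "mat_adjoint T = Q * (mat_adjoint V * mat_adjoint Q)"
    unfolding T_def mat_adjoint_mult[OF QV Q'] mat_adjoint_mult[OF Q v] mat_adjoint_adjoint[OF Q] ..
  have V'Q': "mat_adjoint V * mat_adjoint Q \<in> carrier_mat d m" by (rule mult_carrier_mat[OF v' Q'])
  have T'y: "mat_adjoint T *\<^sub>v y = Q *\<^sub>v (mat_adjoint V *\<^sub>v (mat_adjoint Q *\<^sub>v y))" if "y \<in> carrier_vec m" for y
    unfolding T' assoc_mult_mat_vec[OF Q V'Q' that] assoc_mult_mat_vec[OF v' Q' that] ..
  have bT: "norm_bounded_by T 1"
  proof (rule norm_bounded_byI[OF T])
    fix y :: "complex vec" assume y: "y \<in> carrier_vec m"
    show "\<parallel>T *\<^sub>v y\<parallel> \<le> 1 * \<parallel>y\<parallel>"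
      using nQ[OF car(2)[OF car'[OF y]]] by (simp add: Ty[OF y] vec_l2_norm_unitary[OF V car'[OF y]] nQ'[OF y])
  qed
  obtain V' where V': "V' \<in> carrier (unitary_group m)" and V'T: "\<And>y. y \<in> carrier_vec m \<Longrightarrow>
      \<parallel>V' *\<^sub>v y - T *\<^sub>v y\<parallel> \<le> \<parallel>y - mat_adjoint T *\<^sub>v (T *\<^sub>v y)\<parallel> + \<eta> * \<parallel>y\<parallel>"
    using polar_unitary[OF T bT norm_bounded_by_adjoint[OF T bT] \<eta>] by auto
  define W where "W = Q * D"
  have W: "W \<in> carrier_mat m d" unfolding W_def by (rule mult_carrier_mat[OF Q D])
  have Wx: "W *\<^sub>v x = Q *\<^sub>v (D *\<^sub>v x)" if "x \<in> carrier_vec d" for x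
    unfolding W_def by (rule assoc_mult_mat_vec[OF Q D that])
  have "mat_adjoint W * W = mat_adjoint D * (mat_adjoint Q * (Q * D))"
    unfolding W_def mat_adjoint_mult[OF Q D]
    by (rule assoc_mult_mat[OF mat_adjoint_carrier[OF D] Q' mult_carrier_mat[OF Q D]])
  also have "\<dots> = mat_adjoint D * (E * D)"
    by (simp add: assoc_mult_mat[OF Q' Q D, symmetric] Q'Q E_def)
  also have "\<dots> = diag_of d (\<lambda>i. cnj (w i) * w i)"
    unfolding D_def E_def diag_of_adjoint diag_of_mult by (rule diag_of_cong) (auto simp: S_def)
  finally have WW: "mat_adjoint W * W = diag_of d (\<lambda>i. cnj (w i) * w i)" .
  have 1: "\<parallel>V' *\<^sub>v (W *\<^sub>v x) - W *\<^sub>v (V *\<^sub>v x)\<parallel> \<le> 4 * \<eta> * \<parallel>x\<parallel>" if x: "x \<in> carrier_vec d" for x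
  proof -
    define y where "y = W *\<^sub>v x"
    have yQ: "y = Q *\<^sub>v (D *\<^sub>v x)" by (simp add: y_def Wx[OF x])
    note Dx = car(5)[OF x] and Vx = car(2)[OF x]
    note VDx = car(2)[OF Dx] and DVx = car(5)[OF Vx]
    have y: "y \<in> carrier_vec m" unfolding yQ by (rule car(1)[OF Dx])
    have Ty': "T *\<^sub>v y = Q *\<^sub>v (V *\<^sub>v (D *\<^sub>v x))"
      unfolding Ty[OF y] unfolding yQ Q'Qx[OF Dx] ED[OF x] ..
    have r: "\<parallel>V *\<^sub>v (D *\<^sub>v x) - D *\<^sub>v (V *\<^sub>v x)\<parallel> \<le> \<eta> * \<parallel>x\<parallel>"
    proof -
      have "\<parallel>V *\<^sub>v (D *\<^sub>v x) - D *\<^sub>v (V *\<^sub>v x)\<parallel> = \<parallel>D *\<^sub>v (V *\<^sub>v x) - V *\<^sub>v (D *\<^sub>v x)\<parallel>"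
        by (intro vec_l2_norm_minus_commute) (simp only: carrier_vecD[OF VDx] carrier_vecD[OF DVx])
      then show ?thesis using comm x by (simp add: comm_le_def D_def)
    qed
    have A: "\<parallel>T *\<^sub>v y - W *\<^sub>v (V *\<^sub>v x)\<parallel> \<le> \<eta> * \<parallel>x\<parallel>"
    proof -
      have "T *\<^sub>v y - W *\<^sub>v (V *\<^sub>v x) = Q *\<^sub>v (V *\<^sub>v (D *\<^sub>v x) - D *\<^sub>v (V *\<^sub>v x))"
        unfolding Ty' Wx[OF Vx] mult_minus_mat_vec[OF Q VDx DVx] ..
      then show ?thesis using nQ[of "V *\<^sub>v (D *\<^sub>v x) - D *\<^sub>v (V *\<^sub>v x)"] VDx DVx r by simp
    qed
    \<comment> \<open>The defect is \<open>Q V\<^sup>* (1 - E) V D x\<close>, where \<open>E\<close>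
      projects onto the spectral subspace and \<open>E D = D\<close>. Now \<open>V D x\<close> is
      within one \<eta> of \<open>D V x = E D V x\<close>, which is within another of
      \<open>E V D x\<close>.\<close>
    have B: "\<parallel>y - mat_adjoint T *\<^sub>v (T *\<^sub>v y)\<parallel> \<le> \<eta> * \<parallel>x\<parallel> + \<eta> * \<parallel>x\<parallel>"
    proof -
      have EVDx: "E *\<^sub>v (V *\<^sub>v (D *\<^sub>v x)) \<in> carrier_vec d" by (rule car(4)[OF VDx])
      have TTy: "mat_adjoint T *\<^sub>v (T *\<^sub>v y) = Q *\<^sub>v (mat_adjoint V *\<^sub>v (E *\<^sub>v (V *\<^sub>v (D *\<^sub>v x))))"
        unfolding Ty' T'y[OF car(1)[OF VDx]] Q'Qx[OF VDx] ..
      have y': "y = Q *\<^sub>v (mat_adjoint V *\<^sub>v (V *\<^sub>v (D *\<^sub>v x)))"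
        unfolding unitary_cancel(3)[OF V Dx] yQ ..
      have "y - mat_adjoint T *\<^sub>v (T *\<^sub>v y) =
          Q *\<^sub>v (mat_adjoint V *\<^sub>v (V *\<^sub>v (D *\<^sub>v x) - E *\<^sub>v (V *\<^sub>v (D *\<^sub>v x))))"
        unfolding TTy mult_minus_mat_vec[OF v' VDx EVDx]
          mult_minus_mat_vec[OF Q car(3)[OF VDx] car(3)[OF EVDx]] y'[symmetric] ..
      also have "\<parallel>\<dots>\<parallel> \<le> \<parallel>V *\<^sub>v (D *\<^sub>v x) - E *\<^sub>v (V *\<^sub>v (D *\<^sub>v x))\<parallel>"
        using minus_carrier_vec[OF VDx EVDx]
        by (intro order_trans[OF nQ[OF car(3)]] order_eq_refl[OF vec_l2_norm_unitary[OF mat_adjoint_unitary[OF V]]])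
      also have "\<dots> \<le> \<eta> * \<parallel>x\<parallel> + \<eta> * \<parallel>x\<parallel>"
      proof (rule vec_l2_norm_diff_triangle[OF VDx DVx EVDx r])
        have "D *\<^sub>v (V *\<^sub>v x) - E *\<^sub>v (V *\<^sub>v (D *\<^sub>v x)) = E *\<^sub>v (D *\<^sub>v (V *\<^sub>v x) - V *\<^sub>v (D *\<^sub>v x))"
          unfolding mult_minus_mat_vec[OF E DVx VDx] ED[OF Vx] ..
        also have "\<parallel>\<dots>\<parallel> \<le> \<parallel>D *\<^sub>v (V *\<^sub>v x) - V *\<^sub>v (D *\<^sub>v x)\<parallel>"
          by (rule nE[OF minus_carrier_vec[OF DVx VDx]])
        also have "\<dots> \<le> \<eta> * \<parallel>x\<parallel>" using comm x by (simp add: comm_le_def D_def)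
        finally show "\<parallel>D *\<^sub>v (V *\<^sub>v x) - E *\<^sub>v (V *\<^sub>v (D *\<^sub>v x))\<parallel> \<le> \<eta> * \<parallel>x\<parallel>" .
      qed
      finally show ?thesis .
    qed
    have "\<parallel>y\<parallel> \<le> \<parallel>x\<parallel>"
      unfolding yQ by (rule order_trans[OF nQ[OF Dx] nD[OF x]])
    \<comment> \<open>Two \<eta> come from the defect, one from the perturbation in
      \<open>polar_unitary\<close>; the estimate \<open>A\<close> adds the fourth.\<close>
    then have "\<parallel>V' *\<^sub>v y - T *\<^sub>v y\<parallel> \<le> (\<eta> * \<parallel>x\<parallel> + \<eta> * \<parallel>x\<parallel>) + \<eta> * \<parallel>x\<parallel>"
      using \<eta> by (intro order_trans[OF V'T[OF y]] add_mono B mult_left_mono) auto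
    then have "\<parallel>V' *\<^sub>v y - W *\<^sub>v (V *\<^sub>v x)\<parallel> \<le> ((\<eta> * \<parallel>x\<parallel> + \<eta> * \<parallel>x\<parallel>) + \<eta> * \<parallel>x\<parallel>) + \<eta> * \<parallel>x\<parallel>"
      by (rule vec_l2_norm_diff_triangle[OF mult_mat_vec_carrier[OF unitary_groupD(1)[OF V'] y]
            mult_mat_vec_carrier[OF T y] mult_mat_vec_carrier[OF W Vx] _ A])
    then show ?thesis by (simp add: y_def)
  qed
  \<comment> \<open>The bound is relative to \<open>W x\<close> and not to \<open>x\<close>: over
    all cells the squared norms of \<open>W x\<close> will add up to that of \<open>x\<close>, so
    this error does not grow with the number of cells.\<close>
  have 2: "\<parallel>\<mu> \<cdot>\<^sub>v (W *\<^sub>v x) - W *\<^sub>v (diag_of d u *\<^sub>v x)\<parallel> \<le> \<epsilon> * \<parallel>W *\<^sub>v x\<parallel>"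
    if u: "\<forall>i<d. w i \<noteq> 0 \<longrightarrow> cmod (\<mu> - u i) \<le> \<epsilon>" and \<epsilon>: "0 \<le> \<epsilon>" and x: "x \<in> carrier_vec d" for u \<mu> \<epsilon> x
  proof -
    let ?U = "diag_of d u" and ?R = "diag_of d (\<lambda>i. of_bool (i \<in> S) * (\<mu> - u i))"
    note Dx = car(5)[OF x]
    have "\<mu> \<cdot>\<^sub>v (D *\<^sub>v x) - D *\<^sub>v (?U *\<^sub>v x) = ?R *\<^sub>v (D *\<^sub>v x)"
      unfolding D_def diag_of_mult_vec_mult[OF x] using x
      by (intro eq_vecI) (auto simp: diag_of_mult_vec S_def algebra_simps)
    then have "\<mu> \<cdot>\<^sub>v (W *\<^sub>v x) - W *\<^sub>v (?U *\<^sub>v x) = Q *\<^sub>v (?R *\<^sub>v (D *\<^sub>v x))"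
      unfolding Wx[OF x] Wx[OF diag_of_mult_vec_carrier[OF x]] mult_mat_vec[OF Q Dx, symmetric]
      by (subst mult_minus_mat_vec[OF Q, symmetric])
        (use Dx car(5)[OF diag_of_mult_vec_carrier[OF x]] in auto)
    also have "\<parallel>\<dots>\<parallel> \<le> \<parallel>?R *\<^sub>v (D *\<^sub>v x)\<parallel>"
      by (rule nQ[OF diag_of_mult_vec_carrier[OF Dx]])
    also have "\<dots> \<le> \<epsilon> * \<parallel>D *\<^sub>v x\<parallel>"
      using u \<epsilon> by (intro vec_l2_norm_diag_of_le[OF Dx]) (auto simp: S_def)
    also have "\<parallel>D *\<^sub>v x\<parallel> = \<parallel>W *\<^sub>v x\<parallel>"
      using nQ'[OF car(1)[OF Dx]] unfolding Wx[OF x] Q'Qx[OF Dx] ED[OF x] .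
    finally show ?thesis .
  qed
  show ?thesis
    by (intro exI[of _ W] exI[of _ V'] conjI W V' WW ballI 1 allI impI 2) auto
qed

text \<open>Which cover is used is decided only after the spectrum is known, so \<delta> has to work
  for all candidates. The inserted 1 keeps the minimum meaningful for an empty family.\<close>

lemma comm_le_continuous_uniform:
  assumes fin: "finite A" and F: "\<And>a. a \<in> A \<Longrightarrow> continuous_on (sphere 0 1) (F a :: complex \<Rightarrow> real)"
    and \<epsilon>: "\<epsilon> > 0"
  shows "\<exists>\<delta>>0. \<forall>a\<in>A. \<forall>d V u. V \<in> carrier (unitary_group d) \<longrightarrow> (\<forall>i<d. cmod (u i) = 1) \<longrightarrow>
    comm_le d V u \<delta> \<longrightarrow> comm_le d V (\<lambda>i. complex_of_real (F a (u i))) \<epsilon>"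
proof -
  have "\<forall>a\<in>A. \<exists>\<delta>>0. \<forall>d V u. V \<in> carrier (unitary_group d) \<longrightarrow> (\<forall>i<d. cmod (u i) = 1) \<longrightarrow>
    comm_le d V u \<delta> \<longrightarrow> comm_le d V (\<lambda>i. complex_of_real (F a (u i))) \<epsilon>"
    using comm_le_continuous[OF F \<epsilon>] by blast
  then obtain g where g: "\<And>a. a \<in> A \<Longrightarrow> g a > 0"
    "\<And>a d V u. a \<in> A \<Longrightarrow> V \<in> carrier (unitary_group d) \<Longrightarrow> (\<forall>i<d. cmod (u i) = 1) \<Longrightarrow>
      comm_le d V u (g a) \<Longrightarrow> comm_le d V (\<lambda>i. complex_of_real (F a (u i))) \<epsilon>"
    by (elim bchoice[THEN exE]) blast
  define \<delta> where "\<delta> = Min (insert 1 (g ` A))"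
  have "\<delta> > 0" using fin g(1) by (simp add: \<delta>_def)
  moreover have "\<delta> \<le> g a" if "a \<in> A" for a using fin that by (simp add: \<delta>_def)
  ultimately show ?thesis using g(2) comm_le_mono by (intro exI[of _ \<delta>]) blast
qed

lemma unitary_eigenvalue_norm:
  assumes "diag_of d u \<in> carrier (unitary_group d)" "i < d"
  shows "cmod (u i) = 1"
proof -
  have "diag_of d (\<lambda>i. cnj (u i) * u i) $$ (i, i) = (1\<^sub>m d :: complex mat) $$ (i, i)"
    using unitary_groupD(2)[OF assms(1)] by (simp add: diag_of_adjoint diag_of_mult)
  then have "cnj (u i) * u i = 1" using assms(2) by (simp add: diag_of_def)
  then have "complex_of_real ((cmod (u i))\<^sup>2) = 1" using complex_norm_square[of "u i"] by (simp add: mult.commute)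
  then have "(cmod (u i))\<^sup>2 = 1" by (simp only: of_real_eq_1_iff)
  then show ?thesis by (simp add: power2_eq_1_iff) (smt (verit) norm_ge_zero)
qed

theorem almost_commuting_unitaries:
  assumes \<epsilon>: "\<epsilon> > 0"
  shows "\<exists>\<delta>>0. \<forall>d U V. U \<in> carrier (unitary_group d) \<longrightarrow> V \<in> carrier (unitary_group d) \<longrightarrow>
    norm_bounded_by (U * V - V * U) \<delta> \<longrightarrow>
    (\<exists>k W U' V'. d \<le> k \<and> real k \<le> (1 + \<epsilon>) * real d \<and> isometry_mat d k W \<and>
      U' \<in> carrier (unitary_group k) \<and> V' \<in> carrier (unitary_group k) \<and> U' * V' = V' * U' \<and>
      norm_bounded_by (U' * W - W * U) \<epsilon> \<and> norm_bounded_by (V' * W - W * V) \<epsilon>)"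
proof -
  obtain \<F> :: "(nat \<times> nat \<Rightarrow> complex \<Rightarrow> real) set" and J where fin: "finite \<F>" "finite J"
    and cover: "\<forall>F\<in>\<F>. \<forall>j\<in>J. continuous_on (sphere 0 1) (F j)"
      "\<forall>F\<in>\<F>. \<forall>z. cmod z = 1 \<longrightarrow> (\<Sum>j\<in>J. (F j z)\<^sup>2) = 1"
      "\<forall>F\<in>\<F>. \<forall>j\<in>J. \<forall>z w. F j z \<noteq> 0 \<longrightarrow> F j w \<noteq> 0 \<longrightarrow> cmod (z - w) \<le> \<epsilon>"
      "\<forall>d u. (\<forall>i<d. cmod (u i) = 1) \<longrightarrow>
        (\<exists>F\<in>\<F>. real (\<Sum>j\<in>J. card {i. i < d \<and> F j (u i) \<noteq> 0}) \<le> (1 + \<epsilon>) * real d)"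
    using exists_cover[OF \<epsilon>] by (elim exE conjE) (rule that; assumption)
  note cont = cover(1)[rule_format] and sum1 = cover(2)[rule_format] and small = cover(3)[rule_format]
    and count = cover(4)[THEN spec, THEN spec, THEN mp]
  \<comment> \<open>The errors for \<open>V\<close> are relative to \<open>x\<close> in every cell,
    so the number of cells enters their sum; \<eta> is chosen so that 4 n \<eta> = \<epsilon>. The
    summand 1 keeps \<open>n\<close> positive.\<close>
  define n where "n = real (card J) + 1"
  have n: "n \<ge> 1" by (simp add: n_def)
  define \<eta> where "\<eta> = \<epsilon> / (4 * n)"
  have \<eta>: "\<eta> > 0" using \<epsilon> n by (simp add: \<eta>_def)
  obtain \<delta> where \<delta>: "\<delta> > 0" and comm\<delta>: "\<And>F j d V u. F \<in> \<F> \<Longrightarrow> j \<in> J \<Longrightarrow> V \<in> carrier (unitary_group d) \<Longrightarrow>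
      (\<forall>i<d. cmod (u i) = 1) \<Longrightarrow> comm_le d V u \<delta> \<Longrightarrow> comm_le d V (\<lambda>i. complex_of_real (F j (u i))) \<eta>"
    using comm_le_continuous_uniform[of "\<F> \<times> J" "\<lambda>(F, j). F j", OF _ _ \<eta>] fin cont by fastforce
  obtain js where js: "set js = J" "distinct js" using finite_distinct_list[OF fin(2)] by blast
  have sum_js: "(\<Sum>j\<leftarrow>js. f j) = (\<Sum>j\<in>J. f j)" for f :: "nat \<times> nat \<Rightarrow> 'b::comm_monoid_add"
    using sum_list_distinct_conv_sum_set[OF js(2)] js(1) by metis
  show ?thesis
  proof (intro exI[of _ \<delta>] conjI \<delta> allI impI)
    fix d U V
    assume U: "U \<in> carrier (unitary_group d)" and V: "V \<in> carrier (unitary_group d)"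
      and UV: "norm_bounded_by (U * V - V * U) \<delta>"
    note u = unitary_groupD[OF U] and v = unitary_groupD[OF V]
    obtain Q r where Q: "Q \<in> carrier (unitary_group d)" and UQ: "U = Q * diag_of d r * mat_adjoint Q"
      using normal_unitarily_diagonalizable[OF u(1)] u by auto
    note q = unitary_groupD[OF Q]
    have Q': "mat_adjoint Q \<in> carrier (unitary_group d)" by (rule mat_adjoint_unitary[OF Q])
    define D where "D = diag_of d r"
    have D: "D \<in> carrier_mat d d" by (simp add: D_def)
    note asm = assoc_mult_mat[of _ d d _ d _ d] mult_carrier_mat[of _ d d _ d]
    note asv = assoc_mult_mat_vec[of _ d d _ d] mult_mat_vec_carrier[of _ d d]
    have DQ: "D = mat_adjoint Q * U * Q"
      using q D unfolding UQ D_def[symmetric]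
      by (simp add: asm unitary_cancel(1)[OF Q, where l = d])
    have Du: "D \<in> carrier (unitary_group d)"
      unfolding DQ by (intro unitary_mult Q Q' U)
    have r: "\<forall>i<d. cmod (r i) = 1" using unitary_eigenvalue_norm[of d r] Du by (auto simp: D_def)
    \<comment> \<open>In the eigenbasis of \<open>U\<close> the pair becomes \<open>D\<close>,
      \<open>B\<close>; conjugation by \<open>Q\<close> preserves the norm of the
      commutator.\<close>
    define B where "B = mat_adjoint Q * V * Q"
    have B: "B \<in> carrier (unitary_group d)" unfolding B_def by (intro unitary_mult Q Q' V)
    note b = unitary_groupD(1)[OF B]
    have Dx: "D *\<^sub>v x = mat_adjoint Q *\<^sub>v (U *\<^sub>v (Q *\<^sub>v x))" if "x \<in> carrier_vec d" for x
      using that q(1,4) u(1) by (simp add: DQ asv asm)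
    have Bx: "B *\<^sub>v x = mat_adjoint Q *\<^sub>v (V *\<^sub>v (Q *\<^sub>v x))" if "x \<in> carrier_vec d" for x
      using that q(1,4) v(1) by (simp add: B_def asv asm)
    have comm: "comm_le d B r \<delta>"
      unfolding comm_le_def D_def[symmetric]
    proof
      fix x :: "complex vec" assume x: "x \<in> carrier_vec d"
      define y where "y = Q *\<^sub>v x"
      have y: "y \<in> carrier_vec d" unfolding y_def by (rule mult_mat_vec_carrier[OF q(1) x])
      have Uy: "U *\<^sub>v y \<in> carrier_vec d" and Vy: "V *\<^sub>v y \<in> carrier_vec d"
        using y u(1) v(1) by (auto simp: asv)
      have UVy: "U *\<^sub>v (V *\<^sub>v y) \<in> carrier_vec d" and VUy: "V *\<^sub>v (U *\<^sub>v y) \<in> carrier_vec d"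
        using Uy Vy u(1) v(1) by (auto simp: asv)
      have 1: "D *\<^sub>v (B *\<^sub>v x) = mat_adjoint Q *\<^sub>v (U *\<^sub>v (V *\<^sub>v y))"
        unfolding Bx[OF x] y_def[symmetric] Dx[OF mult_mat_vec_carrier[OF q(4) Vy]] unitary_cancel(4)[OF Q Vy] ..
      have 2: "B *\<^sub>v (D *\<^sub>v x) = mat_adjoint Q *\<^sub>v (V *\<^sub>v (U *\<^sub>v y))"
        unfolding Dx[OF x] y_def[symmetric] Bx[OF mult_mat_vec_carrier[OF q(4) Uy]] unitary_cancel(4)[OF Q Uy] ..
      have "\<parallel>D *\<^sub>v (B *\<^sub>v x) - B *\<^sub>v (D *\<^sub>v x)\<parallel> = \<parallel>U *\<^sub>v (V *\<^sub>v y) - V *\<^sub>v (U *\<^sub>v y)\<parallel>"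
        unfolding 1 2 mult_minus_mat_vec[OF q(4) UVy VUy, symmetric]
        by (rule vec_l2_norm_unitary[OF Q' minus_carrier_vec[OF UVy VUy]])
      also have "U *\<^sub>v (V *\<^sub>v y) - V *\<^sub>v (U *\<^sub>v y) = (U * V - V * U) *\<^sub>v y"
        unfolding minus_mult_distrib_mat_vec[OF mult_carrier_mat[OF u(1) v(1)] mult_carrier_mat[OF v(1) u(1)] y]
          assoc_mult_mat_vec[OF u(1) v(1) y] assoc_mult_mat_vec[OF v(1) u(1) y] ..
      also have "\<parallel>\<dots>\<parallel> \<le> \<delta> * \<parallel>y\<parallel>"
        by (rule norm_bounded_byD[OF UV _ y]) (use u(1) v(1) in \<open>auto simp: asm intro!: minus_carrier_mat\<close>)
      also have "\<parallel>y\<parallel> = \<parallel>x\<parallel>" unfolding y_def by (rule vec_l2_norm_unitary[OF Q x])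
      finally show "\<parallel>D *\<^sub>v (B *\<^sub>v x) - B *\<^sub>v (D *\<^sub>v x)\<parallel> \<le> \<delta> * \<parallel>x\<parallel>" .
    qed
    obtain F where F: "F \<in> \<F>" and cF: "real (\<Sum>j\<in>J. card {i. i < d \<and> F j (r i) \<noteq> 0}) \<le> (1 + \<epsilon>) * real d"
      using count[OF r] by blast
    have F1: "cmod (complex_of_real (F j (r i))) \<le> 1" if "j \<in> J" "i < d" for i j
    proof -
      have "(F j (r i))\<^sup>2 \<le> (\<Sum>j\<in>J. (F j (r i))\<^sup>2)"
        using that fin by (intro member_le_sum) auto
      then have "(F j (r i))\<^sup>2 \<le> 1" using sum1[OF F] r that by simp
      then show ?thesis by (simp add: abs_square_le_1)
    qed
    define m where "m j = card {i. i < d \<and> F j (r i) \<noteq> 0}" for j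
    \<comment> \<open>A name for the conclusion of \<open>local_piece\<close>, so that both
      witnesses can be chosen for all \<open>j\<close> simultaneously.\<close>
    define P where "P j W V' \<longleftrightarrow> W \<in> carrier_mat (m j) d \<and> V' \<in> carrier (unitary_group (m j)) \<and>
        mat_adjoint W * W = diag_of d (\<lambda>i. cnj (complex_of_real (F j (r i))) * complex_of_real (F j (r i))) \<and>
        (\<forall>x\<in>carrier_vec d. \<parallel>V' *\<^sub>v (W *\<^sub>v x) - W *\<^sub>v (B *\<^sub>v x)\<parallel> \<le> 4 * \<eta> * \<parallel>x\<parallel>) \<and>
        (\<forall>u \<mu> \<epsilon>. (\<forall>i<d. complex_of_real (F j (r i)) \<noteq> 0 \<longrightarrow> cmod (\<mu> - u i) \<le> \<epsilon>) \<longrightarrow> 0 \<le> \<epsilon> \<longrightarrow>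
          (\<forall>x\<in>carrier_vec d. \<parallel>\<mu> \<cdot>\<^sub>v (W *\<^sub>v x) - W *\<^sub>v (diag_of d u *\<^sub>v x)\<parallel> \<le> \<epsilon> * \<parallel>W *\<^sub>v x\<parallel>))"
      for j W V'
    have "\<exists>W V'. P j W V'" if j: "j \<in> J" for j
      unfolding P_def
      by (rule local_piece[OF B _ comm\<delta>[OF F j B r comm] \<eta>]) (use F1 j in \<open>auto simp: m_def\<close>)
    then obtain W V' where P: "\<And>j. j \<in> J \<Longrightarrow> P j (W j) (V' j)"
      by metis
    note P' = P[unfolded P_def]
    note W = P'[THEN conjunct1] and V' = P'[THEN conjunct2, THEN conjunct1]
      and WW = P'[THEN conjunct2, THEN conjunct2, THEN conjunct1]
      and V'W = P'[THEN conjunct2, THEN conjunct2, THEN conjunct2, THEN conjunct1, THEN bspec]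
      and UW = P'[THEN conjunct2, THEN conjunct2, THEN conjunct2, THEN conjunct2,
        THEN spec, THEN spec, THEN spec, THEN mp, THEN mp, THEN bspec]
    \<comment> \<open>Any eigenvalue in the cell will do, the cell being small. A cell without
      eigenvalues gives a block of size 0, and 1 is a placeholder of modulus one.\<close>
    have "\<exists>\<mu>. cmod \<mu> = 1 \<and> (\<forall>i<d. F j (r i) \<noteq> 0 \<longrightarrow> cmod (\<mu> - r i) \<le> \<epsilon>)" if j: "j \<in> J" for j
    proof (cases "\<exists>i<d. F j (r i) \<noteq> 0")
      case True
      then show ?thesis using small[OF F j] r by blast
    next
      case False
      then show ?thesis by (intro exI[of _ 1]) auto
    qed
    then obtain \<mu> where \<mu>: "\<And>j. j \<in> J \<Longrightarrow> cmod (\<mu> j) = 1"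
      and \<mu>r: "\<And>j. j \<in> J \<Longrightarrow> \<forall>i<d. F j (r i) \<noteq> 0 \<longrightarrow> cmod (\<mu> j - r i) \<le> \<epsilon>"
      by metis
    define k where "k = (\<Sum>j\<leftarrow>js. m j)"
    have "\<exists>X U' V''. X \<in> carrier_mat k d \<and> U' \<in> carrier (unitary_group k) \<and> V'' \<in> carrier (unitary_group k) \<and>
      U' * V'' = V'' * U' \<and>
      (\<forall>a<d. \<forall>b<d. (mat_adjoint X * X) $$ (a, b) = (\<Sum>j\<leftarrow>js. (mat_adjoint (W j) * W j) $$ (a, b))) \<and>
      (\<forall>x\<in>carrier_vec d. \<forall>y\<in>carrier_vec d.
        \<parallel>U' *\<^sub>v (X *\<^sub>v x) - X *\<^sub>v y\<parallel>\<^sup>2 = (\<Sum>j\<leftarrow>js. \<parallel>\<mu> j \<cdot>\<^sub>v (W j *\<^sub>v x) - W j *\<^sub>v y\<parallel>\<^sup>2) \<and>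
        \<parallel>V'' *\<^sub>v (X *\<^sub>v x) - X *\<^sub>v y\<parallel>\<^sup>2 = (\<Sum>j\<leftarrow>js. \<parallel>V' j *\<^sub>v (W j *\<^sub>v x) - W j *\<^sub>v y\<parallel>\<^sup>2))"
      using W V' \<mu> js(1) k_def by (intro assemble_blocks) auto
    then obtain X U' V'' where X: "X \<in> carrier_mat k d" and U': "U' \<in> carrier (unitary_group k)"
      and V'': "V'' \<in> carrier (unitary_group k)" and comm': "U' * V'' = V'' * U'"
      and XX: "\<forall>a<d. \<forall>b<d. (mat_adjoint X * X) $$ (a, b) = (\<Sum>j\<leftarrow>js. (mat_adjoint (W j) * W j) $$ (a, b))"
      and est: "\<forall>x\<in>carrier_vec d. \<forall>y\<in>carrier_vec d.
        \<parallel>U' *\<^sub>v (X *\<^sub>v x) - X *\<^sub>v y\<parallel>\<^sup>2 = (\<Sum>j\<leftarrow>js. \<parallel>\<mu> j \<cdot>\<^sub>v (W j *\<^sub>v x) - W j *\<^sub>v y\<parallel>\<^sup>2) \<and>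
        \<parallel>V'' *\<^sub>v (X *\<^sub>v x) - X *\<^sub>v y\<parallel>\<^sup>2 = (\<Sum>j\<leftarrow>js. \<parallel>V' j *\<^sub>v (W j *\<^sub>v x) - W j *\<^sub>v y\<parallel>\<^sup>2)"
      by (elim exE conjE) (rule that; assumption)
    note U'x = est[rule_format, THEN conjunct1, unfolded sum_js]
      and V''x = est[rule_format, THEN conjunct2, unfolded sum_js]
    have X1: "mat_adjoint X * X = 1\<^sub>m d"
    proof (rule eq_matI)
      fix a b assume "a < dim_row (1\<^sub>m d :: complex mat)" "b < dim_col (1\<^sub>m d :: complex mat)"
      then have ab: "a < d" "b < d" by auto
      have "(mat_adjoint X * X) $$ (a, b) = (\<Sum>j\<in>J. (mat_adjoint (W j) * W j) $$ (a, b))"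
        using XX ab unfolding sum_js by blast
      also have "\<dots> = (\<Sum>j\<in>J. if a = b then complex_of_real ((F j (r a))\<^sup>2) else 0)"
        using ab by (intro sum.cong refl) (simp add: WW diag_of_def power2_eq_square del: index_mult_mat)
      also have "\<dots> = (if a = b then complex_of_real (\<Sum>j\<in>J. (F j (r a))\<^sup>2) else 0)" by simp
      also have "(\<Sum>j\<in>J. (F j (r a))\<^sup>2) = 1" using sum1[OF F] r ab by blast
      also have "(if a = b then complex_of_real 1 else 0) = 1\<^sub>m d $$ (a, b)" using ab by simp
      finally show "(mat_adjoint X * X) $$ (a, b) = 1\<^sub>m d $$ (a, b)" .
    qed (use X in auto)
    have nX: "\<parallel>X *\<^sub>v x\<parallel> = \<parallel>x\<parallel>" if "x \<in> carrier_vec d" for x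
      by (rule vec_l2_norm_isometry[OF X X1 that])
    \<comment> \<open>Read off from the block identity with y = 0, since both \<open>U'\<close> and
      \<open>X\<close> preserve norms.\<close>
    have sumW: "(\<Sum>j\<in>J. \<parallel>W j *\<^sub>v x\<parallel>\<^sup>2) = \<parallel>x\<parallel>\<^sup>2" if x: "x \<in> carrier_vec d" for x
    proof -
      have "\<parallel>W j *\<^sub>v x\<parallel>\<^sup>2 = \<parallel>\<mu> j \<cdot>\<^sub>v (W j *\<^sub>v x) - W j *\<^sub>v 0\<^sub>v d\<parallel>\<^sup>2" if j: "j \<in> J" for j
        using mult_mat_vec_carrier[OF W[OF j] x] \<mu>[OF j] by (simp add: mult_mat_zero_vec[OF W[OF j]])
      then have "(\<Sum>j\<in>J. \<parallel>W j *\<^sub>v x\<parallel>\<^sup>2) = \<parallel>U' *\<^sub>v (X *\<^sub>v x) - X *\<^sub>v 0\<^sub>v d\<parallel>\<^sup>2"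
        unfolding U'x[OF x zero_carrier_vec] by simp
      also have "\<dots> = \<parallel>U' *\<^sub>v (X *\<^sub>v x)\<parallel>\<^sup>2"
        using mult_mat_vec_carrier[OF unitary_groupD(1)[OF U'] mult_mat_vec_carrier[OF X x]]
        by (simp add: mult_mat_zero_vec[OF X])
      also have "\<dots> = \<parallel>x\<parallel>\<^sup>2"
        by (simp add: vec_l2_norm_unitary[OF U' mult_mat_vec_carrier[OF X x]] nX[OF x])
      finally show ?thesis .
    qed
    have estU: "\<parallel>U' *\<^sub>v (X *\<^sub>v x) - X *\<^sub>v (D *\<^sub>v x)\<parallel> \<le> \<epsilon> * \<parallel>x\<parallel>" if x: "x \<in> carrier_vec d" for x
    proof -
      have "\<parallel>\<mu> j \<cdot>\<^sub>v (W j *\<^sub>v x) - W j *\<^sub>v (D *\<^sub>v x)\<parallel> \<le> \<epsilon> * \<parallel>W j *\<^sub>v x\<parallel>" if j: "j \<in> J" for j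
        unfolding D_def using \<mu>r[OF j] \<epsilon> by (intro UW[OF j _ _ x]) auto
      then have "\<parallel>U' *\<^sub>v (X *\<^sub>v x) - X *\<^sub>v (D *\<^sub>v x)\<parallel>\<^sup>2 \<le> (\<Sum>j\<in>J. (\<epsilon> * \<parallel>W j *\<^sub>v x\<parallel>)\<^sup>2)"
        unfolding U'x[OF x mult_mat_vec_carrier[OF D x]] by (intro sum_mono power_mono) auto
      also have "\<dots> = (\<epsilon> * \<parallel>x\<parallel>)\<^sup>2"
        by (simp add: power_mult_distrib sum_distrib_left[symmetric] sumW[OF x])
      finally show ?thesis using \<epsilon> by (auto intro: power2_le_imp_le)
    qed
    have estV: "\<parallel>V'' *\<^sub>v (X *\<^sub>v x) - X *\<^sub>v (B *\<^sub>v x)\<parallel> \<le> \<epsilon> * \<parallel>x\<parallel>" if x: "x \<in> carrier_vec d" for x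
    proof -
      have "\<parallel>V'' *\<^sub>v (X *\<^sub>v x) - X *\<^sub>v (B *\<^sub>v x)\<parallel>\<^sup>2 \<le> (\<Sum>j\<in>J. (4 * \<eta> * \<parallel>x\<parallel>)\<^sup>2)"
        unfolding V''x[OF x mult_mat_vec_carrier[OF b x]]
        using V'W x by (intro sum_mono power_mono) auto
      also have "\<dots> = real (card J) * (4 * \<eta> * \<parallel>x\<parallel>)\<^sup>2" by simp
      also have "\<dots> \<le> n\<^sup>2 * (4 * \<eta> * \<parallel>x\<parallel>)\<^sup>2"
        using n self_le_power[of n 2] by (intro mult_right_mono) (auto simp: n_def)
      also have "\<dots> = (\<epsilon> * \<parallel>x\<parallel>)\<^sup>2"
        using n by (simp add: \<eta>_def power_mult_distrib[symmetric])
      finally show ?thesis using \<epsilon> by (auto intro: power2_le_imp_le)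
    qed
    \<comment> \<open>Undoes the change of basis: \<open>X\<close> almost intertwines
      \<open>D\<close> and \<open>B\<close>, hence \<open>Y\<close> almost intertwines
      \<open>U\<close> and \<open>V\<close>.\<close>
    define Y where "Y = X * mat_adjoint Q"
    have Y: "Y \<in> carrier_mat k d" unfolding Y_def by (rule mult_carrier_mat[OF X q(4)])
    have Yx: "Y *\<^sub>v x = X *\<^sub>v (mat_adjoint Q *\<^sub>v x)" if "x \<in> carrier_vec d" for x
      unfolding Y_def by (rule assoc_mult_mat_vec[OF X q(4) that])
    have "mat_adjoint Y * Y = 1\<^sub>m d"
      unfolding Y_def mat_adjoint_mult[OF X q(4)] mat_adjoint_adjoint[OF q(1)]
        assoc_mult_mat[OF q(1) mat_adjoint_carrier[OF X] mult_carrier_mat[OF X q(4)]]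
        adjoint_mult_cancel[OF X X1 q(4)] by (rule q(3))
    then have iso: "isometry_mat d k Y" using Y by (simp add: isometry_mat_def)
    have transfer: "norm_bounded_by (A' * Y - Y * A) \<epsilon>"
      if A': "A' \<in> carrier_mat k k" and A: "A \<in> carrier_mat d d"
        and C: "C \<in> carrier_mat d d" "\<And>x. x \<in> carrier_vec d \<Longrightarrow> C *\<^sub>v x = mat_adjoint Q *\<^sub>v (A *\<^sub>v (Q *\<^sub>v x))"
        and estA: "\<And>x. x \<in> carrier_vec d \<Longrightarrow> \<parallel>A' *\<^sub>v (X *\<^sub>v x) - X *\<^sub>v (C *\<^sub>v x)\<parallel> \<le> \<epsilon> * \<parallel>x\<parallel>" for A' A C
    proof (rule norm_bounded_byI)
      note A'Y = mult_carrier_mat[OF A' Y] and YA = mult_carrier_mat[OF Y A]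
      show "A' * Y - Y * A \<in> carrier_mat k d" by (rule minus_carrier_mat[OF YA])
      fix x :: "complex vec" assume x: "x \<in> carrier_vec d"
      note Q'x = mult_mat_vec_carrier[OF q(4) x] and Ax = mult_mat_vec_carrier[OF A x]
      have "(A' * Y - Y * A) *\<^sub>v x = A' *\<^sub>v (X *\<^sub>v (mat_adjoint Q *\<^sub>v x)) - X *\<^sub>v (C *\<^sub>v (mat_adjoint Q *\<^sub>v x))"
        unfolding minus_mult_distrib_mat_vec[OF A'Y YA x] assoc_mult_mat_vec[OF A' Y x]
          assoc_mult_mat_vec[OF Y A x] Yx[OF x] Yx[OF Ax] C(2)[OF Q'x] unitary_cancel(4)[OF Q x] ..
      then show "\<parallel>(A' * Y - Y * A) *\<^sub>v x\<parallel> \<le> \<epsilon> * \<parallel>x\<parallel>"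
        using estA[OF Q'x] by (simp add: vec_l2_norm_unitary[OF Q' x])
    qed
    have "d \<le> k"
    proof -
      \<comment> \<open>Every eigenvalue lies in some cell, since the squares sum to 1
        there.\<close>
      have "{..<d} \<subseteq> (\<Union>j\<in>J. {i. i < d \<and> F j (r i) \<noteq> 0})"
      proof
        fix i assume i: "i \<in> {..<d}"
        then have "(\<Sum>j\<in>J. (F j (r i))\<^sup>2) \<noteq> 0" using sum1[OF F, of "r i"] r by simp
        then obtain j where "j \<in> J" "(F j (r i))\<^sup>2 \<noteq> 0" by (meson sum.neutral)
        then show "i \<in> (\<Union>j\<in>J. {i. i < d \<and> F j (r i) \<noteq> 0})" using i by auto
      qed
      then have "card {..<d} \<le> card (\<Union>j\<in>J. {i. i < d \<and> F j (r i) \<noteq> 0})"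
        using fin by (intro card_mono) auto
      also have "\<dots> \<le> (\<Sum>j\<in>J. m j)" unfolding m_def by (rule card_UN_le[OF fin(2)])
      finally show ?thesis by (simp add: k_def sum_js)
    qed
    moreover have "real k \<le> (1 + \<epsilon>) * real d"
      using cF by (simp add: k_def sum_js m_def)
    moreover have "norm_bounded_by (U' * Y - Y * U) \<epsilon>"
      by (rule transfer[OF unitary_groupD(1)[OF U'] u(1) D Dx estU])
    moreover have "norm_bounded_by (V'' * Y - Y * V) \<epsilon>"
      by (rule transfer[OF unitary_groupD(1)[OF V''] v(1) b Bx estV])
    ultimately show "\<exists>k W U' V'. d \<le> k \<and> real k \<le> (1 + \<epsilon>) * real d \<and> isometry_mat d k W \<and>
      U' \<in> carrier (unitary_group k) \<and> V' \<in> carrier (unitary_group k) \<and> U' * V' = V' * U' \<and>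
      norm_bounded_by (U' * W - W * U) \<epsilon> \<and> norm_bounded_by (V' * W - W * V) \<epsilon>"
      using iso U' V'' comm'
      by (intro exI[of _ k] exI[of _ Y] exI[of _ U'] exI[of _ V'']) (intro conjI)
  qed
qed

section \<open>Flexible stability\<close>

lemma mult_minus_mult_mat_vec:
  fixes A B C D :: "complex mat"
  assumes A: "A \<in> carrier_mat k l" and B: "B \<in> carrier_mat l d"
    and C: "C \<in> carrier_mat k m" and D: "D \<in> carrier_mat m d" and x: "x \<in> carrier_vec d"
  shows "(A * B - C * D) *\<^sub>v x = A *\<^sub>v (B *\<^sub>v x) - C *\<^sub>v (D *\<^sub>v x)"
  unfolding minus_mult_distrib_mat_vec[OF mult_carrier_mat[OF A B] mult_carrier_mat[OF C D] x]
    assoc_mult_mat_vec[OF A B x] assoc_mult_mat_vec[OF C D x] ..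

lemma minus_mult_carrier:
  fixes A B C D :: "complex mat"
  assumes "A \<in> carrier_mat k l" "B \<in> carrier_mat l d" "C \<in> carrier_mat k m" "D \<in> carrier_mat m d"
  shows "A * B - C * D \<in> carrier_mat k d"
  using mult_carrier_mat[OF assms(3,4)] by (rule minus_carrier_mat)

lemma unitary_norm_diff:
  assumes "U \<in> carrier (unitary_group n)" "x \<in> carrier_vec n" "y \<in> carrier_vec n"
  shows "\<parallel>U *\<^sub>v x - U *\<^sub>v y\<parallel> = \<parallel>x - y\<parallel>"
  unfolding mult_minus_mat_vec[OF unitary_groupD(1)[OF assms(1)] assms(2,3), symmetric]
  by (rule vec_l2_norm_unitary[OF assms(1) minus_carrier_vec[OF assms(2,3)]])

text \<open>An asymptotic representation may send the neutral element to a matrix \<open>e\<close>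
  other than the identity, but \<open>e\<close> is almost equal to its square; cancelling one
  unitary factor shows that it is close to the identity.\<close>

lemma almost_idempotent_unitary:
  assumes e: "e \<in> carrier (unitary_group d)" and ee: "norm_bounded_by (e - e * e) c" and x: "x \<in> carrier_vec d"
  shows "\<parallel>x - e *\<^sub>v x\<parallel> \<le> c * \<parallel>x\<parallel>"
proof -
  note E = unitary_groupD(1)[OF e]
  note ex = mult_mat_vec_carrier[OF E x]
  have "(e - e * e) *\<^sub>v x = e *\<^sub>v x - e *\<^sub>v (e *\<^sub>v x)"
    unfolding minus_mult_distrib_mat_vec[OF E mult_carrier_mat[OF E E] x] assoc_mult_mat_vec[OF E E x] ..
  then show ?thesis
    using norm_bounded_byD[OF ee minus_carrier_mat[OF mult_carrier_mat[OF E E]] x]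
      unitary_norm_diff[OF e x ex] by simp
qed

section \<open>Approximate intertwining along an isometry\<close>

context
  fixes W :: "complex mat" and k d :: nat
  assumes iso: "isometry_mat d k W"
begin

lemma isometry_carrier: "W \<in> carrier_mat k d"
  using iso by (simp add: isometry_mat_def)

lemma isometry_norm: "x \<in> carrier_vec d \<Longrightarrow> \<parallel>W *\<^sub>v x\<parallel> = \<parallel>x\<parallel>"
  using iso by (intro vec_l2_norm_isometry[of W k d]) (auto simp: isometry_mat_def)

lemma isometry_norm_diff:
  assumes "x \<in> carrier_vec d" "y \<in> carrier_vec d"
  shows "\<parallel>W *\<^sub>v x - W *\<^sub>v y\<parallel> = \<parallel>x - y\<parallel>"
  unfolding mult_minus_mat_vec[OF isometry_carrier assms, symmetric]
  by (rule isometry_norm[OF minus_carrier_vec[OF assms]])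

lemma intertwine_iff:
  assumes "p \<in> carrier (unitary_group k)" "f \<in> carrier (unitary_group d)"
  shows "norm_bounded_by (p * W - W * f) c \<longleftrightarrow>
    (\<forall>x\<in>carrier_vec d. \<parallel>p *\<^sub>v (W *\<^sub>v x) - W *\<^sub>v (f *\<^sub>v x)\<parallel> \<le> c * \<parallel>x\<parallel>)"
proof -
  note c = unitary_groupD(1)[OF assms(1)] isometry_carrier isometry_carrier unitary_groupD(1)[OF assms(2)]
  show ?thesis
    using mult_minus_mult_mat_vec[OF c] carrier_matD(2)[OF minus_mult_carrier[OF c]]
    by (simp add: norm_bounded_by_def)
qed

text \<open>The chain \<open>p q W\<close>, \<open>p W g\<close>, \<open>W f g\<close>,
  \<open>W h\<close>: neighbours differ by at most \<open>b\<close>, \<open>a\<close> and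
  \<open>c\<close>, since \<open>p\<close> and \<open>W\<close> preserve norms and \<open>g\<close>
  is unitary.\<close>

lemma intertwine_mult:
  assumes p: "p \<in> carrier (unitary_group k)" and q: "q \<in> carrier (unitary_group k)"
    and f: "f \<in> carrier (unitary_group d)" and g: "g \<in> carrier (unitary_group d)"
    and h: "h \<in> carrier (unitary_group d)"
    and pf: "norm_bounded_by (p * W - W * f) a" and qg: "norm_bounded_by (q * W - W * g) b"
    and fgh: "norm_bounded_by (h - f * g) c"
  shows "norm_bounded_by (p * q * W - W * h) (b + a + c)"
  unfolding intertwine_iff[OF unitary_mult[OF p q] h]
proof
  fix x :: "complex vec" assume x: "x \<in> carrier_vec d"
  note P = unitary_groupD(1)[OF p] and Q = unitary_groupD(1)[OF q] and F = unitary_groupD(1)[OF f]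
    and G = unitary_groupD(1)[OF g] and H = unitary_groupD(1)[OF h] and W = isometry_carrier
  note Wx = mult_mat_vec_carrier[OF W x] and gx = mult_mat_vec_carrier[OF G x]
    and hx = mult_mat_vec_carrier[OF H x]
  note qWx = mult_mat_vec_carrier[OF Q Wx] and Wgx = mult_mat_vec_carrier[OF W gx]
    and fgx = mult_mat_vec_carrier[OF F gx]
  have 1: "\<parallel>p *\<^sub>v (q *\<^sub>v (W *\<^sub>v x)) - p *\<^sub>v (W *\<^sub>v (g *\<^sub>v x))\<parallel> \<le> b * \<parallel>x\<parallel>"
    using qg x unfolding intertwine_iff[OF q g] unitary_norm_diff[OF p qWx Wgx] by blast
  have 2: "\<parallel>p *\<^sub>v (W *\<^sub>v (g *\<^sub>v x)) - W *\<^sub>v (f *\<^sub>v (g *\<^sub>v x))\<parallel> \<le> a * \<parallel>x\<parallel>"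
    using pf gx unfolding intertwine_iff[OF p f] vec_l2_norm_unitary[OF g x, symmetric] by blast
  have "(h - f * g) *\<^sub>v x = h *\<^sub>v x - f *\<^sub>v (g *\<^sub>v x)"
    unfolding minus_mult_distrib_mat_vec[OF H mult_carrier_mat[OF F G] x] assoc_mult_mat_vec[OF F G x] ..
  then have "\<parallel>h *\<^sub>v x - f *\<^sub>v (g *\<^sub>v x)\<parallel> \<le> c * \<parallel>x\<parallel>"
    using norm_bounded_byD[OF fgh minus_carrier_mat[OF mult_carrier_mat[OF F G]] x] by simp
  then have 3: "\<parallel>W *\<^sub>v (f *\<^sub>v (g *\<^sub>v x)) - W *\<^sub>v (h *\<^sub>v x)\<parallel> \<le> c * \<parallel>x\<parallel>"
    unfolding isometry_norm_diff[OF fgx hx]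
    by (subst vec_l2_norm_minus_commute) (simp_all only: carrier_vecD[OF fgx] carrier_vecD[OF hx])
  have "\<parallel>p *\<^sub>v (q *\<^sub>v (W *\<^sub>v x)) - W *\<^sub>v (h *\<^sub>v x)\<parallel> \<le> (b * \<parallel>x\<parallel> + a * \<parallel>x\<parallel>) + c * \<parallel>x\<parallel>"
    using mult_mat_vec_carrier[OF P qWx] mult_mat_vec_carrier[OF P Wgx] mult_mat_vec_carrier[OF W fgx]
      mult_mat_vec_carrier[OF W hx]
    by (meson vec_l2_norm_diff_triangle 1 2 3)
  then show "\<parallel>p * q *\<^sub>v (W *\<^sub>v x) - W *\<^sub>v (h *\<^sub>v x)\<parallel> \<le> (b + a + c) * \<parallel>x\<parallel>"
    unfolding assoc_mult_mat_vec[OF P Q Wx] by (simp add: distrib_right)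
qed

lemma intertwine_one:
  assumes e: "e \<in> carrier (unitary_group d)" and ee: "norm_bounded_by (e - e * e) c"
  shows "norm_bounded_by (1\<^sub>m k * W - W * e) c"
  unfolding intertwine_iff[OF one_unitary e]
proof
  fix x :: "complex vec" assume x: "x \<in> carrier_vec d"
  note ex = mult_mat_vec_carrier[OF unitary_groupD(1)[OF e] x]
  show "\<parallel>1\<^sub>m k *\<^sub>v (W *\<^sub>v x) - W *\<^sub>v (e *\<^sub>v x)\<parallel> \<le> c * \<parallel>x\<parallel>"
    using almost_idempotent_unitary[OF e ee x] mult_mat_vec_carrier[OF isometry_carrier x]
    by (simp add: isometry_norm_diff[OF x ex])
qed

text \<open>Here \<open>g\<close> is only an approximate inverse of \<open>f\<close>. The chain
  \<open>W\<close>, \<open>W e\<close>, \<open>W f g\<close>, \<open>p W g\<close> has errors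
  \<open>c\<close>, \<open>b\<close> and \<open>a\<close>; multiplying by \<open>q\<close>, the
  exact inverse of \<open>p\<close>, gives the claim.\<close>

lemma intertwine_inverse:
  assumes p: "p \<in> carrier (unitary_group k)" and q: "q \<in> carrier (unitary_group k)" and pq: "p * q = 1\<^sub>m k"
    and f: "f \<in> carrier (unitary_group d)" and g: "g \<in> carrier (unitary_group d)"
    and e: "e \<in> carrier (unitary_group d)"
    and pf: "norm_bounded_by (p * W - W * f) a" and efg: "norm_bounded_by (e - f * g) b"
    and ee: "norm_bounded_by (e - e * e) c"
  shows "norm_bounded_by (q * W - W * g) (c + b + a)"
  unfolding intertwine_iff[OF q g]
proof
  fix x :: "complex vec" assume x: "x \<in> carrier_vec d"
  note P = unitary_groupD(1)[OF p] and Q = unitary_groupD(1)[OF q] and F = unitary_groupD(1)[OF f]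
    and G = unitary_groupD(1)[OF g] and E = unitary_groupD(1)[OF e] and W = isometry_carrier
  note Wx = mult_mat_vec_carrier[OF W x] and gx = mult_mat_vec_carrier[OF G x]
    and ex = mult_mat_vec_carrier[OF E x]
  note qWx = mult_mat_vec_carrier[OF Q Wx] and Wgx = mult_mat_vec_carrier[OF W gx]
    and fgx = mult_mat_vec_carrier[OF F gx]
  have pqW: "p *\<^sub>v (q *\<^sub>v (W *\<^sub>v x)) = W *\<^sub>v x"
    unfolding assoc_mult_mat_vec[OF P Q Wx, symmetric] pq using Wx by simp
  have "(e - f * g) *\<^sub>v x = e *\<^sub>v x - f *\<^sub>v (g *\<^sub>v x)"
    unfolding minus_mult_distrib_mat_vec[OF E mult_carrier_mat[OF F G] x] assoc_mult_mat_vec[OF F G x] ..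
  then have 2: "\<parallel>e *\<^sub>v x - f *\<^sub>v (g *\<^sub>v x)\<parallel> \<le> b * \<parallel>x\<parallel>"
    using norm_bounded_byD[OF efg minus_carrier_mat[OF mult_carrier_mat[OF F G]] x] by simp
  have 12: "\<parallel>W *\<^sub>v x - W *\<^sub>v (f *\<^sub>v (g *\<^sub>v x))\<parallel> \<le> c * \<parallel>x\<parallel> + b * \<parallel>x\<parallel>"
    unfolding isometry_norm_diff[OF x fgx]
    by (rule vec_l2_norm_diff_triangle[OF x ex fgx almost_idempotent_unitary[OF e ee x] 2])
  have "\<parallel>p *\<^sub>v (W *\<^sub>v (g *\<^sub>v x)) - W *\<^sub>v (f *\<^sub>v (g *\<^sub>v x))\<parallel> \<le> a * \<parallel>x\<parallel>"
    using pf gx unfolding intertwine_iff[OF p f] vec_l2_norm_unitary[OF g x, symmetric] by blast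
  then have 3: "\<parallel>W *\<^sub>v (f *\<^sub>v (g *\<^sub>v x)) - p *\<^sub>v (W *\<^sub>v (g *\<^sub>v x))\<parallel> \<le> a * \<parallel>x\<parallel>"
    by (subst vec_l2_norm_minus_commute)
      (simp_all only: carrier_vecD[OF mult_mat_vec_carrier[OF W fgx]] carrier_vecD[OF mult_mat_vec_carrier[OF P Wgx]])
  have "\<parallel>q *\<^sub>v (W *\<^sub>v x) - W *\<^sub>v (g *\<^sub>v x)\<parallel> = \<parallel>W *\<^sub>v x - p *\<^sub>v (W *\<^sub>v (g *\<^sub>v x))\<parallel>"
    unfolding unitary_norm_diff[OF p qWx Wgx, symmetric] pqW ..
  also have "\<dots> \<le> (c * \<parallel>x\<parallel> + b * \<parallel>x\<parallel>) + a * \<parallel>x\<parallel>"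
    by (rule vec_l2_norm_diff_triangle[OF Wx mult_mat_vec_carrier[OF W fgx] mult_mat_vec_carrier[OF P Wgx] 12 3])
  finally show "\<parallel>q *\<^sub>v (W *\<^sub>v x) - W *\<^sub>v (g *\<^sub>v x)\<parallel> \<le> (c + b + a) * \<parallel>x\<parallel>"
    by (simp add: distrib_right)
qed

text \<open>The adjoint of \<open>W\<close> is a contraction and a left inverse of \<open>W\<close>;
  apply it to \<open>p W - W f\<close>.\<close>

lemma compression_le:
  assumes p: "p \<in> carrier (unitary_group k)" and f: "f \<in> carrier (unitary_group d)"
    and pf: "norm_bounded_by (p * W - W * f) c"
  shows "norm_bounded_by (mat_adjoint W * p * W - f) c"
proof (rule norm_bounded_byI)
  note P = unitary_groupD(1)[OF p] and F = unitary_groupD(1)[OF f] and W = isometry_carrier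
  note W' = mat_adjoint_carrier[OF W]
  note W'p = mult_carrier_mat[OF W' P]
  show "mat_adjoint W * p * W - f \<in> carrier_mat d d" by (rule minus_carrier_mat[OF F])
  fix x :: "complex vec" assume x: "x \<in> carrier_vec d"
  note Wx = mult_mat_vec_carrier[OF W x] and fx = mult_mat_vec_carrier[OF F x]
  note pWx = mult_mat_vec_carrier[OF P Wx] and Wfx = mult_mat_vec_carrier[OF W fx]
  have "mat_adjoint W *\<^sub>v (W *\<^sub>v (f *\<^sub>v x)) = f *\<^sub>v x"
    using iso fx by (simp add: assoc_mult_mat_vec[OF W' W fx, symmetric] isometry_mat_def)
  then have "(mat_adjoint W * p * W - f) *\<^sub>v x = mat_adjoint W *\<^sub>v (p *\<^sub>v (W *\<^sub>v x) - W *\<^sub>v (f *\<^sub>v x))"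
    unfolding minus_mult_distrib_mat_vec[OF mult_carrier_mat[OF W'p W] F x] assoc_mult_mat_vec[OF W'p W x]
      assoc_mult_mat_vec[OF W' P Wx] mult_minus_mat_vec[OF W' pWx Wfx] by simp
  also have "\<parallel>\<dots>\<parallel> \<le> 1 * \<parallel>p *\<^sub>v (W *\<^sub>v x) - W *\<^sub>v (f *\<^sub>v x)\<parallel>"
  proof (rule norm_bounded_byD[OF norm_bounded_by_adjoint[OF W] W'])
    show "norm_bounded_by W 1" by (rule norm_bounded_byI[OF W]) (simp add: isometry_norm)
  qed (use pWx Wfx in auto)
  also have "\<dots> \<le> c * \<parallel>x\<parallel>" using pf x by (simp add: intertwine_iff[OF p f])
  finally show "\<parallel>(mat_adjoint W * p * W - f) *\<^sub>v x\<parallel> \<le> c * \<parallel>x\<parallel>" .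
qed

end

section \<open>Homomorphisms from commuting pairs\<close>

lemma (in group) int_pow_commute:
  fixes i :: int
  assumes x: "x \<in> carrier G" and y: "y \<in> carrier G" and xy: "x \<otimes> y = y \<otimes> x"
  shows "x [^] i \<otimes> y = y \<otimes> x [^] i"
proof -
  have nat: "x [^] n \<otimes> y = y \<otimes> x [^] n" for n :: nat
    by (rule group_commutes_pow[OF xy x y])
  show ?thesis
  proof (cases "i \<ge> 0")
    case True
    then have "x [^] i = x [^] nat i" by (simp only: int_pow_def2 not_less[symmetric] if_False)
    then show ?thesis by (simp only: nat)
  next
    case False
    define z where "z = x [^] nat (- i)"
    have z: "z \<in> carrier G" unfolding z_def by (rule nat_pow_closed[OF x])
    have zy: "z \<otimes> y = y \<otimes> z" unfolding z_def by (rule nat)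
    have i: "x [^] i = inv z" unfolding z_def using False by (simp only: int_pow_def2 not_le if_True)
    have "inv z \<otimes> y = inv z \<otimes> (y \<otimes> z) \<otimes> inv z"
      using z y by (simp add: m_assoc)
    also have "\<dots> = y \<otimes> inv z"
      unfolding zy[symmetric] using z y by (simp add: m_assoc[symmetric])
    finally show ?thesis unfolding i .
  qed
qed

lemma (in group) int_pow_pair_hom:
  assumes x: "x \<in> carrier G" and y: "y \<in> carrier G" and xy: "x \<otimes> y = y \<otimes> x"
  shows "(\<lambda>(a, b). x [^] a \<otimes> y [^] b) \<in> hom Z2_group G"
proof (rule homI)
  fix g h :: "int \<times> int"
  obtain a b where g: "g = (a, b)" by (cases g)
  obtain c e where h: "h = (c, e)" by (cases h)
  \<comment> \<open>Commutation is extended to powers of \<open>x\<close>, and then, for a fixed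
    power of \<open>x\<close>, to powers of \<open>y\<close>.\<close>
  have comm: "y [^] b \<otimes> x [^] c = x [^] c \<otimes> y [^] b"
    using int_pow_commute[OF y int_pow_closed[OF x] int_pow_commute[OF x y xy, symmetric]] .
  have "x [^] (a + c) \<otimes> y [^] (b + e) = x [^] a \<otimes> (x [^] c \<otimes> y [^] b) \<otimes> y [^] e"
    using x y by (simp add: int_pow_mult m_assoc)
  also have "\<dots> = (x [^] a \<otimes> y [^] b) \<otimes> (x [^] c \<otimes> y [^] e)"
    using x y by (simp add: comm[symmetric] m_assoc)
  finally show "(case g \<otimes>\<^bsub>Z2_group\<^esub> h of (a, b) \<Rightarrow> x [^] a \<otimes> y [^] b) =
      (case g of (a, b) \<Rightarrow> x [^] a \<otimes> y [^] b) \<otimes> (case h of (a, b) \<Rightarrow> x [^] a \<otimes> y [^] b)"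
    by (simp add: g h DirProd_def integer_group_def)
qed (use x y in auto)

text \<open>Converts "for every \<epsilon>, eventually" into a single null sequence. Choose
  \<open>e n\<close> within 1/(n + 1) of the infimum of the admissible values; once \<epsilon>/2 is
  admissible, this infimum is at most \<epsilon>/2. The assumption \<open>ex\<close> gives an
  admissible value also for the early indices.\<close>

lemma exists_null_sequence:
  fixes P :: "nat \<Rightarrow> real \<Rightarrow> bool"
  assumes ex: "\<And>n. \<exists>e>0. P n e" and ev: "\<And>\<epsilon>. \<epsilon> > 0 \<Longrightarrow> \<forall>\<^sub>F n in sequentially. P n \<epsilon>"
  shows "\<exists>e. e \<longlonglongrightarrow> 0 \<and> (\<forall>n. 0 < e n \<and> P n (e n))"
proof -
  define A where "A n = {e. 0 < e \<and> P n e}" for n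
  have ne: "A n \<noteq> {}" and bd: "bdd_below (A n)" for n
    using ex[of n] by (auto simp: A_def intro!: bdd_belowI[of _ 0])
  have "\<exists>e\<in>A n. e < Inf (A n) + 1 / real (Suc n)" for n
    using cInf_lessD[OF ne, of n "Inf (A n) + 1 / real (Suc n)"] by auto
  then obtain e where e: "\<And>n. e n \<in> A n" "\<And>n. e n < Inf (A n) + 1 / real (Suc n)" by metis
  have "e \<longlonglongrightarrow> 0"
  proof (rule LIMSEQ_I)
    fix \<epsilon> :: real assume \<epsilon>: "\<epsilon> > 0"
    have "\<forall>\<^sub>F n in sequentially. P n (\<epsilon> / 2)" using ev \<epsilon> by simp
    moreover have "\<forall>\<^sub>F n in sequentially. 1 / real (Suc n) < \<epsilon> / 2"
      using order_tendstoD(2)[OF lim_1_over_n[THEN LIMSEQ_Suc], of "\<epsilon> / 2"] \<epsilon> by simp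
    ultimately have "\<forall>\<^sub>F n in sequentially. norm (e n - 0) < \<epsilon>"
    proof eventually_elim
      case (elim n)
      then have "\<epsilon> / 2 \<in> A n" using \<epsilon> by (simp add: A_def)
      then have "Inf (A n) \<le> \<epsilon> / 2" by (intro cInf_lower bd)
      moreover have "0 < e n" using e(1)[of n] by (simp add: A_def)
      ultimately show ?case using e(2)[of n] elim by simp
    qed
    then show "\<exists>N. \<forall>n\<ge>N. norm (e n - 0) < \<epsilon>" by (simp add: eventually_sequentially)
  qed
  then show ?thesis using e(1) by (auto simp: A_def)
qed

theorem theorem1:
  shows "flexibly_stable Z2_group"
  unfolding flexibly_stable_def
proof (intro allI impI)
  fix d :: "nat \<Rightarrow> nat" and \<phi> :: "nat \<Rightarrow> int \<times> int \<Rightarrow> complex mat"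
  assume "asymptotic_rep Z2_group d \<phi>"
  note rep = this[unfolded asymptotic_rep_def]
  have d: "d n > 0" for n using rep by blast
  have \<phi>: "\<phi> n g \<in> carrier (unitary_group (d n))" for n g
    using funcset_mem[OF rep[THEN conjunct2, THEN conjunct1, THEN spec], of g n] by (simp add: integer_group_def)
  have lim: "(\<lambda>n. mat_op_norm (\<phi> n (a + c, b + e) - \<phi> n (a, b) * \<phi> n (c, e))) \<longlonglongrightarrow> 0" for a b c e
    using rep[THEN conjunct2, THEN conjunct2, rule_format, of "(a, b)" "(c, e)"] by (simp add: integer_group_def)
  define U where "U n = \<phi> n (1, 0)" for n
  define V where "V n = \<phi> n (0, 1)" for n
  have UV: "U n \<in> carrier (unitary_group (d n))" "V n \<in> carrier (unitary_group (d n))" for n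
    by (simp_all add: U_def V_def \<phi>)
  \<comment> \<open>The defect of multiplicativity at the pair \<open>g\<close>,
    \<open>h\<close>.\<close>
  define def where "def g h n = mat_op_norm (\<phi> n (fst g + fst h, snd g + snd h) - \<phi> n g * \<phi> n h)" for g h n
  have lim_def: "def g h \<longlonglongrightarrow> 0" for g h
    using lim[of "fst g" "fst h" "snd g" "snd h"] by (simp add: def_def[abs_def])
  have def: "norm_bounded_by (\<phi> n (fst g + fst h, snd g + snd h) - \<phi> n g * \<phi> n h) (def g h n)" for g h n
    unfolding def_def by (rule norm_bounded_by_mat_op_norm)
  \<comment> \<open>Both \<open>U n * V n\<close> and \<open>V n * U n\<close> are compared with the
    image of (1, 1).\<close>
  define c where "c n = def (1, 0) (0, 1) n + def (0, 1) (1, 0) n" for n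
  have lim_c: "c \<longlonglongrightarrow> 0" unfolding c_def using tendsto_add[OF lim_def lim_def] by simp
  have comm: "norm_bounded_by (U n * V n - V n * U n) (c n)" for n
  proof (rule norm_bounded_byI)
    note u = unitary_groupD(1)[OF UV(1)[of n]] and v = unitary_groupD(1)[OF UV(2)[of n]]
    note w = unitary_groupD(1)[OF \<phi>[of n "(1, 1)"]]
    note uv = mult_carrier_mat[OF u v] and vu = mult_carrier_mat[OF v u]
    show "U n * V n - V n * U n \<in> carrier_mat (d n) (d n)" by (rule minus_carrier_mat[OF vu])
    fix x :: "complex vec" assume x: "x \<in> carrier_vec (d n)"
    note wx = mult_mat_vec_carrier[OF w x] and uvx = mult_mat_vec_carrier[OF uv x] and vux = mult_mat_vec_carrier[OF vu x]
    have 1: "\<parallel>\<phi> n (1, 1) *\<^sub>v x - (U n * V n) *\<^sub>v x\<parallel> \<le> def (1, 0) (0, 1) n * \<parallel>x\<parallel>"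
      using def[of n "(1, 0)" "(0, 1)"] unfolding minus_mult_distrib_mat_vec[OF w uv x, symmetric]
      by (intro norm_bounded_byD[OF _ minus_carrier_mat[OF uv] x]) (simp add: U_def V_def)
    have 2: "\<parallel>\<phi> n (1, 1) *\<^sub>v x - (V n * U n) *\<^sub>v x\<parallel> \<le> def (0, 1) (1, 0) n * \<parallel>x\<parallel>"
      using def[of n "(0, 1)" "(1, 0)"] unfolding minus_mult_distrib_mat_vec[OF w vu x, symmetric]
      by (intro norm_bounded_byD[OF _ minus_carrier_mat[OF vu] x]) (simp add: U_def V_def)
    have 3: "\<parallel>(U n * V n) *\<^sub>v x - \<phi> n (1, 1) *\<^sub>v x\<parallel> \<le> def (1, 0) (0, 1) n * \<parallel>x\<parallel>"
      using 1 by (subst vec_l2_norm_minus_commute) (simp_all only: carrier_vecD[OF wx] carrier_vecD[OF uvx])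
    show "\<parallel>(U n * V n - V n * U n) *\<^sub>v x\<parallel> \<le> c n * \<parallel>x\<parallel>"
      using vec_l2_norm_diff_triangle[OF uvx wx vux 3 2]
      by (simp add: minus_mult_distrib_mat_vec[OF uv vu x] c_def distrib_right)
  qed
  define P where "P n e k W U' V' \<longleftrightarrow> d n \<le> k \<and> real k \<le> (1 + e) * real (d n) \<and> isometry_mat (d n) k W \<and>
    U' \<in> carrier (unitary_group k) \<and> V' \<in> carrier (unitary_group k) \<and> U' * V' = V' * U' \<and>
    norm_bounded_by (U' * W - W * U n) e \<and> norm_bounded_by (V' * W - W * V n) e"
    for n e k W U' V'
  have "\<exists>e. e \<longlonglongrightarrow> 0 \<and> (\<forall>n. 0 < e n \<and> (\<exists>k W U' V'. P n (e n) k W U' V'))"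
  proof (rule exists_null_sequence)
    fix n
    have iso: "isometry_mat (d n) (d n) (1\<^sub>m (d n))" by (simp add: isometry_mat_def)
    \<comment> \<open>For indices where the commutator is still large, the trivial choice of
      identity matrices works with error 2, as two unitaries differ by at most 2 in norm.\<close>
    have "norm_bounded_by (1\<^sub>m (d n) * 1\<^sub>m (d n) - 1\<^sub>m (d n) * A) 2" if A: "A \<in> carrier (unitary_group (d n))" for A
      unfolding intertwine_iff[OF iso one_unitary A]
    proof
      fix x :: "complex vec" assume x: "x \<in> carrier_vec (d n)"
      note Ax = mult_mat_vec_carrier[OF unitary_groupD(1)[OF A] x]
      show "\<parallel>1\<^sub>m (d n) *\<^sub>v (1\<^sub>m (d n) *\<^sub>v x) - 1\<^sub>m (d n) *\<^sub>v (A *\<^sub>v x)\<parallel> \<le> 2 * \<parallel>x\<parallel>"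
        using vec_l2_norm_triangle_minus[of x "A *\<^sub>v x"] carrier_vecD[OF x] carrier_vecD[OF Ax]
        unfolding one_mult_mat_vec[OF x] one_mult_mat_vec[OF Ax] vec_l2_norm_unitary[OF A x] by linarith
    qed
    then have "P n 2 (d n) (1\<^sub>m (d n)) (1\<^sub>m (d n)) (1\<^sub>m (d n))"
      using UV[of n] iso one_unitary by (auto simp: P_def)
    then show "\<exists>e>0. \<exists>k W U' V'. P n e k W U' V'" by (intro exI[of _ 2]) auto
  next
    fix \<epsilon> :: real assume "\<epsilon> > 0"
    then obtain \<delta> where \<delta>: "\<delta> > 0" and main: "\<forall>d U V. U \<in> carrier (unitary_group d) \<longrightarrow> V \<in> carrier (unitary_group d) \<longrightarrow>
      norm_bounded_by (U * V - V * U) \<delta> \<longrightarrow>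
      (\<exists>k W U' V'. d \<le> k \<and> real k \<le> (1 + \<epsilon>) * real d \<and> isometry_mat d k W \<and>
        U' \<in> carrier (unitary_group k) \<and> V' \<in> carrier (unitary_group k) \<and> U' * V' = V' * U' \<and>
        norm_bounded_by (U' * W - W * U) \<epsilon> \<and> norm_bounded_by (V' * W - W * V) \<epsilon>)"
      using almost_commuting_unitaries by blast
    have "\<forall>\<^sub>F n in sequentially. c n < \<delta>" using lim_c \<delta> by (rule order_tendstoD)
    then show "\<forall>\<^sub>F n in sequentially. \<exists>k W U' V'. P n \<epsilon> k W U' V'"
    proof eventually_elim
      case (elim n)
      have "norm_bounded_by (U n * V n - V n * U n) \<delta>"
        unfolding norm_bounded_by_def
      proof
        fix x :: "complex vec" assume "x \<in> carrier_vec (dim_col (U n * V n - V n * U n))"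
        then have "\<parallel>(U n * V n - V n * U n) *\<^sub>v x\<parallel> \<le> c n * \<parallel>x\<parallel>" using comm[of n] by (simp add: norm_bounded_by_def)
        also have "\<dots> \<le> \<delta> * \<parallel>x\<parallel>" using elim by (intro mult_right_mono) auto
        finally show "\<parallel>(U n * V n - V n * U n) *\<^sub>v x\<parallel> \<le> \<delta> * \<parallel>x\<parallel>" .
      qed
      then show ?case unfolding P_def using main[THEN spec, THEN spec, THEN spec, THEN mp, THEN mp, THEN mp, OF UV[of n]] by simp
    qed
  qed
  then obtain e k W U' V' where e: "e \<longlonglongrightarrow> 0" and P: "\<And>n. P n (e n) (k n) (W n) (U' n) (V' n)"
    by metis
  have k: "d n \<le> k n" "real (k n) \<le> (1 + e n) * real (d n)" and iso: "isometry_mat (d n) (k n) (W n)"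
    and U': "U' n \<in> carrier (unitary_group (k n))" and V': "V' n \<in> carrier (unitary_group (k n))"
    and comm': "U' n * V' n = V' n * U' n"
    and U'W: "norm_bounded_by (U' n * W n - W n * U n) (e n)"
    and V'W: "norm_bounded_by (V' n * W n - W n * V n) (e n)" for n
    using P[of n] unfolding P_def by blast+
  define \<pi> where "\<pi> n = (\<lambda>(a :: int, b :: int). U' n [^]\<^bsub>unitary_group (k n)\<^esub> a \<otimes>\<^bsub>unitary_group (k n)\<^esub> V' n [^]\<^bsub>unitary_group (k n)\<^esub> b)"
    for n
  have hom: "\<pi> n \<in> hom Z2_group (unitary_group (k n))" for n
    unfolding \<pi>_def by (rule group.int_pow_pair_hom[OF group_unitary_group U' V'])
      (simp add: unitary_group_def comm')
  have \<pi>: "\<pi> n g \<in> carrier (unitary_group (k n))" for n g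
    using hom_in_carrier[OF hom, of g n] by (simp add: integer_group_def)
  have \<pi>_mult: "\<pi> n (a + a', b + b') = \<pi> n (a, b) * \<pi> n (a', b')" for n a b a' b'
    using hom_mult[OF hom[of n], of "(a, b)" "(a', b')"] by (simp add: integer_group_def unitary_group_def)
  have \<pi>_gen: "\<pi> n (0, 0) = 1\<^sub>m (k n)" "\<pi> n (1, 0) = U' n" "\<pi> n (0, 1) = V' n" for n
  proof -
    interpret G: group "unitary_group (k n)" by (rule group_unitary_group)
    show "\<pi> n (0, 0) = 1\<^sub>m (k n)" "\<pi> n (1, 0) = U' n" "\<pi> n (0, 1) = V' n"
      using U'[of n] V'[of n] G.int_pow_1[OF U'] G.int_pow_1[OF V']
      by (simp_all add: \<pi>_def) (simp_all add: unitary_group_def)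
  qed
  \<comment> \<open>The elements on which \<open>W n\<close> intertwines up to a null sequence. They
    will be seen to contain the generators and to be closed under products and inverses, so they are
    the whole group.\<close>
  define S where "S g \<longleftrightarrow> (\<exists>c. c \<longlonglongrightarrow> 0 \<and> (\<forall>n. norm_bounded_by (\<pi> n g * W n - W n * \<phi> n g) (c n)))" for g
  have S_mult: "S (a + a', b + b')" if S: "S (a, b)" "S (a', b')" for a b a' b'
  proof -
    obtain c c' where c: "c \<longlonglongrightarrow> 0" "\<And>n. norm_bounded_by (\<pi> n (a, b) * W n - W n * \<phi> n (a, b)) (c n)"
      and c': "c' \<longlonglongrightarrow> 0" "\<And>n. norm_bounded_by (\<pi> n (a', b') * W n - W n * \<phi> n (a', b')) (c' n)"
      using S unfolding S_def by blast
    have "norm_bounded_by (\<pi> n (a + a', b + b') * W n - W n * \<phi> n (a + a', b + b')) (c' n + c n + def (a, b) (a', b') n)" for n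
      unfolding \<pi>_mult using def[of n "(a, b)" "(a', b')"]
      by (intro intertwine_mult[OF iso \<pi> \<pi> \<phi> \<phi> \<phi> c(2) c'(2)]) simp
    moreover have "(\<lambda>n. c' n + c n + def (a, b) (a', b') n) \<longlonglongrightarrow> 0"
      using tendsto_add[OF tendsto_add[OF c'(1) c(1)] lim_def] by simp
    ultimately show ?thesis unfolding S_def by blast
  qed
  have idem: "norm_bounded_by (\<phi> n (0, 0) - \<phi> n (0, 0) * \<phi> n (0, 0)) (def (0, 0) (0, 0) n)" for n
    using def[of n "(0, 0)" "(0, 0)"] by simp
  have S_one: "S (0, 0)"
    unfolding S_def \<pi>_gen using intertwine_one[OF iso \<phi> idem] lim_def by blast
  have S_inv: "S (- a, - b)" if S: "S (a, b)" for a b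
  proof -
    obtain c where c: "c \<longlonglongrightarrow> 0" "\<And>n. norm_bounded_by (\<pi> n (a, b) * W n - W n * \<phi> n (a, b)) (c n)"
      using S unfolding S_def by blast
    have "\<pi> n (a, b) * \<pi> n (- a, - b) = 1\<^sub>m (k n)" for n
      unfolding \<pi>_mult[symmetric] by (simp add: \<pi>_gen)
    then have "norm_bounded_by (\<pi> n (- a, - b) * W n - W n * \<phi> n (- a, - b))
        (def (0, 0) (0, 0) n + def (a, b) (- a, - b) n + c n)" for n
      using def[of n "(a, b)" "(- a, - b)"]
      by (intro intertwine_inverse[OF iso \<pi> \<pi> _ \<phi> \<phi> \<phi> c(2) _ idem]) simp_all
    moreover have "(\<lambda>n. def (0, 0) (0, 0) n + def (a, b) (- a, - b) n + c n) \<longlonglongrightarrow> 0"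
      using tendsto_add[OF tendsto_add[OF lim_def lim_def] c(1)] by simp
    ultimately show ?thesis unfolding S_def by blast
  qed
  have gens: "S (1, 0)" "S (0, 1)"
    unfolding S_def \<pi>_gen U_def[symmetric] V_def[symmetric] using e U'W V'W by blast+
  have nat: "S (int m, 0)" "S (0, int m)" for m
  proof (induction m)
    case (Suc m)
    show "S (int (Suc m), 0)" "S (0, int (Suc m))"
      using S_mult[OF gens(1) Suc(1)] S_mult[OF gens(2) Suc(2)] by simp_all
  qed (simp_all add: S_one)
  have "S (a, 0)" "S (0, a)" for a
    using nat[of "nat a"] S_inv[OF nat(1)[of "nat (- a)"]] S_inv[OF nat(2)[of "nat (- a)"]]
    by (cases "a \<ge> 0"; simp)+
  then have S: "S (a, b)" for a b using S_mult[of a 0 0 b] by simp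
  have compress: "(\<lambda>n. mat_op_norm (mat_adjoint (W n) * \<pi> n g * W n - \<phi> n g)) \<longlonglongrightarrow> 0" for g
  proof -
    obtain c where c: "c \<longlonglongrightarrow> 0" "\<And>n. norm_bounded_by (\<pi> n g * W n - W n * \<phi> n g) (c n)"
      using S[of "fst g" "snd g"] unfolding S_def by auto
    \<comment> \<open>The absolute value supplies the nonnegative bound that
      \<open>mat_op_norm_le\<close> asks for.\<close>
    have le: "mat_op_norm (mat_adjoint (W n) * \<pi> n g * W n - \<phi> n g) \<le> \<bar>c n\<bar>" for n
    proof (rule mat_op_norm_le)
      have "norm_bounded_by (mat_adjoint (W n) * \<pi> n g * W n - \<phi> n g) (c n)"
        by (rule compression_le[OF iso \<pi> \<phi> c(2)])
      then show "norm_bounded_by (mat_adjoint (W n) * \<pi> n g * W n - \<phi> n g) \<bar>c n\<bar>"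
        unfolding norm_bounded_by_def by (meson abs_ge_self mult_right_mono order_trans vec_l2_norm_nonneg)
    qed simp
    show ?thesis
      by (rule tendsto_sandwich[OF _ _ tendsto_const tendsto_rabs_zero[OF c(1)]])
        (simp_all add: mat_op_norm_nonneg le)
  qed
  have ratio: "(\<lambda>n. real (k n) / real (d n)) \<longlonglongrightarrow> 1"
  proof (rule tendsto_sandwich[OF _ _ tendsto_const])
    show "(\<lambda>n. 1 + e n) \<longlonglongrightarrow> 1" using tendsto_add[OF tendsto_const e, of 1] by simp
    show "\<forall>\<^sub>F n in sequentially. 1 \<le> real (k n) / real (d n)"
      using k(1) d by (simp add: pos_le_divide_eq)
    show "\<forall>\<^sub>F n in sequentially. real (k n) / real (d n) \<le> 1 + e n"
      using k(2) d by (simp add: pos_divide_le_eq)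
  qed
  show "\<exists>k W \<pi>. (\<forall>n. k n \<ge> d n) \<and>
      (\<lambda>n. real (k n) / real (d n)) \<longlonglongrightarrow> 1 \<and>
      (\<forall>n. isometry_mat (d n) (k n) (W n)) \<and>
      (\<forall>n. \<pi> n \<in> hom Z2_group (unitary_group (k n))) \<and>
      (\<forall>g\<in>carrier Z2_group.
        (\<lambda>n. mat_op_norm (mat_adjoint (W n) * \<pi> n g * W n - \<phi> n g)) \<longlonglongrightarrow> 0)"
    by (intro exI[of _ k] exI[of _ W] exI[of _ \<pi>] conjI allI ballI k(1) ratio iso hom compress)
qed

end
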